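(* The full subcategory $\mathbf{HDTS}$ of higher dimensional transition systems is a full reflective locally finitely presentable subcategory of the category $\mathbf{WHDTS}$ of weak higher dimensional transition systems. In particular, the inclusion functor $\mathbf{HDTS}\subset\mathbf{WHDTS}$ is limit-preserving and accessible.
   Context: $\Sigma$ is a fixed nonempty set of labels. A weak higher dimensional transition system is a triple $(S,\mu:L\to\Sigma,T=\bigcup_{n\ge1}T_n)$ with $S$ a set (states), $L$ a set (actions), $\mu$ a set map (labelling map) and $T_n\subset S\times L^n\times S$ ($n$-transitions) such that: - (Multiset axiom) for every permutation $\sigma$ of $\{1,\dots,n\}$, $n\ge2$, if $(\alpha,u_1,\dots,u_n,\beta)\in T$ then $(\alpha,u_{\sigma(1)},\dots,u_{\sigma(n)},\beta)\in T$; - (Coherence axiom) for $n\ge3$, $p,q\ge1$ with $p+q<n$, if $(\alpha,u_1,\dots,u_n,\beta)$, $(\alpha,u_1,\dots,u_p,\nu_1)$, $(\nu_1,u_{p+1},\dots,u_n,\beta)$, $(\alpha,u_1,\dots,u_{p+q},\nu_2)$, $(\nu_2,u_{p+q+1},\dots,u_n,\beta)$ are transitions, then $(\nu_1,u_{p+1},\dots,u_{p+q},\nu_2)$ is a transition. A morphism $f$ consists of a map $f_0$ on states and a map $\widetilde f$ on actions commuting with the labelling maps, such that $(f_0(\alpha),\widetilde f(u_1),\dots,\widetilde f(u_n),f_0(\beta))$ is a transition whenever $(\alpha,u_1,\dots,u_n,\beta)$ is. The category is $\mathbf{WHDTS}$. A higher dimensional transition system is a triple $(S,\mu:L\to\Sigma,T=\bigcup_{n\ge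 1}T_n)$ with $T_n\subset S\times L^n\times S$ satisfying the Multiset axiom and: - (CSA1) if $(\alpha,u,\beta)$ and $(\alpha,u',\beta)$ are transitions and $\mu(u)=\mu(u')$ then $u=u'$; - (CSA2) for every $n\ge2$, $1\le p<n$ and transition $(\alpha,u_1,\dots,u_n,\beta)$, there exist a unique state $\nu_1$ and a unique state $\nu_2$ such that $(\alpha,u_1,\dots,u_p,\nu_1)$, $(\nu_1,u_{p+1},\dots,u_n,\beta)$, $(\alpha,u_{p+1},\dots,u_n,\nu_2)$, $(\nu_2,u_1,\dots,u_p,\beta)$ are transitions; - (CSA3) for all states $\alpha,\beta,\nu_1,\nu_2,\nu_1',\nu_2'$, actions $u_1,\dots,u_n$ and $p,q\ge1$ with $p+q<n$, if $(\alpha,u_1,\dots,u_n,\beta)$, $(\alpha,u_1,\dots,u_p,\nu_1)$, $(\nu_1,u_{p+1},\dots,u_n,\beta)$, $(\nu_1,u_{p+1},\dots,u_{p+q},\nu_2)$, $(\nu_2,u_{p+q+1},\dots,u_n,\beta)$, $(\alpha,u_1,\dots,u_{p+q},\nu_2')$, $(\nu_2',u_{p+q+1},\dots,u_n,\beta)$, $(\alpha,u_1,\dots,u_p,\nu_1')$, $(\nu_1',u_{p+1},\dots,u_{p+q},\nu_2')$ are transitions, then $\nu_1=\nu_1'$ and $\nu_2=\nu_2'$. Every higher dimensional transition system is a weak one; $\mathbf{HDTS}$ is the full subcategory of $\mathbf{WHDTS}$ of higher dimensional transition systems. A functor between locally presentable categories is accessible if it preserves $\lambda$-directed colimits for some regular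 cardinal $\lambda$. *)

theory Defs
  imports "HOL-Library.FuncSet" "HOL-Combinatorics.Permutations"
begin

unbundle cardinal_syntax

section \<open>Small sets\<close>

text \<open>
  HOL has no type of all sets, so \<open>small\<close> is taken relative to a type \<open>'u\<close>: a set of any type is
  small if it has fewer elements than \<open>'u\<close>. When the cardinality of \<open>'u\<close> is (strongly)
  inaccessible, the small sets are, up to bijection, the sets of a Grothendieck universe and every
  notion below is the usual one. Only regularity and uncountability of that cardinal are
  required: the inaccessible case is included, and instances exist in plain HOL, e.g. a type
  whose cardinality is the successor of \<open>natLeq\<close>.
\<close>

definition small :: "'u itself \<Rightarrow> 'b set \<Rightarrow> bool" where
  "small U A \<longleftrightarrow> |A| <o |UNIV :: 'u set|"

definition universe :: "'u itself \<Rightarrow> bool" where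
  "universe U \<longleftrightarrow> natLeq <o |UNIV :: 'u set| \<and> regularCard |UNIV :: 'u set|"

definition regular_cardinal :: "'k rel \<Rightarrow> bool" where
  "regular_cardinal \<kappa> \<longleftrightarrow> Cinfinite \<kappa> \<and> regularCard \<kappa>"


section \<open>Categories, functors, limits and colimits\<close>

record ('o, 'm) cat =
  Ob :: "'o set"
  Ar :: "'m set"
  Dom :: "'m \<Rightarrow> 'o"
  Cod :: "'m \<Rightarrow> 'o"
  Id :: "'o \<Rightarrow> 'm"
  Comp :: "'m \<Rightarrow> 'm \<Rightarrow> 'm"  \<comment> \<open>\<open>Comp C g f\<close> is \<open>g\<close> after \<open>f\<close>\<close>

definition Hom :: "('o, 'm) cat \<Rightarrow> 'o \<Rightarrow> 'o \<Rightarrow> 'm set" where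
  "Hom C X Y = {f \<in> Ar C. Dom C f = X \<and> Cod C f = Y}"

locale category =
  fixes C :: "('o, 'm) cat"
  assumes dom_ob: "f \<in> Ar C \<Longrightarrow> Dom C f \<in> Ob C"
    and cod_ob: "f \<in> Ar C \<Longrightarrow> Cod C f \<in> Ob C"
    and id_hom: "X \<in> Ob C \<Longrightarrow> Id C X \<in> Hom C X X"
    and comp_hom: "f \<in> Hom C X Y \<Longrightarrow> g \<in> Hom C Y Z \<Longrightarrow> Comp C g f \<in> Hom C X Z"
    and comp_id_left: "f \<in> Hom C X Y \<Longrightarrow> Comp C (Id C Y) f = f"
    and comp_id_right: "f \<in> Hom C X Y \<Longrightarrow> Comp C f (Id C X) = f"
    and comp_assoc: "f \<in> Hom C W X \<Longrightarrow> g \<in> Hom C X Y \<Longrightarrow> h \<in> Hom C Y Z \<Longrightarrow>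
      Comp C h (Comp C g f) = Comp C (Comp C h g) f"

record ('o, 'm, 'p, 'n) cfunctor =
  omap :: "'o \<Rightarrow> 'p"
  amap :: "'m \<Rightarrow> 'n"

definition is_functor :: "('o, 'm) cat \<Rightarrow> ('p, 'n) cat \<Rightarrow> ('o, 'm, 'p, 'n) cfunctor \<Rightarrow> bool" where
  "is_functor A B F \<longleftrightarrow>
     category A \<and> category B \<and>
     (\<forall>X\<in>Ob A. omap F X \<in> Ob B) \<and>
     (\<forall>f\<in>Ar A. amap F f \<in> Hom B (omap F (Dom A f)) (omap F (Cod A f))) \<and>
     (\<forall>X\<in>Ob A. amap F (Id A X) = Id B (omap F X)) \<and>
     (\<forall>f\<in>Ar A. \<forall>g\<in>Ar A. Dom A g = Cod A f \<longrightarrow>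
        amap F (Comp A g f) = Comp B (amap F g) (amap F f))"

definition comp_functor ::
    "('p, 'n, 'q, 'r) cfunctor \<Rightarrow> ('o, 'm, 'p, 'n) cfunctor \<Rightarrow> ('o, 'm, 'q, 'r) cfunctor" where
  "comp_functor G F = \<lparr>omap = omap G \<circ> omap F, amap = amap G \<circ> amap F\<rparr>"

text \<open>Only the values of the legs \<open>c\<close> at objects of the index category \<open>J\<close> are relevant.\<close>

definition cocone ::
    "('j, 'k) cat \<Rightarrow> ('o, 'm) cat \<Rightarrow> ('j, 'k, 'o, 'm) cfunctor \<Rightarrow> 'o \<Rightarrow> ('j \<Rightarrow> 'm) \<Rightarrow> bool" where
  "cocone J C D Y c \<longleftrightarrow>
     Y \<in> Ob C \<and> (\<forall>j\<in>Ob J. c j \<in> Hom C (omap D j) Y) \<and>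
     (\<forall>a\<in>Ar J. Comp C (c (Cod J a)) (amap D a) = c (Dom J a))"

definition is_colimit ::
    "('j, 'k) cat \<Rightarrow> ('o, 'm) cat \<Rightarrow> ('j, 'k, 'o, 'm) cfunctor \<Rightarrow> 'o \<Rightarrow> ('j \<Rightarrow> 'm) \<Rightarrow> bool" where
  "is_colimit J C D X c \<longleftrightarrow>
     cocone J C D X c \<and>
     (\<forall>Y d. cocone J C D Y d \<longrightarrow>
        (\<exists>!h. h \<in> Hom C X Y \<and> (\<forall>j\<in>Ob J. Comp C h (c j) = d j)))"

definition cone ::
    "('j, 'k) cat \<Rightarrow> ('o, 'm) cat \<Rightarrow> ('j, 'k, 'o, 'm) cfunctor \<Rightarrow> 'o \<Rightarrow> ('j \<Rightarrow> 'm) \<Rightarrow> bool" where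
  "cone J C D Y c \<longleftrightarrow>
     Y \<in> Ob C \<and> (\<forall>j\<in>Ob J. c j \<in> Hom C Y (omap D j)) \<and>
     (\<forall>a\<in>Ar J. Comp C (amap D a) (c (Dom J a)) = c (Cod J a))"

definition is_limit ::
    "('j, 'k) cat \<Rightarrow> ('o, 'm) cat \<Rightarrow> ('j, 'k, 'o, 'm) cfunctor \<Rightarrow> 'o \<Rightarrow> ('j \<Rightarrow> 'm) \<Rightarrow> bool" where
  "is_limit J C D X c \<longleftrightarrow>
     cone J C D X c \<and>
     (\<forall>Y d. cone J C D Y d \<longrightarrow>
        (\<exists>!h. h \<in> Hom C Y X \<and> (\<forall>j\<in>Ob J. Comp C (c j) h = d j)))"

text \<open>Every small category is isomorphic to one whose objects and arrows are elements of \<open>'u\<close>.\<close>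

definition small_category :: "('u, 'u) cat \<Rightarrow> bool" where
  "small_category J \<longleftrightarrow> category J \<and> small TYPE('u) (Ob J) \<and> small TYPE('u) (Ar J)"

definition cocomplete :: "'u itself \<Rightarrow> ('o, 'm) cat \<Rightarrow> bool" where
  "cocomplete U C \<longleftrightarrow>
     (\<forall>(J :: ('u, 'u) cat) D. small_category J \<and> is_functor J C D \<longrightarrow>
        (\<exists>X c. is_colimit J C D X c))"

definition limit_preserving ::
    "'u itself \<Rightarrow> ('o, 'm) cat \<Rightarrow> ('p, 'n) cat \<Rightarrow> ('o, 'm, 'p, 'n) cfunctor \<Rightarrow> bool" where
  "limit_preserving U A B F \<longleftrightarrow>
     is_functor A B F \<and>
     (\<forall>(J :: ('u, 'u) cat) D X c.
        small_category J \<and> is_functor J A D \<and> is_limit J A D X c \<longrightarrow>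
        is_limit J B (comp_functor F D) (omap F X) (amap F \<circ> c))"


section \<open>Directed colimits, presentable objects, accessible functors\<close>

text \<open>The case \<open>K = {}\<close> makes a directed poset nonempty. For \<open>\<kappa> = natLeq\<close> the sets \<open>K\<close> are the
  finite ones.\<close>

definition directed_poset :: "'k rel \<Rightarrow> 'i set \<Rightarrow> 'i rel \<Rightarrow> bool" where
  "directed_poset \<kappa> I r \<longleftrightarrow>
     partial_order_on I r \<and>
     (\<forall>K\<subseteq>I. |K| <o \<kappa> \<longrightarrow> (\<exists>b\<in>I. \<forall>k\<in>K. (k, b) \<in> r))"

definition poset_cat :: "'i set \<Rightarrow> 'i rel \<Rightarrow> ('i, 'i \<times> 'i) cat" where
  "poset_cat I r = \<lparr>Ob = I, Ar = r, Dom = fst, Cod = snd, Id = (\<lambda>i. (i, i)),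
     Comp = (\<lambda>g f. (fst f, snd g))\<rparr>"

definition preserves_directed_colimits ::
    "'u itself \<Rightarrow> 'k rel \<Rightarrow> ('o, 'm) cat \<Rightarrow> ('p, 'n) cat \<Rightarrow> ('o, 'm, 'p, 'n) cfunctor \<Rightarrow> bool" where
  "preserves_directed_colimits U \<kappa> A B F \<longleftrightarrow>
     (\<forall>(I :: 'u set) r D X c.
        small U I \<and> directed_poset \<kappa> I r \<and> is_functor (poset_cat I r) A D \<and>
        is_colimit (poset_cat I r) A D X c \<longrightarrow>
        is_colimit (poset_cat I r) B (comp_functor F D) (omap F X) (amap F \<circ> c))"

text \<open>Sets and maps, the sets being arbitrary subsets of a type \<open>'x\<close>. An arrow is a triple of a
  source, an extensional function and a target. It is used with \<open>'x\<close> the type of arrows of a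
  category \<open>C\<close>, so that the hom-sets of \<open>C\<close> are among its objects.\<close>

definition set_cat :: "('x set, 'x set \<times> ('x \<Rightarrow> 'x) \<times> 'x set) cat" where
  "set_cat = \<lparr>Ob = UNIV, Ar = {(A, f, B). f \<in> A \<rightarrow>\<^sub>E B},
     Dom = (\<lambda>(A, f, B). A), Cod = (\<lambda>(A, f, B). B), Id = (\<lambda>A. (A, restrict id A, A)),
     Comp = (\<lambda>(B', g, Z) (A, f, B). (A, compose A g f, Z))\<rparr>"

definition hom_functor ::
    "('o, 'm) cat \<Rightarrow> 'o \<Rightarrow> ('o, 'm, 'm set, 'm set \<times> ('m \<Rightarrow> 'm) \<times> 'm set) cfunctor" where
  "hom_functor C K = \<lparr>omap = (\<lambda>Y. Hom C K Y),
     amap = (\<lambda>g. (Hom C K (Dom C g), \<lambda>f\<in>Hom C K (Dom C g). Comp C g f, Hom C K (Cod C g)))\<rparr>"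

definition presentable :: "'u itself \<Rightarrow> 'k rel \<Rightarrow> ('o, 'm) cat \<Rightarrow> 'o \<Rightarrow> bool" where
  "presentable U \<kappa> C K \<longleftrightarrow>
     K \<in> Ob C \<and> preserves_directed_colimits U \<kappa> C set_cat (hom_functor C K)"

definition locally_presentable_at :: "'u itself \<Rightarrow> 'k rel \<Rightarrow> ('o, 'm) cat \<Rightarrow> bool" where
  "locally_presentable_at U \<kappa> C \<longleftrightarrow>
     category C \<and> cocomplete U C \<and>
     (\<exists>\<G>. small U \<G> \<and> (\<forall>K\<in>\<G>. presentable U \<kappa> C K) \<and>
        (\<forall>X\<in>Ob C. \<exists>(I :: 'u set) r D c.
           small U I \<and> directed_poset \<kappa> I r \<and> is_functor (poset_cat I r) C D \<and>
           (\<forall>i\<in>I. omap D i \<in> \<G>) \<and> is_colimit (poset_cat I r) C D X c))"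

definition locally_finitely_presentable :: "'u itself \<Rightarrow> ('o, 'm) cat \<Rightarrow> bool" where
  "locally_finitely_presentable U C \<longleftrightarrow> locally_presentable_at U natLeq C"

definition locally_presentable :: "'u itself \<Rightarrow> ('o, 'm) cat \<Rightarrow> bool" where
  "locally_presentable U C \<longleftrightarrow>
     (\<exists>\<kappa> :: 'u rel. regular_cardinal \<kappa> \<and> \<kappa> <o |UNIV :: 'u set| \<and> locally_presentable_at U \<kappa> C)"

definition accessible ::
    "'u itself \<Rightarrow> ('o, 'm) cat \<Rightarrow> ('p, 'n) cat \<Rightarrow> ('o, 'm, 'p, 'n) cfunctor \<Rightarrow> bool" where
  "accessible U A B F \<longleftrightarrow>
     locally_presentable U A \<and> locally_presentable U B \<and> is_functor A B F \<and>
     (\<exists>\<kappa> :: 'u rel. regular_cardinal \<kappa> \<and> \<kappa> <o |UNIV :: 'u set| \<and>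
        preserves_directed_colimits U \<kappa> A B F)"


section \<open>Full and reflective subcategories\<close>

definition full_subcategory :: "('o, 'm) cat \<Rightarrow> ('o, 'm) cat \<Rightarrow> bool" where
  "full_subcategory A B \<longleftrightarrow>
     category A \<and> category B \<and> Ob A \<subseteq> Ob B \<and>
     (\<forall>X\<in>Ob A. \<forall>Y\<in>Ob A. Hom A X Y = Hom B X Y) \<and>
     (\<forall>X\<in>Ob A. Id A X = Id B X) \<and>
     (\<forall>f\<in>Ar A. \<forall>g\<in>Ar A. Dom A g = Cod A f \<longrightarrow> Comp A g f = Comp B g f)"

definition inclusion :: "('o, 'm, 'o, 'm) cfunctor" where
  "inclusion = \<lparr>omap = (\<lambda>X. X), amap = (\<lambda>f. f)\<rparr>"

definition is_reflection :: "('o, 'm) cat \<Rightarrow> ('o, 'm) cat \<Rightarrow> 'o \<Rightarrow> 'o \<Rightarrow> 'm \<Rightarrow> bool" where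
  "is_reflection A B X R \<eta> \<longleftrightarrow>
     R \<in> Ob A \<and> \<eta> \<in> Hom B X R \<and>
     (\<forall>Y\<in>Ob A. \<forall>f\<in>Hom B X Y. \<exists>!g. g \<in> Hom A R Y \<and> Comp B g \<eta> = f)"

definition full_reflective_subcategory :: "('o, 'm) cat \<Rightarrow> ('o, 'm) cat \<Rightarrow> bool" where
  "full_reflective_subcategory A B \<longleftrightarrow>
     full_subcategory A B \<and> (\<forall>X\<in>Ob B. \<exists>R \<eta>. is_reflection A B X R \<eta>)"


section \<open>Weak higher dimensional transition systems\<close>

text \<open>The transition \<open>(\<alpha>, u\<^sub>1, \<dots>, u\<^sub>n, \<beta>)\<close> is the triple \<open>(\<alpha>, [u\<^sub>1, \<dots>, u\<^sub>n], \<beta>)\<close>. With \<open>0\<close>-based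
  lists, \<open>u\<^sub>1, \<dots>, u\<^sub>p\<close> is \<open>take p us\<close>, \<open>u\<^sub>p\<^sub>+\<^sub>1, \<dots>, u\<^sub>n\<close> is \<open>drop p us\<close>, and
  \<open>u\<^sub>p\<^sub>+\<^sub>1, \<dots>, u\<^sub>p\<^sub>+\<^sub>q\<close> is \<open>take q (drop p us)\<close>.\<close>

record ('u, 'a) tsystem =
  states :: "'u set"
  actions :: "'u set"
  label :: "'u \<Rightarrow> 'a"
  trans :: "('u \<times> 'u list \<times> 'u) set"

definition pre_tsystem :: "'a set \<Rightarrow> ('u, 'a) tsystem \<Rightarrow> bool" where
  "pre_tsystem \<Sigma> X \<longleftrightarrow>
     small TYPE('u) (states X) \<and> small TYPE('u) (actions X) \<and>
     label X \<in> actions X \<rightarrow>\<^sub>E \<Sigma> \<and>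
     trans X \<subseteq> {(\<alpha>, us, \<beta>). \<alpha> \<in> states X \<and> us \<in> lists (actions X) \<and> us \<noteq> [] \<and> \<beta> \<in> states X}"

definition multiset_axiom :: "('u, 'a) tsystem \<Rightarrow> bool" where
  "multiset_axiom X \<longleftrightarrow>
     (\<forall>\<alpha> us \<beta> \<sigma>. 2 \<le> length us \<and> \<sigma> permutes {..<length us} \<and> (\<alpha>, us, \<beta>) \<in> trans X \<longrightarrow>
        (\<alpha>, permute_list \<sigma> us, \<beta>) \<in> trans X)"

definition coherence_axiom :: "('u, 'a) tsystem \<Rightarrow> bool" where
  "coherence_axiom X \<longleftrightarrow>
     (\<forall>\<alpha> us \<beta> \<nu>1 \<nu>2 p q.
        3 \<le> length us \<and> 1 \<le> p \<and> 1 \<le> q \<and> p + q < length us \<and>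
        (\<alpha>, us, \<beta>) \<in> trans X \<and>
        (\<alpha>, take p us, \<nu>1) \<in> trans X \<and> (\<nu>1, drop p us, \<beta>) \<in> trans X \<and>
        (\<alpha>, take (p + q) us, \<nu>2) \<in> trans X \<and> (\<nu>2, drop (p + q) us, \<beta>) \<in> trans X \<longrightarrow>
        (\<nu>1, take q (drop p us), \<nu>2) \<in> trans X)"

definition weak_hdts :: "'a set \<Rightarrow> ('u, 'a) tsystem \<Rightarrow> bool" where
  "weak_hdts \<Sigma> X \<longleftrightarrow> pre_tsystem \<Sigma> X \<and> multiset_axiom X \<and> coherence_axiom X"

record ('u, 'a) tmorphism =
  source :: "('u, 'a) tsystem"
  target :: "('u, 'a) tsystem"
  on_states :: "'u \<Rightarrow> 'u"
  on_actions :: "'u \<Rightarrow> 'u"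

definition is_tmorphism :: "('u, 'a) tmorphism \<Rightarrow> bool" where
  "is_tmorphism f \<longleftrightarrow>
     on_states f \<in> states (source f) \<rightarrow>\<^sub>E states (target f) \<and>
     on_actions f \<in> actions (source f) \<rightarrow>\<^sub>E actions (target f) \<and>
     (\<forall>u\<in>actions (source f). label (target f) (on_actions f u) = label (source f) u) \<and>
     (\<forall>\<alpha> us \<beta>. (\<alpha>, us, \<beta>) \<in> trans (source f) \<longrightarrow>
        (on_states f \<alpha>, map (on_actions f) us, on_states f \<beta>) \<in> trans (target f))"

definition tsystem_cat ::
    "('u, 'a) tsystem set \<Rightarrow> (('u, 'a) tsystem, ('u, 'a) tmorphism) cat" where
  "tsystem_cat \<O> = \<lparr>
     Ob = \<O>,
     Ar = {f. is_tmorphism f \<and> source f \<in> \<O> \<and> target f \<in> \<O>},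
     Dom = source,
     Cod = target,
     Id = (\<lambda>X. \<lparr>source = X, target = X,
             on_states = restrict id (states X), on_actions = restrict id (actions X)\<rparr>),
     Comp = (\<lambda>g f. \<lparr>source = source f, target = target g,
             on_states = compose (states (source f)) (on_states g) (on_states f),
             on_actions = compose (actions (source f)) (on_actions g) (on_actions f)\<rparr>)\<rparr>"

definition WHDTS :: "'a set \<Rightarrow> (('u, 'a) tsystem, ('u, 'a) tmorphism) cat" where
  "WHDTS \<Sigma> = tsystem_cat {X. weak_hdts \<Sigma> X}"


section \<open>Higher dimensional transition systems\<close>

definition CSA1 :: "('u, 'a) tsystem \<Rightarrow> bool" where
  "CSA1 X \<longleftrightarrow>
     (\<forall>\<alpha> \<beta> u u'. (\<alpha>, [u], \<beta>) \<in> trans X \<and> (\<alpha>, [u'], \<beta>) \<in> trans X \<and> label X u = label X u' \<longrightarrow>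
        u = u')"

definition CSA2 :: "('u, 'a) tsystem \<Rightarrow> bool" where
  "CSA2 X \<longleftrightarrow>
     (\<forall>\<alpha> us \<beta> p. 2 \<le> length us \<and> 1 \<le> p \<and> p < length us \<and> (\<alpha>, us, \<beta>) \<in> trans X \<longrightarrow>
        (\<exists>!\<nu>1. \<nu>1 \<in> states X \<and> (\<alpha>, take p us, \<nu>1) \<in> trans X \<and> (\<nu>1, drop p us, \<beta>) \<in> trans X) \<and>
        (\<exists>!\<nu>2. \<nu>2 \<in> states X \<and> (\<alpha>, drop p us, \<nu>2) \<in> trans X \<and> (\<nu>2, take p us, \<beta>) \<in> trans X))"

definition CSA3 :: "('u, 'a) tsystem \<Rightarrow> bool" where
  "CSA3 X \<longleftrightarrow>
     (\<forall>\<alpha> us \<beta> \<nu>1 \<nu>2 \<nu>1' \<nu>2' p q.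
        1 \<le> p \<and> 1 \<le> q \<and> p + q < length us \<and>
        (\<alpha>, us, \<beta>) \<in> trans X \<and>
        (\<alpha>, take p us, \<nu>1) \<in> trans X \<and> (\<nu>1, drop p us, \<beta>) \<in> trans X \<and>
        (\<nu>1, take q (drop p us), \<nu>2) \<in> trans X \<and> (\<nu>2, drop (p + q) us, \<beta>) \<in> trans X \<and>
        (\<alpha>, take (p + q) us, \<nu>2') \<in> trans X \<and> (\<nu>2', drop (p + q) us, \<beta>) \<in> trans X \<and>
        (\<alpha>, take p us, \<nu>1') \<in> trans X \<and> (\<nu>1', take q (drop p us), \<nu>2') \<in> trans X \<longrightarrow>
        \<nu>1 = \<nu>1' \<and> \<nu>2 = \<nu>2')"

definition hdts :: "'a set \<Rightarrow> ('u, 'a) tsystem \<Rightarrow> bool" where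
  "hdts \<Sigma> X \<longleftrightarrow> pre_tsystem \<Sigma> X \<and> multiset_axiom X \<and> CSA1 X \<and> CSA2 X \<and> CSA3 X"

definition HDTS :: "'a set \<Rightarrow> (('u, 'a) tsystem, ('u, 'a) tmorphism) cat" where
  "HDTS \<Sigma> = tsystem_cat {X. hdts \<Sigma> X}"

end

theory Submission
  imports Defs
begin

text \<open>
  Every axiom of a weak or of a higher dimensional transition system speaks of finitely many
  states, actions and transitions: from certain transitions it infers another transition, an
  equality, or the existence of a unique intermediate state. Two constructions respect axioms of
  this kind, and they carry the proof.

  \<^item> \<^emph>\<open>Directed colimits are computed elementwise.\<close> In a directed colimit every element comes from
    a stage, and finitely many states, actions and transitions occur together at one stage
    (\<open>finite_lift\<close>). So the axioms pass from the stages to the colimit, the inclusion preserves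
    directed colimits, and finite weak systems are finitely presentable
    (\<open>finite_directed_lifting\<close>). A weak system is the directed union of the finite systems
    obtained by keeping finitely many states and actions and bounding the length of the
    transitions (\<open>weak_hdts_directed_union\<close>). The finite systems live, up to isomorphism, on a
    fixed countable set, hence form a small set.

  \<^item> \<^emph>\<open>Joint images.\<close> Let a family of maps send a set of names to the states and actions of given
    systems. Identify the names that no map separates, and call transition whatever becomes one
    under every map (\<open>joint_image\<close>). The axioms can be tested map by map, and so hold in the
    result if they hold in the targets; only the existence of intermediate states must be provided
    for. Applied to all cocones under a diagram of weak systems this gives its colimit. Applied to
    all morphisms from a weak system to higher dimensional transition systems, with formal
    intermediate states adjoined to the names, it gives the reflection (\<open>hdts_reflection\<close>). There
    may be too many maps for a product of the targets to be small, but the set of names is small,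
    and so is its quotient.

  The rest holds for any full reflective subcategory: limits are preserved, and colimits and
  generators are obtained by reflecting those of the ambient category, the generators remaining
  finitely presentable when the inclusion preserves directed colimits
  (\<open>directed_generation_subcategory\<close>).
\<close>

section \<open>Arithmetic of small sets\<close>

lemma universe_Cinfinite: "universe TYPE('u) \<Longrightarrow> Cinfinite |UNIV :: 'u set|"
  unfolding universe_def cinfinite_def
  by (metis card_of_Card_order Field_card_of finite_iff_ordLess_natLeq not_ordLess_ordLeq
      ordLess_imp_ordLeq)

lemma small_image: "small U A \<Longrightarrow> small U (f ` A)"
  unfolding small_def by (meson card_of_image ordLeq_ordLess_trans)

lemma small_subset: "small U B \<Longrightarrow> A \<subseteq> B \<Longrightarrow> small U A"
  unfolding small_def by (meson card_of_mono1 ordLeq_ordLess_trans)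

text \<open>Uncountability of \<open>'u\<close> makes \<open>small_nat\<close> true, and its regularity makes \<open>small_UN\<close> true;
  lists, finite subsets and closures under finitary operations are then small as countable
  unions.\<close>

lemma small_nat:
  assumes "universe TYPE('u)" shows "small TYPE('u) (A :: nat set)"
proof -
  have "|UNIV :: nat set| <o |UNIV :: 'u set|"
    using assms unfolding universe_def using card_of_nat ordIso_ordLess_trans by blast
  then show ?thesis unfolding small_def by (meson card_of_mono1 ordLeq_ordLess_trans subset_UNIV)
qed

lemma small_finite:
  assumes "universe TYPE('u)" "finite A" shows "small TYPE('u) A"
  using assms unfolding small_def universe_def
  by (meson finite_iff_ordLess_natLeq ordLess_transitive)

lemma small_UN:
  assumes "universe TYPE('u)" "small TYPE('u) I" "\<And>i. i \<in> I \<Longrightarrow> small TYPE('u) (A i)"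
  shows "small TYPE('u) (\<Union>i\<in>I. A i)"
  using assms universe_Cinfinite[OF assms(1)] unfolding small_def universe_def
  by (intro card_of_UNION_ordLess_infinite_Field_regularCard) auto

lemma small_Sigma:
  assumes "universe TYPE('u)" "small TYPE('u) I" "\<And>i. i \<in> I \<Longrightarrow> small TYPE('u) (A i)"
  shows "small TYPE('u) (Sigma I A)"
proof -
  have "Sigma I A = (\<Union>i\<in>I. Pair i ` A i)" by auto
  moreover have "small TYPE('u) (\<Union>i\<in>I. Pair i ` A i)"
    by (intro small_UN assms small_image)
  ultimately show ?thesis by simp
qed

lemma small_lists:
  assumes "universe TYPE('u)" "small TYPE('u) A"
  shows "small TYPE('u) (lists A)"
proof -
  have "small TYPE('u) {xs \<in> lists A. length xs = n}" for n
  proof (induction n)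
    case 0
    show ?case by (rule small_finite[OF assms(1)]) (auto intro: finite_subset[of _ "{[]}"])
  next
    case (Suc n)
    have "{xs \<in> lists A. length xs = Suc n} \<subseteq>
        (\<lambda>(x, xs). x # xs) ` (A \<times> {xs \<in> lists A. length xs = n})"
    proof
      fix ys assume "ys \<in> {xs \<in> lists A. length xs = Suc n}"
      then obtain x xs where "ys = x # xs" "x \<in> A" "xs \<in> lists A" "length xs = n"
        by (cases ys) auto
      then show "ys \<in> (\<lambda>(x, xs). x # xs) ` (A \<times> {xs \<in> lists A. length xs = n})"
        by (intro image_eqI[of _ _ "(x, xs)"]) auto
    qed
    then show ?case
      by (rule small_subset[rotated]) (intro small_image small_Sigma assms Suc)
  qed
  then have "small TYPE('u) (\<Union>n. {xs \<in> lists A. length xs = n})"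
    by (intro small_UN[OF assms(1) small_nat[OF assms(1)]])
  moreover have "(\<Union>n. {xs \<in> lists A. length xs = n}) = lists A" by blast
  ultimately show ?thesis by simp
qed

lemma small_Fpow:
  assumes "universe TYPE('u)" "small TYPE('u) A"
  shows "small TYPE('u) (Fpow A)"
proof (rule small_subset)
  show "small TYPE('u) (set ` lists A)" by (intro small_image small_lists assms)
  show "Fpow A \<subseteq> set ` lists A"
    by (auto simp: Fpow_def image_iff in_lists_conv_set dest!: finite_list)
qed

text \<open>A small set has a copy inside \<open>'u\<close>; this is how quotients of small sets of any type are made
  into sets of states or of actions.\<close>

lemma small_encode:
  assumes "small TYPE('u) A"
  obtains e :: "'x \<Rightarrow> 'u" where "inj_on e A"
  using assms unfolding small_def by (metis card_of_ordLeq ordLess_imp_ordLeq)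

lemma small_quotient_encode:
  assumes "small TYPE('u) A" and "\<And>x. x \<in> A \<Longrightarrow> R x x"
    and "\<And>x y. x \<in> A \<Longrightarrow> y \<in> A \<Longrightarrow> R x y \<Longrightarrow> R y x"
    and "\<And>x y z. x \<in> A \<Longrightarrow> y \<in> A \<Longrightarrow> z \<in> A \<Longrightarrow> R x y \<Longrightarrow> R y z \<Longrightarrow> R x z"
  obtains e :: "'x \<Rightarrow> 'u" where "\<And>x y. x \<in> A \<Longrightarrow> y \<in> A \<Longrightarrow> e x = e y \<longleftrightarrow> R x y"
proof -
  let ?cl = "\<lambda>x. {z \<in> A. R x z}"
  obtain e0 :: "'x set \<Rightarrow> 'u" where e0: "inj_on e0 (?cl ` A)"
    using small_encode[OF small_image[OF assms(1), of ?cl]] by blast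
  have "e0 (?cl x) = e0 (?cl y) \<longleftrightarrow> R x y" if "x \<in> A" "y \<in> A" for x y
  proof -
    have "e0 (?cl x) = e0 (?cl y) \<longleftrightarrow> ?cl x = ?cl y"
      by (rule inj_on_eq_iff[OF e0]) (use that in auto)
    also have "\<dots> \<longleftrightarrow> R x y" using that assms(2,3,4) by blast
    finally show ?thesis .
  qed
  then show ?thesis using that[of "\<lambda>x. e0 (?cl x)"] by blast
qed

lemma universe_nat_embedding:
  assumes "universe TYPE('u)"
  obtains \<nu> :: "nat \<Rightarrow> 'u" where "inj \<nu>"
  using small_encode[OF small_nat[OF assms, of UNIV]] by blast

section \<open>Colimits and presentable objects\<close>

lemma is_functorD:
  assumes "is_functor J C D"
  shows "category J" "category C" "\<And>X. X \<in> Ob J \<Longrightarrow> omap D X \<in> Ob C"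
    "\<And>f X Y. f \<in> Hom J X Y \<Longrightarrow> amap D f \<in> Hom C (omap D X) (omap D Y)"
    "\<And>X. X \<in> Ob J \<Longrightarrow> amap D (Id J X) = Id C (omap D X)"
    "\<And>f g X Y Z. f \<in> Hom J X Y \<Longrightarrow> g \<in> Hom J Y Z \<Longrightarrow>
       amap D (Comp J g f) = Comp C (amap D g) (amap D f)"
  using assms unfolding is_functor_def Hom_def by auto

lemma arrow_in_Hom: "f \<in> Ar C \<Longrightarrow> f \<in> Hom C (Dom C f) (Cod C f)"
  by (simp add: Hom_def)

lemma Hom_ob: "category C \<Longrightarrow> f \<in> Hom C X Y \<Longrightarrow> X \<in> Ob C \<and> Y \<in> Ob C"
  unfolding Hom_def by (auto simp: category.dom_ob category.cod_ob)

lemma colimit_unique: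
  assumes D: "is_functor J C D" and X: "is_colimit J C D X c" and X': "is_colimit J C D X' c'"
  obtains h h' where "h \<in> Hom C X X'" "h' \<in> Hom C X' X"
    "Comp C h' h = Id C X" "Comp C h h' = Id C X'" "\<And>j. j \<in> Ob J \<Longrightarrow> Comp C h (c j) = c' j"
    "\<And>j. j \<in> Ob J \<Longrightarrow> Comp C h' (c' j) = c j"
proof -
  interpret C: category C using is_functorD(2)[OF D] .
  have inv: "Comp C k' k = Id C Z"
    if Z: "is_colimit J C D Z e" and Z': "is_colimit J C D Z' e'"
      and k: "k \<in> Hom C Z Z'" "\<And>j. j \<in> Ob J \<Longrightarrow> Comp C k (e j) = e' j"
      and k': "k' \<in> Hom C Z' Z" "\<And>j. j \<in> Ob J \<Longrightarrow> Comp C k' (e' j) = e j" for Z e Z' e' k k'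
  proof -
    have e: "e j \<in> Hom C (omap D j) Z" if "j \<in> Ob J" for j
      using Z that by (auto simp: is_colimit_def cocone_def)
    have "Z \<in> Ob C" using Z by (auto simp: is_colimit_def cocone_def)
    then have "Id C Z \<in> Hom C Z Z" "\<And>j. j \<in> Ob J \<Longrightarrow> Comp C (Id C Z) (e j) = e j"
      using C.comp_id_left[OF e] C.id_hom by blast+
    moreover have "Comp C k' k \<in> Hom C Z Z" using k k' C.comp_hom by blast
    moreover have "Comp C (Comp C k' k) (e j) = e j" if "j \<in> Ob J" for j
      using C.comp_assoc[OF e[OF that] k(1) k'(1)] k(2)[OF that] k'(2)[OF that] by simp
    ultimately show ?thesis
      using Z unfolding is_colimit_def by blast
  qed
  have "\<exists>h. h \<in> Hom C X X' \<and> (\<forall>j\<in>Ob J. Comp C h (c j) = c' j)"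
    "\<exists>h. h \<in> Hom C X' X \<and> (\<forall>j\<in>Ob J. Comp C h (c' j) = c j)"
    using X X' unfolding is_colimit_def by blast+
  then show ?thesis using that inv[OF X X'] inv[OF X' X] by metis
qed

lemma colimit_factor:
  assumes "is_colimit J C D X c" and "cocone J C D Y d"
  shows "\<exists>h\<in>Hom C X Y. (\<forall>j\<in>Ob J. Comp C h (c j) = d j) \<and>
    (\<forall>h'\<in>Hom C X Y. (\<forall>j\<in>Ob J. Comp C h' (c j) = d j) \<longrightarrow> h' = h)"
proof -
  have "\<exists>!h. h \<in> Hom C X Y \<and> (\<forall>j\<in>Ob J. Comp C h (c j) = d j)"
    using assms unfolding is_colimit_def by blast
  then show ?thesis by (elim ex1E) blast
qed

lemma limit_factor:
  assumes "is_limit J C D X c" and "cone J C D Y d"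
  shows "\<exists>h\<in>Hom C Y X. (\<forall>j\<in>Ob J. Comp C (c j) h = d j) \<and>
    (\<forall>h'\<in>Hom C Y X. (\<forall>j\<in>Ob J. Comp C (c j) h' = d j) \<longrightarrow> h' = h)"
proof -
  have "\<exists>!h. h \<in> Hom C Y X \<and> (\<forall>j\<in>Ob J. Comp C (c j) h = d j)"
    using assms unfolding is_limit_def by blast
  then show ?thesis by (elim ex1E) blast
qed

lemma directed_poset_cong: "\<kappa> =o \<kappa>' \<Longrightarrow> directed_poset \<kappa> I r = directed_poset \<kappa>' I r"
  unfolding directed_poset_def by (meson ordIso_symmetric ordLess_ordIso_trans)

lemma locally_presentable_at_cong:
  "\<kappa> =o \<kappa>' \<Longrightarrow> locally_presentable_at U \<kappa> C = locally_presentable_at U \<kappa>' C"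
  unfolding locally_presentable_at_def presentable_def preserves_directed_colimits_def
  by (simp add: directed_poset_cong)

lemma preserves_directed_colimits_cong:
  "\<kappa> =o \<kappa>' \<Longrightarrow> preserves_directed_colimits U \<kappa> A B F = preserves_directed_colimits U \<kappa>' A B F"
  unfolding preserves_directed_colimits_def by (simp add: directed_poset_cong)

lemma directed_poset_finite_bound:
  "directed_poset natLeq I r \<Longrightarrow> finite K \<Longrightarrow> K \<subseteq> I \<Longrightarrow> \<exists>b\<in>I. \<forall>k\<in>K. (k, b) \<in> r"
  unfolding directed_poset_def using finite_iff_ordLess_natLeq by blast

lemma directed_posetD:
  assumes "directed_poset natLeq I r"
  shows "\<And>i j. (i, j) \<in> r \<Longrightarrow> i \<in> I \<and> j \<in> I" "\<And>i. i \<in> I \<Longrightarrow> (i, i) \<in> r"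
    "\<And>i j k. (i, j) \<in> r \<Longrightarrow> (j, k) \<in> r \<Longrightarrow> (i, k) \<in> r"
    "\<And>i j. i \<in> I \<Longrightarrow> j \<in> I \<Longrightarrow> \<exists>k. (i, k) \<in> r \<and> (j, k) \<in> r" "I \<noteq> {}"
proof -
  have p: "partial_order_on I r" using assms by (simp add: directed_poset_def)
  show "(i, j) \<in> r \<Longrightarrow> i \<in> I \<and> j \<in> I" for i j
    using p unfolding partial_order_on_def preorder_on_def by auto
  show "i \<in> I \<Longrightarrow> (i, i) \<in> r" for i
    using p unfolding partial_order_on_def preorder_on_def refl_on_def by auto
  show "(i, j) \<in> r \<Longrightarrow> (j, k) \<in> r \<Longrightarrow> (i, k) \<in> r" for i j k
    using p unfolding partial_order_on_def preorder_on_def by (meson transE)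
  show "\<exists>k. (i, k) \<in> r \<and> (j, k) \<in> r" if "i \<in> I" "j \<in> I" for i j
    using directed_poset_finite_bound[OF assms, of "{i, j}"] that by auto
  show "I \<noteq> {}" using directed_poset_finite_bound[OF assms, of "{}"] by auto
qed

lemma poset_cat_simps [simp]:
  "Ob (poset_cat I r) = I" "Ar (poset_cat I r) = r" "Dom (poset_cat I r) = fst"
  "Cod (poset_cat I r) = snd" "Id (poset_cat I r) i = (i, i)"
  "Comp (poset_cat I r) g f = (fst f, snd g)"
  by (auto simp: poset_cat_def)

lemma poset_cat_category:
  assumes "directed_poset natLeq I r"
  shows "category (poset_cat I r)"
proof -
  note r = directed_posetD(1-3)[OF assms]
  show ?thesis by unfold_locales (use r in \<open>auto simp: Hom_def\<close>)
qed

lemma poset_Hom: "(i, j) \<in> r \<Longrightarrow> (i, j) \<in> Hom (poset_cat I r) i j"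
  by (simp add: Hom_def)

text \<open>The elementwise form of the finite presentability of \<open>K\<close>: a morphism from \<open>K\<close> to a directed
  colimit comes from some stage, and two morphisms to one stage with the same image in the colimit
  already agree at a later stage.\<close>

definition directed_lifting :: "'u itself \<Rightarrow> ('o, 'm) cat \<Rightarrow> 'o \<Rightarrow> bool" where
  "directed_lifting U C K \<longleftrightarrow> K \<in> Ob C \<and>
     (\<forall>(I :: 'u set) r D X c.
        small U I \<and> directed_poset natLeq I r \<and> is_functor (poset_cat I r) C D \<and>
        is_colimit (poset_cat I r) C D X c \<longrightarrow>
        (\<forall>f\<in>Hom C K X. \<exists>i\<in>I. \<exists>g\<in>Hom C K (omap D i). Comp C (c i) g = f) \<and>
        (\<forall>i\<in>I. \<forall>g\<in>Hom C K (omap D i). \<forall>g'\<in>Hom C K (omap D i).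
           Comp C (c i) g = Comp C (c i) g' \<longrightarrow>
           (\<exists>j. (i, j) \<in> r \<and> Comp C (amap D (i, j)) g = Comp C (amap D (i, j)) g')))"

lemma directed_liftingD:
  fixes I :: "'u set"
  assumes "directed_lifting TYPE('u) C K" "small TYPE('u) I" "directed_poset natLeq I r"
    "is_functor (poset_cat I r) C D" "is_colimit (poset_cat I r) C D X c"
  shows "f \<in> Hom C K X \<Longrightarrow> \<exists>i\<in>I. \<exists>g\<in>Hom C K (omap D i). Comp C (c i) g = f"
    "i \<in> I \<Longrightarrow> g \<in> Hom C K (omap D i) \<Longrightarrow> g' \<in> Hom C K (omap D i) \<Longrightarrow>
      Comp C (c i) g = Comp C (c i) g' \<Longrightarrow>
      \<exists>j. (i, j) \<in> r \<and> Comp C (amap D (i, j)) g = Comp C (amap D (i, j)) g'"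
  using assms unfolding directed_lifting_def by blast+

lemma Hom_set_cat:
  "\<phi> \<in> Hom set_cat P Q \<longleftrightarrow> (\<exists>f. \<phi> = (P, f, Q) \<and> f \<in> P \<rightarrow>\<^sub>E Q)"
  by (auto simp: Hom_def set_cat_def)

lemma Comp_set_cat: "Comp set_cat (Q', g, Z) (P, f, Q) = (P, compose P g f, Z)"
  by (simp add: set_cat_def)

text \<open>How a map out of a quotient or a colimit is defined: \<open>q\<close> is the projection, and \<open>e\<close> is
  constant on its fibres.\<close>

lemma factor_through_image:
  assumes "\<And>x y. x \<in> A \<Longrightarrow> y \<in> A \<Longrightarrow> q x = q y \<Longrightarrow> e x = e y"
  shows "\<exists>h\<in>extensional (q ` A). \<forall>x\<in>A. h (q x) = e x"
proof (intro bexI ballI)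
  let ?h = "\<lambda>b\<in>q ` A. e (inv_into A q b)"
  show "?h (q x) = e x" if "x \<in> A" for x
    using that assms[OF inv_into_into[of "q x" q A] that] f_inv_into_f[of "q x" q A] by simp
qed (rule restrict_extensional)

text \<open>The two clauses of \<open>directed_lifting\<close> say that the hom-sets \<open>Hom K (D i)\<close> map jointly onto
  \<open>Hom K X\<close> and that the kernel is the identification at a later stage, which describes the
  directed colimit of these sets.\<close>

lemma presentable_if_directed_lifting:
  assumes C: "category C" and K: "directed_lifting TYPE('u) C K"
  shows "presentable TYPE('u) natLeq C K"
  unfolding presentable_def preserves_directed_colimits_def
proof (intro conjI allI impI)
  interpret C: category C by fact
  show KOb: "K \<in> Ob C" using K by (simp add: directed_lifting_def)
  fix I :: "'u set" and r D X c
  assume "small TYPE('u) I \<and> directed_poset natLeq I r \<and> is_functor (poset_cat I r) C D \<and>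
      is_colimit (poset_cat I r) C D X c"
  then have I: "small TYPE('u) I" and dir: "directed_poset natLeq I r"
    and D: "is_functor (poset_cat I r) C D" and X: "is_colimit (poset_cat I r) C D X c" by auto
  note r = directed_posetD[OF dir]
  let ?H = "hom_functor C K" and ?J = "poset_cat I r"
  let ?D = "comp_functor ?H D"
  have coc: "cocone ?J C D X c" using X by (simp add: is_colimit_def)
  have c: "c i \<in> Hom C (omap D i) X" if "i \<in> I" for i using coc that by (auto simp: cocone_def)
  have Dij: "amap D (i, j) \<in> Hom C (omap D i) (omap D j)" if "(i, j) \<in> r" for i j
    using is_functorD(4)[OF D poset_Hom[OF that]] .
  have cD: "Comp C (c j) (amap D (i, j)) = c i" if "(i, j) \<in> r" for i j
    using coc that by (auto simp: cocone_def)
  have legs: "(amap ?H \<circ> c) i = (Hom C K (omap D i), \<lambda>g\<in>Hom C K (omap D i). Comp C (c i) g,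
      Hom C K X)"
    if "i \<in> I" for i
    using c[OF that] by (auto simp: hom_functor_def Hom_def)
  have maps: "amap ?D (i, j) = (Hom C K (omap D i),
      \<lambda>g\<in>Hom C K (omap D i). Comp C (amap D (i, j)) g, Hom C K (omap D j))" if "(i, j) \<in> r" for i j
    using Dij[OF that] by (auto simp: comp_functor_def hom_functor_def Hom_def)
  have obs: "omap ?D i = Hom C K (omap D i)" "omap ?H X = Hom C K X" for i
    by (auto simp: comp_functor_def hom_functor_def)
  note lift = directed_liftingD[OF K I dir D X]
  have "cocone ?J set_cat ?D (omap ?H X) (amap ?H \<circ> c)"
    unfolding cocone_def
  proof (intro conjI ballI)
    show "omap ?H X \<in> Ob set_cat" by (simp add: set_cat_def)
    show "(amap ?H \<circ> c) i \<in> Hom set_cat (omap ?D i) (omap ?H X)" if "i \<in> Ob ?J" for i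
      using that legs C.comp_hom[OF _ c] by (auto simp: obs Hom_set_cat)
    show "Comp set_cat ((amap ?H \<circ> c) (Cod ?J a)) (amap ?D a) = (amap ?H \<circ> c) (Dom ?J a)"
      if aJ: "a \<in> Ar ?J" for a
    proof -
      obtain i j where a: "a = (i, j)" "(i, j) \<in> r" using aJ by (cases a) auto
      have ij: "i \<in> I" "j \<in> I" using r(1) a by auto
      show ?thesis
        using C.comp_hom[OF _ Dij[OF a(2)]] C.comp_assoc[OF _ Dij[OF a(2)] c[OF ij(2)]] cD[OF a(2)]
        by (auto simp: a(1) legs[OF ij(1), unfolded o_def] legs[OF ij(2), unfolded o_def]
            maps[OF a(2)] Comp_set_cat compose_def restrict_def fun_eq_iff)
    qed
  qed
  moreover have "\<exists>!h. h \<in> Hom set_cat (omap ?H X) Y \<and> (\<forall>j\<in>Ob ?J. Comp set_cat h ((amap ?H \<circ> c) j)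
      = d j)"
    if d: "cocone ?J set_cat ?D Y d" for Y d
  proof -
    have "\<exists>e. d i = (Hom C K (omap D i), e, Y) \<and> e \<in> Hom C K (omap D i) \<rightarrow>\<^sub>E Y" if "i \<in> I" for i
      using d that by (auto simp: cocone_def Hom_set_cat obs)
    then obtain e where e: "\<And>i. i \<in> I \<Longrightarrow> d i = (Hom C K (omap D i), e i, Y)"
      "\<And>i. i \<in> I \<Longrightarrow> e i \<in> Hom C K (omap D i) \<rightarrow>\<^sub>E Y" by metis
    have ecomp: "e j (Comp C (amap D (i, j)) g) = e i g" if "(i, j) \<in> r" "g \<in> Hom C K (omap D i)"
        for i j g
    proof -
      have "Comp set_cat (d j) (amap ?D (i, j)) = d i" using d that by (auto simp: cocone_def)
      then have "compose (Hom C K (omap D i)) (e j) (\<lambda>g\<in>Hom C K (omap D i). Comp C (amap D (i,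
          j)) g) = e i"
        using r(1)[OF that(1)] by (simp add: e(1) maps[OF that(1)] Comp_set_cat)
      from fun_cong[OF this, of g] show ?thesis using that by (simp add: compose_def)
    qed
    \<comment> \<open>Morphisms from two stages are compared at a common one, and there at a still later one.\<close>
    have wd: "e i g = e j g'" if "i \<in> I" "j \<in> I" "g \<in> Hom C K (omap D i)" "g' \<in> Hom C K (omap D j)"
      "Comp C (c i) g = Comp C (c j) g'" for i j g g'
    proof -
      obtain k where k: "(i, k) \<in> r" "(j, k) \<in> r" using r(4) \<open>i \<in> I\<close> \<open>j \<in> I\<close> by blast
      let ?g = "Comp C (amap D (i, k)) g" and ?g' = "Comp C (amap D (j, k)) g'"
      have hom: "?g \<in> Hom C K (omap D k)" "?g' \<in> Hom C K (omap D k)"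
        using C.comp_hom that Dij k by blast+
      have kI: "k \<in> I" using r(1) k by blast
      have "Comp C (c k) ?g = Comp C (c k) ?g'"
        using C.comp_assoc[OF that(3) Dij[OF k(1)] c[OF kI]] C.comp_assoc[OF that(4) Dij[OF k(2)]
            c[OF kI]]
          cD k that(5) by simp
      then obtain l where l: "(k, l) \<in> r" "Comp C (amap D (k, l)) ?g = Comp C (amap D (k, l)) ?g'"
        using lift(2)[OF kI hom] by blast
      then show ?thesis using ecomp[OF k(1) that(3)] ecomp[OF k(2) that(4)] ecomp[OF l(1)] hom
          by metis
    qed
    let ?S = "SIGMA i:I. Hom C K (omap D i)" and ?q = "\<lambda>(i, g). Comp C (c i) g"
    have surj: "?q ` ?S = Hom C K X"
    proof (intro equalityI subsetI)
      fix f assume "f \<in> Hom C K X"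
      then obtain i g where "i \<in> I" "g \<in> Hom C K (omap D i)" "Comp C (c i) g = f" using lift(1)
          by blast
      then show "f \<in> ?q ` ?S" by (intro image_eqI[of _ _ "(i, g)"]) auto
    qed (use C.comp_hom[OF _ c] in auto)
    have same: "e (fst x) (snd x) = e (fst y) (snd y)" if "x \<in> ?S" "y \<in> ?S" "?q x = ?q y" for x y
      using wd[of "fst x" "fst y" "snd x" "snd y"] that by (auto simp: case_prod_beta)
    obtain h where h: "h \<in> extensional (?q ` ?S)"
        "\<And>x. x \<in> ?S \<Longrightarrow> h (?q x) = e (fst x) (snd x)"
      using factor_through_image[of ?S ?q "\<lambda>x. e (fst x) (snd x)", OF same] by blast
    have hval: "h (Comp C (c i) g) = e i g" if "i \<in> I" "g \<in> Hom C K (omap D i)" for i g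
      using h(2)[of "(i, g)"] that by simp
    have hY: "h \<in> Hom C K X \<rightarrow>\<^sub>E Y"
    proof (rule PiE_I)
      fix f assume "f \<in> Hom C K X"
      then obtain i g where "i \<in> I" "g \<in> Hom C K (omap D i)" "Comp C (c i) g = f" using lift(1)
          by blast
      then show "h f \<in> Y" using hval e(2) by fastforce
    qed (use h(1) surj in \<open>auto simp: extensional_def\<close>)
    have value_iff: "Comp set_cat (Hom C K X, k, Y) ((amap ?H \<circ> c) i) = d i \<longleftrightarrow>
        (\<forall>g\<in>Hom C K (omap D i). k (Comp C (c i) g) = e i g)" if "i \<in> I" for i k
      using e(2)[OF that] unfolding legs[OF that] e(1)[OF that] Comp_set_cat
      by (auto simp: compose_def fun_eq_iff restrict_def PiE_def extensional_def)
    show ?thesis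
    proof (rule ex1I[of _ "(Hom C K X, h, Y)"])
      show "(Hom C K X, h, Y) \<in> Hom set_cat (omap ?H X) Y \<and>
          (\<forall>j\<in>Ob ?J. Comp set_cat (Hom C K X, h, Y) ((amap ?H \<circ> c) j) = d j)"
        using hY hval value_iff by (auto simp: Hom_set_cat obs)
      fix \<phi> assume phi: "\<phi> \<in> Hom set_cat (omap ?H X) Y \<and>
          (\<forall>j\<in>Ob ?J. Comp set_cat \<phi> ((amap ?H \<circ> c) j) = d j)"
      then obtain k where k: "\<phi> = (Hom C K X, k, Y)" "k \<in> Hom C K X \<rightarrow>\<^sub>E Y"
          by (auto simp: Hom_set_cat obs)
      have "k f = h f" if "f \<in> Hom C K X" for f
      proof -
        obtain i g where ig: "i \<in> I" "g \<in> Hom C K (omap D i)" "Comp C (c i) g = f"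
            using lift(1) \<open>f \<in> Hom C K X\<close> by blast
        then show ?thesis using phi value_iff[OF ig(1)] k(1) hval by auto
      qed
      then show "\<phi> = (Hom C K X, h, Y)" using k hY by (auto intro: PiE_ext)
    qed
  qed
  ultimately show "is_colimit ?J set_cat ?D (omap ?H X) (amap ?H \<circ> c)" by (simp add: is_colimit_def)
qed

text \<open>Local finite presentability without cocompleteness, the generators being presentable in the
  elementwise sense.\<close>

definition directed_generation :: "'u itself \<Rightarrow> ('o, 'm) cat \<Rightarrow> bool" where
  "directed_generation U C \<longleftrightarrow>
     (\<exists>\<G>. small U \<G> \<and> (\<forall>K\<in>\<G>. directed_lifting U C K) \<and>
        (\<forall>X\<in>Ob C. \<exists>(I :: 'u set) r D c.
           small U I \<and> directed_poset natLeq I r \<and> is_functor (poset_cat I r) C D \<and>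
           (\<forall>i\<in>I. omap D i \<in> \<G>) \<and> is_colimit (poset_cat I r) C D X c))"

lemma locally_presentable_if_directed_generation:
  assumes "category C" "cocomplete TYPE('u) C" "directed_generation TYPE('u) C"
  shows "locally_presentable_at TYPE('u) natLeq C"
proof -
  obtain \<G> where "small TYPE('u) \<G>" "\<forall>K\<in>\<G>. directed_lifting TYPE('u) C K"
    "\<forall>X\<in>Ob C. \<exists>(I :: 'u set) r D c.
           small TYPE('u) I \<and> directed_poset natLeq I r \<and> is_functor (poset_cat I r) C D \<and>
           (\<forall>i\<in>I. omap D i \<in> \<G>) \<and> is_colimit (poset_cat I r) C D X c"
    using assms(3) unfolding directed_generation_def by blast
  moreover from this have "\<forall>K\<in>\<G>. presentable TYPE('u) natLeq C K"
    using presentable_if_directed_lifting[OF assms(1)] by blast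
  ultimately show ?thesis using assms(1,2) unfolding locally_presentable_at_def by blast
qed

section \<open>Reflective subcategories\<close>

locale full_reflective =
  fixes A B :: "('o, 'm) cat"
  assumes full_reflective: "full_reflective_subcategory A B"
begin

sublocale A: category A
  using full_reflective by (simp add: full_reflective_subcategory_def full_subcategory_def)

sublocale B: category B
  using full_reflective by (simp add: full_reflective_subcategory_def full_subcategory_def)

lemma ob_subset: "X \<in> Ob A \<Longrightarrow> X \<in> Ob B"
  using full_reflective by (auto simp: full_reflective_subcategory_def full_subcategory_def)

lemma Hom_eq: "X \<in> Ob A \<Longrightarrow> Y \<in> Ob A \<Longrightarrow> Hom A X Y = Hom B X Y"
  using full_reflective by (auto simp: full_reflective_subcategory_def full_subcategory_def)

lemma Id_eq: "X \<in> Ob A \<Longrightarrow> Id A X = Id B X"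
  using full_reflective by (auto simp: full_reflective_subcategory_def full_subcategory_def)

lemma Comp_eq: "f \<in> Hom A X Y \<Longrightarrow> g \<in> Hom A Y Z \<Longrightarrow> Comp A g f = Comp B g f"
  using full_reflective
  by (auto simp: full_reflective_subcategory_def full_subcategory_def Hom_def)

lemma Hom_sub: "f \<in> Hom A X Y \<Longrightarrow> f \<in> Hom B X Y"
  using Hom_eq Hom_ob[OF A.category_axioms] by blast

lemma inclusion_functor: "is_functor A B inclusion"
  unfolding is_functor_def
proof (intro conjI ballI impI)
  show "amap inclusion (Comp A g f) = Comp B (amap inclusion g) (amap inclusion f)"
    if "f \<in> Ar A" "g \<in> Ar A" "Dom A g = Cod A f" for f g
    using Comp_eq[of f "Dom A f" "Cod A f" g "Cod A g"] that by (simp add: inclusion_def Hom_def)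
qed (auto simp: inclusion_def ob_subset Id_eq Hom_sub arrow_in_Hom A.category_axioms
    B.category_axioms)

lemma comp_inclusion: "comp_functor inclusion D = D"
  by (simp add: comp_functor_def inclusion_def o_def)

lemma inclusion_simps: "omap inclusion X = X" "amap inclusion \<circ> c = c"
  by (auto simp: inclusion_def)

lemma functor_into_B:
  assumes "is_functor J A D"
  shows "is_functor J B D"
  unfolding is_functor_def
proof (intro conjI ballI impI)
  note D = is_functorD[OF assms]
  show "amap D f \<in> Hom B (omap D (Dom J f)) (omap D (Cod J f))" if "f \<in> Ar J" for f
    using D(4)[OF arrow_in_Hom[OF that]] Hom_sub by blast
  show "amap D (Comp J g f) = Comp B (amap D g) (amap D f)"
    if "f \<in> Ar J" "g \<in> Ar J" "Dom J g = Cod J f" for f g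
  proof -
    have h: "f \<in> Hom J (Dom J f) (Cod J f)" "g \<in> Hom J (Cod J f) (Cod J g)"
      using that by (auto simp: Hom_def)
    show ?thesis using D(6)[OF h] Comp_eq[OF D(4)[OF h(1)] D(4)[OF h(2)]] by simp
  qed
qed (use is_functorD[OF assms] ob_subset Id_eq B.category_axioms in auto)

lemma cone_iff:
  assumes D: "is_functor J A D" and Y: "Y \<in> Ob A"
  shows "cone J A D Y c \<longleftrightarrow> cone J B D Y c"
proof -
  note D' = is_functorD[OF D]
  interpret J: category J using D'(1) .
  have hom: "c j \<in> Hom A Y (omap D j) \<longleftrightarrow> c j \<in> Hom B Y (omap D j)" if "j \<in> Ob J" for j
    using Hom_eq[OF Y D'(3)[OF that]] by simp
  have "Comp A (amap D a) (c (Dom J a)) = Comp B (amap D a) (c (Dom J a))"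
    if "a \<in> Ar J" "\<forall>j\<in>Ob J. c j \<in> Hom A Y (omap D j)" for a
    using Comp_eq[OF _ D'(4)[OF arrow_in_Hom[OF that(1)]]] that J.dom_ob by blast
  then show ?thesis using hom Y ob_subset unfolding cone_def by auto
qed

lemma reflectionD:
  assumes "is_reflection A B X R \<eta>"
  shows "R \<in> Ob A" "\<eta> \<in> Hom B X R"
    "Y \<in> Ob A \<Longrightarrow> f \<in> Hom B X Y \<Longrightarrow> \<exists>g. g \<in> Hom A R Y \<and> Comp B g \<eta> = f"
    "g \<in> Hom A R Y \<Longrightarrow> g' \<in> Hom A R Y \<Longrightarrow> Comp B g \<eta> = Comp B g' \<eta> \<Longrightarrow> g = g'"
proof -
  show "R \<in> Ob A" and eta: "\<eta> \<in> Hom B X R" using assms by (auto simp: is_reflection_def)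
  show "Y \<in> Ob A \<Longrightarrow> f \<in> Hom B X Y \<Longrightarrow> \<exists>g. g \<in> Hom A R Y \<and> Comp B g \<eta> = f"
    using assms unfolding is_reflection_def by blast
  assume g: "g \<in> Hom A R Y" "g' \<in> Hom A R Y" "Comp B g \<eta> = Comp B g' \<eta>"
  have "Y \<in> Ob A" "Comp B g \<eta> \<in> Hom B X Y"
    using Hom_ob[OF A.category_axioms g(1)] B.comp_hom[OF eta Hom_sub[OF g(1)]] by auto
  then show "g = g'" using assms g unfolding is_reflection_def by metis
qed

lemma reflection_of_object: "X \<in> Ob A \<Longrightarrow> is_reflection A B X X (Id B X)"
  unfolding is_reflection_def using ob_subset B.id_hom Hom_eq B.comp_id_right by (metis (no_types))

text \<open>The legs of a cone over a diagram in the subcategory factor through the reflection of its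
  apex.\<close>

lemma inclusion_preserves_limits: "limit_preserving U A B inclusion"
  unfolding limit_preserving_def comp_inclusion inclusion_simps
proof (intro conjI allI impI, rule inclusion_functor)
  fix J D X c
  assume "small_category J \<and> is_functor J A D \<and> is_limit J A D X c"
  then have D: "is_functor J A D" and X: "is_limit J A D X c" by auto
  note D' = is_functorD[OF D]
  interpret J: category J using D'(1) .
  have XA: "X \<in> Ob A" and coneA: "cone J A D X c" using X by (auto simp: is_limit_def cone_def)
  have c: "c j \<in> Hom A X (omap D j)" if "j \<in> Ob J" for j using coneA that by (auto simp: cone_def)
  have "\<exists>!h. h \<in> Hom B Y X \<and> (\<forall>j\<in>Ob J. Comp B (c j) h = d j)" if "cone J B D Y d" for Y d
  proof -
    have Y: "Y \<in> Ob B" and d: "\<And>j. j \<in> Ob J \<Longrightarrow> d j \<in> Hom B Y (omap D j)"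
      and dD: "\<And>a. a \<in> Ar J \<Longrightarrow> Comp B (amap D a) (d (Dom J a)) = d (Cod J a)"
      using that by (auto simp: cone_def)
    obtain R \<eta> where R: "is_reflection A B Y R \<eta>"
      using full_reflective Y unfolding full_reflective_subcategory_def by blast
    note refl = reflectionD[OF R]
    obtain d' where d': "\<And>j. j \<in> Ob J \<Longrightarrow> d' j \<in> Hom A R (omap D j)"
      "\<And>j. j \<in> Ob J \<Longrightarrow> Comp B (d' j) \<eta> = d j"
      using refl(3)[OF D'(3) d] by metis
    have "Comp A (amap D a) (d' (Dom J a)) = d' (Cod J a)" if a: "a \<in> Ar J" for a
    proof (rule refl(4))
      have j: "Dom J a \<in> Ob J" "Cod J a \<in> Ob J" using J.dom_ob J.cod_ob a by auto
      have Da: "amap D a \<in> Hom A (omap D (Dom J a)) (omap D (Cod J a))"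
        using D'(4)[OF arrow_in_Hom[OF a]] .
      show "Comp A (amap D a) (d' (Dom J a)) \<in> Hom A R (omap D (Cod J a))"
        using A.comp_hom[OF d'(1)[OF j(1)] Da] .
      show "Comp B (Comp A (amap D a) (d' (Dom J a))) \<eta> = Comp B (d' (Cod J a)) \<eta>"
        using B.comp_assoc[OF refl(2) Hom_sub[OF d'(1)[OF j(1)]] Hom_sub[OF Da]]
          Comp_eq[OF d'(1)[OF j(1)] Da] d'(2)[OF j(1)] d'(2)[OF j(2)] dD[OF a] by simp
    qed (use d'(1) J.cod_ob a in blast)
    then have coneR: "cone J A D R d'" using refl(1) d'(1) by (simp add: cone_def)
    obtain k where k: "k \<in> Hom A R X" "\<And>j. j \<in> Ob J \<Longrightarrow> Comp A (c j) k = d' j"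
      "\<And>k'. k' \<in> Hom A R X \<Longrightarrow> (\<And>j. j \<in> Ob J \<Longrightarrow> Comp A (c j) k' = d' j) \<Longrightarrow> k' = k"
      using limit_factor[OF X coneR] by blast
    have c_comp: "Comp B (c j) (Comp B k' \<eta>) = Comp B (Comp A (c j) k') \<eta>"
      if "k' \<in> Hom A R X" "j \<in> Ob J" for k' j
      using B.comp_assoc[OF refl(2) Hom_sub[OF that(1)] Hom_sub[OF c[OF that(2)]]]
        Comp_eq[OF that(1) c[OF that(2)]] by simp
    show ?thesis
    proof (rule ex1I[of _ "Comp B k \<eta>"])
      show "Comp B k \<eta> \<in> Hom B Y X \<and> (\<forall>j\<in>Ob J. Comp B (c j) (Comp B k \<eta>) = d j)"
        using B.comp_hom[OF refl(2) Hom_sub[OF k(1)]] c_comp[OF k(1)] k(2) d'(2) by simp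
      fix h assume h: "h \<in> Hom B Y X \<and> (\<forall>j\<in>Ob J. Comp B (c j) h = d j)"
      then obtain k' where k': "k' \<in> Hom A R X" "Comp B k' \<eta> = h" using refl(3)[OF XA] by blast
      have "Comp A (c j) k' = d' j" if "j \<in> Ob J" for j
        by (rule refl(4)[OF A.comp_hom[OF k'(1) c[OF that]] d'(1)[OF that]])
          (use c_comp[OF k'(1) that] k'(2) h d'(2) that in simp)
      then show "h = Comp B k \<eta>" using k(3)[OF k'(1)] k'(2) by simp
    qed
  qed
  then show "is_limit J B D X c" using coneA cone_iff[OF D XA] unfolding is_limit_def by blast
qed

text \<open>Reflecting a colimit objectwise, diagram and apex alike, gives a colimit in the
  subcategory.\<close>

lemma reflection_of_colimit:
  assumes D: "is_functor J B D" and D': "is_functor J A D'"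
    and \<theta>: "\<And>j. j \<in> Ob J \<Longrightarrow> is_reflection A B (omap D j) (omap D' j) (\<theta> j)"
    and nat: "\<And>a. a \<in> Ar J \<Longrightarrow> Comp B (amap D' a) (\<theta> (Dom J a)) = Comp B (\<theta> (Cod J a)) (amap D a)"
    and X: "is_colimit J B D X c" and R: "is_reflection A B X R \<eta>"
    and c': "\<And>j. j \<in> Ob J \<Longrightarrow> c' j \<in> Hom A (omap D' j) R"
      "\<And>j. j \<in> Ob J \<Longrightarrow> Comp B (c' j) (\<theta> j) = Comp B \<eta> (c j)"
  shows "is_colimit J A D' R c'"
proof -
  interpret J: category J using is_functorD(1)[OF D] .
  note refl = reflectionD[OF R] and th = reflectionD[OF \<theta>]
  have c: "\<And>j. j \<in> Ob J \<Longrightarrow> c j \<in> Hom B (omap D j) X"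
    and cD: "\<And>a. a \<in> Ar J \<Longrightarrow> Comp B (c (Cod J a)) (amap D a) = c (Dom J a)"
    using X by (auto simp: is_colimit_def cocone_def)
  have Da: "amap D a \<in> Hom B (omap D (Dom J a)) (omap D (Cod J a))"
    and D'a: "amap D' a \<in> Hom A (omap D' (Dom J a)) (omap D' (Cod J a))" if "a \<in> Ar J" for a
    using is_functorD(4)[OF D arrow_in_Hom[OF that]] is_functorD(4)[OF D' arrow_in_Hom[OF that]]
        by auto
  have slide: "Comp B (Comp A k (amap D' a)) (\<theta> (Dom J a)) = Comp B (Comp B k (\<theta> (Cod J a))) (amap
      D a)"
    if a: "a \<in> Ar J" and k: "k \<in> Hom A (omap D' (Cod J a)) Y" for a k Y
  proof -
    have j: "Dom J a \<in> Ob J" "Cod J a \<in> Ob J" using J.dom_ob J.cod_ob a by auto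
    show ?thesis
      using B.comp_assoc[OF th(2)[OF j(1)] Hom_sub[OF D'a[OF a]] Hom_sub[OF k]]
        B.comp_assoc[OF Da[OF a] th(2)[OF j(2)] Hom_sub[OF k]] nat[OF a] Comp_eq[OF D'a[OF a] k]
      by simp
  qed
  have "cocone J A D' R c'"
    unfolding cocone_def
  proof (intro conjI ballI)
    show "Comp A (c' (Cod J a)) (amap D' a) = c' (Dom J a)" if a: "a \<in> Ar J" for a
    proof -
      have j: "Dom J a \<in> Ob J" "Cod J a \<in> Ob J" using J.dom_ob J.cod_ob a by auto
      show ?thesis
      proof (rule th(4)[OF j(1)])
        show "Comp B (Comp A (c' (Cod J a)) (amap D' a)) (\<theta> (Dom J a)) = Comp B (c' (Dom J a)) (\<theta>
            (Dom J a))"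
          using slide[OF a c'(1)[OF j(2)]] c'(2)[OF j(2)] c'(2)[OF j(1)] cD[OF a]
            B.comp_assoc[OF Da[OF a] c[OF j(2)] refl(2)] by simp
      qed (use A.comp_hom[OF D'a[OF a] c'(1)[OF j(2)]] c'(1)[OF j(1)] in auto)
    qed
  qed (use refl(1) c'(1) in auto)
  moreover have "\<exists>!h. h \<in> Hom A R Y \<and> (\<forall>j\<in>Ob J. Comp A h (c' j) = d j)"
    if "cocone J A D' Y d" for Y d
  proof -
    have Y: "Y \<in> Ob A" and d: "\<And>j. j \<in> Ob J \<Longrightarrow> d j \<in> Hom A (omap D' j) Y"
      and dD: "\<And>a. a \<in> Ar J \<Longrightarrow> Comp A (d (Cod J a)) (amap D' a) = d (Dom J a)"
      using that by (auto simp: cocone_def)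
    have coc: "cocone J B D Y (\<lambda>j. Comp B (d j) (\<theta> j))"
      unfolding cocone_def
    proof (intro conjI ballI)
      show "Comp B (d j) (\<theta> j) \<in> Hom B (omap D j) Y" if "j \<in> Ob J" for j
        using B.comp_hom[OF th(2)[OF that] Hom_sub[OF d[OF that]]] .
      show "Comp B (Comp B (d (Cod J a)) (\<theta> (Cod J a))) (amap D a) = Comp B (d (Dom J a)) (\<theta> (Dom
          J a))"
        if "a \<in> Ar J" for a
        using slide[OF that d[OF J.cod_ob[OF that]]] dD[OF that] by simp
    qed (use Y ob_subset in auto)
    obtain h where h: "h \<in> Hom B X Y" "\<And>j. j \<in> Ob J \<Longrightarrow> Comp B h (c j) = Comp B (d j) (\<theta> j)"
      "\<And>h'. h' \<in> Hom B X Y \<Longrightarrow> (\<And>j. j \<in> Ob J \<Longrightarrow> Comp B h' (c j) = Comp B (d j) (\<theta> j)) \<Longrightarrow> h' = h"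
      using colimit_factor[OF X coc] by blast
    have comp: "Comp B (Comp A k (c' j)) (\<theta> j) = Comp B (Comp B k \<eta>) (c j)"
      if "k \<in> Hom A R Y" "j \<in> Ob J" for k j
      using B.comp_assoc[OF th(2)[OF that(2)] Hom_sub[OF c'(1)[OF that(2)]] Hom_sub[OF that(1)]]
        B.comp_assoc[OF c[OF that(2)] refl(2) Hom_sub[OF that(1)]] c'(2)[OF that(2)]
        Comp_eq[OF c'(1)[OF that(2)] that(1)] by simp
    obtain k where k: "k \<in> Hom A R Y" "Comp B k \<eta> = h" using refl(3)[OF Y h(1)] by blast
    show ?thesis
    proof (rule ex1I[of _ k])
      have "Comp A k (c' j) = d j" if "j \<in> Ob J" for j
        by (rule th(4)[OF that A.comp_hom[OF c'(1)[OF that] k(1)] d[OF that]])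
          (use comp[OF k(1) that] k(2) h(2)[OF that] in simp)
      then show "k \<in> Hom A R Y \<and> (\<forall>j\<in>Ob J. Comp A k (c' j) = d j)" using k(1) by blast
      fix k' assume k': "k' \<in> Hom A R Y \<and> (\<forall>j\<in>Ob J. Comp A k' (c' j) = d j)"
      then have "Comp B (Comp B k' \<eta>) (c j) = Comp B (d j) (\<theta> j)" if "j \<in> Ob J" for j
        using comp[OF _ that, of k'] that by simp
      then have "Comp B k' \<eta> = h"
        using h(3) B.comp_hom[OF refl(2) Hom_sub] k' by blast
      then show "k' = k" using refl(4)[of k' Y k] k k' by simp
    qed
  qed
  ultimately show ?thesis by (simp add: is_colimit_def)
qed

text \<open>The functoriality of the reflection, applied to one diagram.\<close>

lemma reflected_diagram:
  assumes D: "is_functor J B D" and \<rho>: "\<And>X. X \<in> Ob B \<Longrightarrow> is_reflection A B X (\<rho> X) (\<epsilon> X)"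
  obtains D' where "is_functor J A D'" "\<And>j. omap D' j = \<rho> (omap D j)"
    "\<And>a. a \<in> Ar J \<Longrightarrow>
       Comp B (amap D' a) (\<epsilon> (omap D (Dom J a))) = Comp B (\<epsilon> (omap D (Cod J a))) (amap D a)"
proof -
  note D' = is_functorD[OF D]
  interpret J: category J using D'(1) .
  note refl = reflectionD[OF \<rho>[OF D'(3)]]
  have "\<exists>g. g \<in> Hom A (\<rho> (omap D (Dom J a))) (\<rho> (omap D (Cod J a))) \<and>
      Comp B g (\<epsilon> (omap D (Dom J a))) = Comp B (\<epsilon> (omap D (Cod J a))) (amap D a)"
    if "a \<in> Ar J" for a
    using refl(3)[OF J.dom_ob[OF that] refl(1)[OF J.cod_ob[OF that]]
        B.comp_hom[OF D'(4)[OF arrow_in_Hom[OF that]] refl(2)[OF J.cod_ob[OF that]]]] .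
  then obtain m where m: "\<And>a. a \<in> Ar J \<Longrightarrow> m a \<in> Hom A (\<rho> (omap D (Dom J a))) (\<rho> (omap D (Cod J a)))"
    "\<And>a. a \<in> Ar J \<Longrightarrow> Comp B (m a) (\<epsilon> (omap D (Dom J a))) = Comp B (\<epsilon> (omap D (Cod J a))) (amap D a)"
    by metis
  let ?D = "\<lparr>omap = \<lambda>j. \<rho> (omap D j), amap = m\<rparr>"
  have "is_functor J A ?D"
    unfolding is_functor_def
  proof (intro conjI ballI impI)
    show "amap ?D (Id J j) = Id A (omap ?D j)" if j: "j \<in> Ob J" for j
    proof -
      have i: "Id J j \<in> Ar J" "Dom J (Id J j) = j" "Cod J (Id J j) = j"
        using J.id_hom[OF j] by (auto simp: Hom_def)
      have "m (Id J j) = Id A (\<rho> (omap D j))"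
      proof (rule refl(4)[OF j])
        show "m (Id J j) \<in> Hom A (\<rho> (omap D j)) (\<rho> (omap D j))" using m(1)[OF i(1)] i by simp
        show "Id A (\<rho> (omap D j)) \<in> Hom A (\<rho> (omap D j)) (\<rho> (omap D j))"
          using A.id_hom refl(1)[OF j] by blast
        show "Comp B (m (Id J j)) (\<epsilon> (omap D j)) = Comp B (Id A (\<rho> (omap D j))) (\<epsilon> (omap D j))"
          using m(2)[OF i(1)] i D'(5)[OF j] B.comp_id_right[OF refl(2)[OF j]]
            B.comp_id_left[OF refl(2)[OF j]] Id_eq[OF refl(1)[OF j]] by simp
      qed
      then show ?thesis by simp
    qed
    show "amap ?D (Comp J g f) = Comp A (amap ?D g) (amap ?D f)"
      if fg: "f \<in> Ar J" "g \<in> Ar J" "Dom J g = Cod J f" for f g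
    proof -
      have h: "f \<in> Hom J (Dom J f) (Cod J f)" "g \<in> Hom J (Cod J f) (Cod J g)"
        using fg by (auto simp: Hom_def)
      have gf: "Comp J g f \<in> Ar J" "Dom J (Comp J g f) = Dom J f" "Cod J (Comp J g f) = Cod J g"
        using J.comp_hom[OF h] by (auto simp: Hom_def)
      have j: "Dom J f \<in> Ob J" "Cod J f \<in> Ob J" "Cod J g \<in> Ob J"
        using J.dom_ob J.cod_ob fg by auto
      have mf: "m f \<in> Hom A (\<rho> (omap D (Dom J f))) (\<rho> (omap D (Cod J f)))"
        and mg: "m g \<in> Hom A (\<rho> (omap D (Cod J f))) (\<rho> (omap D (Cod J g)))"
        using m(1)[OF fg(1)] m(1)[OF fg(2)] fg(3) by auto
      have "m (Comp J g f) = Comp A (m g) (m f)"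
      proof (rule refl(4)[OF j(1)])
        show "m (Comp J g f) \<in> Hom A (\<rho> (omap D (Dom J f))) (\<rho> (omap D (Cod J g)))"
          using m(1)[OF gf(1)] gf by simp
        show "Comp A (m g) (m f) \<in> Hom A (\<rho> (omap D (Dom J f))) (\<rho> (omap D (Cod J g)))"
          using A.comp_hom[OF mf mg] .
        have "Comp B (Comp A (m g) (m f)) (\<epsilon> (omap D (Dom J f)))
            = Comp B (m g) (Comp B (\<epsilon> (omap D (Cod J f))) (amap D f))"
          using Comp_eq[OF mf mg] B.comp_assoc[OF refl(2)[OF j(1)] Hom_sub[OF mf] Hom_sub[OF mg]]
            m(2)[OF fg(1)] by simp
        also have "\<dots> = Comp B (Comp B (\<epsilon> (omap D (Cod J g))) (amap D g)) (amap D f)"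
          using B.comp_assoc[OF D'(4)[OF h(1)] refl(2)[OF j(2)] Hom_sub[OF mg]] m(2)[OF fg(2)]
              fg(3) by simp
        also have "\<dots> = Comp B (m (Comp J g f)) (\<epsilon> (omap D (Dom J f)))"
          using B.comp_assoc[OF D'(4)[OF h(1)] D'(4)[OF h(2)] refl(2)[OF j(3)]] m(2)[OF gf(1)] gf
            D'(6)[OF h] by simp
        finally show "Comp B (m (Comp J g f)) (\<epsilon> (omap D (Dom J f))) =
            Comp B (Comp A (m g) (m f)) (\<epsilon> (omap D (Dom J f)))" by simp
      qed
      then show ?thesis by simp
    qed
  qed (use m refl(1) D'(1) A.category_axioms in auto)
  then show ?thesis using that[of ?D] m(2) by simp
qed

lemma reflection_choice:
  obtains \<rho> \<epsilon> where "\<And>X. X \<in> Ob B \<Longrightarrow> is_reflection A B X (\<rho> X) (\<epsilon> X)"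
  using full_reflective unfolding full_reflective_subcategory_def by metis

text \<open>The diagram already lies in the subcategory, so only the apex of its colimit is reflected;
  the objects of the diagram are their own reflections.\<close>

lemma cocomplete_subcategory:
  assumes "cocomplete TYPE('u) B"
  shows "cocomplete TYPE('u) A"
  unfolding cocomplete_def
proof (intro allI impI)
  fix J :: "('u, 'u) cat" and D
  assume "small_category J \<and> is_functor J A D"
  then have D: "is_functor J A D" and J: "small_category J" by auto
  note DB = functor_into_B[OF D] and D' = is_functorD[OF D]
  interpret J: category J using D'(1) .
  obtain X c where X: "is_colimit J B D X c" using assms J DB unfolding cocomplete_def by blast
  have XB: "X \<in> Ob B" and c: "\<And>j. j \<in> Ob J \<Longrightarrow> c j \<in> Hom B (omap D j) X"
    using X by (auto simp: is_colimit_def cocone_def)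
  obtain R \<eta> where R: "is_reflection A B X R \<eta>"
    using full_reflective XB unfolding full_reflective_subcategory_def by blast
  note refl = reflectionD[OF R]
  have c': "Comp B \<eta> (c j) \<in> Hom B (omap D j) R" if "j \<in> Ob J" for j
    using B.comp_hom[OF c[OF that] refl(2)] .
  have "is_colimit J A D R (\<lambda>j. Comp B \<eta> (c j))"
  proof (rule reflection_of_colimit[OF DB D _ _ X R, of "\<lambda>j. Id B (omap D j)"])
    show "Comp B (amap D a) (Id B (omap D (Dom J a))) = Comp B (Id B (omap D (Cod J a))) (amap D a)"
      if "a \<in> Ar J" for a
      using B.comp_id_left B.comp_id_right is_functorD(4)[OF DB arrow_in_Hom[OF that]] by simp
    show "Comp B (Comp B \<eta> (c j)) (Id B (omap D j)) = Comp B \<eta> (c j)" if "j \<in> Ob J" for j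
      using B.comp_id_right[OF c'[OF that]] .
    show "Comp B \<eta> (c j) \<in> Hom A (omap D j) R" if "j \<in> Ob J" for j
      using c'[OF that] Hom_eq[OF D'(3)[OF that] refl(1)] by simp
  qed (use reflection_of_object D'(3) in auto)
  then show "\<exists>X c. is_colimit J A D X c" by blast
qed

text \<open>A morphism from the reflection of \<open>K\<close> into an object of the subcategory is the same as one
  from \<open>K\<close>, and the inclusion takes directed colimits to directed colimits.\<close>

lemma directed_lifting_reflection:
  assumes K: "directed_lifting TYPE('u) B K" and R: "is_reflection A B K R \<eta>"
    and incl: "preserves_directed_colimits TYPE('u) natLeq A B inclusion"
  shows "directed_lifting TYPE('u) A R"
  unfolding directed_lifting_def
proof (intro conjI allI impI)
  note refl = reflectionD[OF R]
  show "R \<in> Ob A" using refl(1) .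
  fix I :: "'u set" and r D X c
  assume a: "small TYPE('u) I \<and> directed_poset natLeq I r \<and> is_functor (poset_cat I r) A D \<and>
      is_colimit (poset_cat I r) A D X c"
  then have I: "small TYPE('u) I" "directed_poset natLeq I r"
    and D: "is_functor (poset_cat I r) A D" and X: "is_colimit (poset_cat I r) A D X c" by auto
  have XA: "X \<in> Ob A" and c: "\<And>i. i \<in> I \<Longrightarrow> c i \<in> Hom A (omap D i) X"
    using X by (auto simp: is_colimit_def cocone_def)
  have "is_colimit (poset_cat I r) B D X c"
    using incl a unfolding preserves_directed_colimits_def comp_inclusion inclusion_simps by blast
  note lift = directed_liftingD[OF K I functor_into_B[OF D] this]
  note Dob = is_functorD(3)[OF D, simplified]
  have assoc: "Comp B (Comp A p g) \<eta> = Comp B p (Comp B g \<eta>)"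
    if "g \<in> Hom A R Y" "p \<in> Hom A Y Z" for g p Y Z
    using B.comp_assoc[OF refl(2) Hom_sub[OF that(1)] Hom_sub[OF that(2)]] Comp_eq[OF that] by simp
  show "\<forall>f\<in>Hom A R X. \<exists>i\<in>I. \<exists>g\<in>Hom A R (omap D i). Comp A (c i) g = f"
  proof
    fix f assume f: "f \<in> Hom A R X"
    obtain i g where i: "i \<in> I" "g \<in> Hom B K (omap D i)" "Comp B (c i) g = Comp B f \<eta>"
      using lift(1)[OF B.comp_hom[OF refl(2) Hom_sub[OF f]]] by blast
    obtain g' where g': "g' \<in> Hom A R (omap D i)" "Comp B g' \<eta> = g"
        using refl(3)[OF Dob i(2)] i(1) by blast
    have "Comp A (c i) g' = f"
      by (rule refl(4)[OF A.comp_hom[OF g'(1) c[OF i(1)]] f]) (use assoc[OF g'(1) c[OF i(1)]] g' i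
          in simp)
    then show "\<exists>i\<in>I. \<exists>g\<in>Hom A R (omap D i). Comp A (c i) g = f" using i(1) g'(1) by blast
  qed
  show "\<forall>i\<in>I. \<forall>g\<in>Hom A R (omap D i). \<forall>g'\<in>Hom A R (omap D i). Comp A (c i) g = Comp A (c i) g' \<longrightarrow>
      (\<exists>j. (i, j) \<in> r \<and> Comp A (amap D (i, j)) g = Comp A (amap D (i, j)) g')"
  proof (intro ballI impI)
    fix i g g' assume i: "i \<in> I" and g: "g \<in> Hom A R (omap D i)" and g': "g' \<in> Hom A R (omap D i)"
      and eq: "Comp A (c i) g = Comp A (c i) g'"
    have hom: "Comp B g \<eta> \<in> Hom B K (omap D i)" "Comp B g' \<eta> \<in> Hom B K (omap D i)"
      using B.comp_hom[OF refl(2) Hom_sub[OF g]] B.comp_hom[OF refl(2) Hom_sub[OF g']] by auto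
    have "Comp B (c i) (Comp B g \<eta>) = Comp B (c i) (Comp B g' \<eta>)"
      using assoc[OF g c[OF i]] assoc[OF g' c[OF i]] eq by simp
    then obtain j where j: "(i, j) \<in> r"
      "Comp B (amap D (i, j)) (Comp B g \<eta>) = Comp B (amap D (i, j)) (Comp B g' \<eta>)"
      using lift(2)[OF i hom] by blast
    have Dij: "amap D (i, j) \<in> Hom A (omap D i) (omap D j)"
        using is_functorD(4)[OF D poset_Hom[OF j(1)]] .
    have "Comp A (amap D (i, j)) g = Comp A (amap D (i, j)) g'"
      by (rule refl(4)[OF A.comp_hom[OF g Dij] A.comp_hom[OF g' Dij]])
        (use assoc[OF g Dij] assoc[OF g' Dij] j(2) in simp)
    then show "\<exists>j. (i, j) \<in> r \<and> Comp A (amap D (i, j)) g = Comp A (amap D (i, j)) g'" using j(1)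
        by blast
  qed
qed

text \<open>The reflected generators generate: an object of the subcategory is a directed colimit of
  generators in the ambient category, and reflecting that colimit leaves its apex unchanged.\<close>

lemma directed_generation_subcategory:
  assumes gen: "directed_generation TYPE('u) B"
    and incl: "preserves_directed_colimits TYPE('u) natLeq A B inclusion"
  shows "directed_generation TYPE('u) A"
proof -
  obtain \<rho> \<epsilon> where \<rho>: "\<And>X. X \<in> Ob B \<Longrightarrow> is_reflection A B X (\<rho> X) (\<epsilon> X)"
    by (rule reflection_choice) blast
  obtain \<G> where small: "small TYPE('u) \<G>" and lift: "\<And>K. K \<in> \<G> \<Longrightarrow> directed_lifting TYPE('u) B K"
    and dense: "\<And>X. X \<in> Ob B \<Longrightarrow> \<exists>(I :: 'u set) r D c.
           small TYPE('u) I \<and> directed_poset natLeq I r \<and> is_functor (poset_cat I r) B D \<and>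
           (\<forall>i\<in>I. omap D i \<in> \<G>) \<and> is_colimit (poset_cat I r) B D X c"
    using gen unfolding directed_generation_def by blast
  have "directed_lifting TYPE('u) A (\<rho> K)" if "K \<in> \<G>" for K
  proof -
    have "K \<in> Ob B" using lift[OF that] by (simp add: directed_lifting_def)
    then show ?thesis by (rule directed_lifting_reflection[OF lift[OF that] \<rho> incl])
  qed
  moreover have "\<exists>(I :: 'u set) r D c.
           small TYPE('u) I \<and> directed_poset natLeq I r \<and> is_functor (poset_cat I r) A D \<and>
           (\<forall>i\<in>I. omap D i \<in> \<rho> ` \<G>) \<and> is_colimit (poset_cat I r) A D X c" if X: "X \<in> Ob A" for X
  proof -
    obtain I :: "'u set" and r D c where I: "small TYPE('u) I" "directed_poset natLeq I r"
      and D: "is_functor (poset_cat I r) B D" and DG: "\<forall>i\<in>I. omap D i \<in> \<G>"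
      and col: "is_colimit (poset_cat I r) B D X c"
      using dense[OF ob_subset[OF X]] by blast
    obtain D' where D': "is_functor (poset_cat I r) A D'" "\<And>j. omap D' j = \<rho> (omap D j)"
      "\<And>a. a \<in> r \<Longrightarrow> Comp B (amap D' a) (\<epsilon> (omap D (fst a))) = Comp B (\<epsilon> (omap D (snd a))) (amap D a)"
      using reflected_diagram[OF D \<rho>] by (metis poset_cat_simps(2-4))
    have c: "c i \<in> Hom B (omap D i) X" if "i \<in> I" for i
      using col that by (auto simp: is_colimit_def cocone_def)
    note refl = \<rho>[OF is_functorD(3)[OF D, simplified]]
    obtain c' where c': "\<And>i. i \<in> I \<Longrightarrow> c' i \<in> Hom A (omap D' i) X"
      "\<And>i. i \<in> I \<Longrightarrow> Comp B (c' i) (\<epsilon> (omap D i)) = c i"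
      using reflectionD(3)[OF refl X c] unfolding D'(2) by metis
    have "is_colimit (poset_cat I r) A D' X c'"
      by (rule reflection_of_colimit[OF D D'(1) _ _ col reflection_of_object[OF X],
            of "\<lambda>j. \<epsilon> (omap D j)"])
        (use D'(2,3) refl c' B.comp_id_left[OF c] in auto)
    moreover have "\<forall>i\<in>I. omap D' i \<in> \<rho> ` \<G>" using DG D'(2) by auto
    ultimately show ?thesis using I D'(1) by blast
  qed
  ultimately show ?thesis
    unfolding directed_generation_def using small_image[OF small, of \<rho>]
        by (intro exI[of _ "\<rho> ` \<G>"]) blast
qed

end

section \<open>Categories of transition systems\<close>

text \<open>The morphisms between two fixed systems. Unlike the hom-sets they do not refer to a class of
  objects, so they are shared by all the full subcategories considered below.\<close>

definition tmor :: "('u, 'a) tsystem \<Rightarrow> ('u, 'a) tsystem \<Rightarrow> ('u, 'a) tmorphism set" where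
  "tmor X Y = {f. is_tmorphism f \<and> source f = X \<and> target f = Y}"

text \<open>The restrictions make a morphism depend only on the values of \<open>f\<close> and \<open>g\<close> on states and
  actions of the source.\<close>

definition tmap :: "('u, 'a) tsystem \<Rightarrow> ('u, 'a) tsystem \<Rightarrow> ('u \<Rightarrow> 'u) \<Rightarrow> ('u \<Rightarrow> 'u) \<Rightarrow> ('u,
    'a) tmorphism" where
  "tmap X Y f g = \<lparr>source = X, target = Y, on_states = restrict f (states X),
     on_actions = restrict g (actions X)\<rparr>"

lemma tmap_simps [simp]:
  "source (tmap X Y f g) = X" "target (tmap X Y f g) = Y"
  "x \<in> states X \<Longrightarrow> on_states (tmap X Y f g) x = f x"
  "u \<in> actions X \<Longrightarrow> on_actions (tmap X Y f g) u = g u"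
  by (auto simp: tmap_def)

lemma pre_tsystem_trans:
  assumes "pre_tsystem \<Sigma> X" "(\<alpha>, us, \<beta>) \<in> trans X"
  shows "\<alpha> \<in> states X" "\<beta> \<in> states X" "set us \<subseteq> actions X" "us \<noteq> []"
  using assms by (auto simp: pre_tsystem_def)

lemma pre_tsystem_label: "pre_tsystem \<Sigma> X \<Longrightarrow> u \<in> actions X \<Longrightarrow> label X u \<in> \<Sigma>"
  by (auto simp: pre_tsystem_def)

lemma tmorD:
  assumes "f \<in> tmor X Y"
  shows "\<And>x. x \<in> states X \<Longrightarrow> on_states f x \<in> states Y"
    "\<And>u. u \<in> actions X \<Longrightarrow> on_actions f u \<in> actions Y"
    "\<And>u. u \<in> actions X \<Longrightarrow> label Y (on_actions f u) = label X u"
    "\<And>\<alpha> us \<beta>. (\<alpha>, us, \<beta>) \<in> trans X \<Longrightarrow> (on_states f \<alpha>, map (on_actions f) us, on_states f \<beta>) \<in> trans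
        Y"
    "source f = X" "target f = Y"
  using assms by (auto simp: tmor_def is_tmorphism_def PiE_iff)

lemma tmor_eqI:
  assumes f: "f \<in> tmor X Y" and g: "g \<in> tmor X Y"
    and s: "\<And>x. x \<in> states X \<Longrightarrow> on_states f x = on_states g x"
    and a: "\<And>u. u \<in> actions X \<Longrightarrow> on_actions f u = on_actions g u"
  shows "f = g"
proof -
  have "on_states f \<in> states X \<rightarrow>\<^sub>E states Y" "on_states g \<in> states X \<rightarrow>\<^sub>E states Y"
    "on_actions f \<in> actions X \<rightarrow>\<^sub>E actions Y" "on_actions g \<in> actions X \<rightarrow>\<^sub>E actions Y"
    using f g by (auto simp: tmor_def is_tmorphism_def)
  then have "on_states f = on_states g" "on_actions f = on_actions g"
    using s a by (metis PiE_ext)+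
  then show ?thesis using f g by (cases f; cases g) (auto simp: tmor_def)
qed

lemma tmap_in_tmor:
  assumes X: "pre_tsystem \<Sigma> X"
    and s: "\<And>x. x \<in> states X \<Longrightarrow> f x \<in> states Y"
    and a: "\<And>u. u \<in> actions X \<Longrightarrow> g u \<in> actions Y"
    and l: "\<And>u. u \<in> actions X \<Longrightarrow> label Y (g u) = label X u"
    and t: "\<And>\<alpha> us \<beta>. (\<alpha>, us, \<beta>) \<in> trans X \<Longrightarrow> (f \<alpha>, map g us, f \<beta>) \<in> trans Y"
  shows "tmap X Y f g \<in> tmor X Y"
proof -
  have "(on_states (tmap X Y f g) \<alpha>, map (on_actions (tmap X Y f g)) us, on_states (tmap X Y f g)
      \<beta>) \<in> trans Y"
    if "(\<alpha>, us, \<beta>) \<in> trans X" for \<alpha> us \<beta>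
  proof -
    note p = pre_tsystem_trans[OF X that]
    have m: "map (on_actions (tmap X Y f g)) us = map g us" using p(3) by auto
    show ?thesis unfolding m using t[OF that] p(1,2) by simp
  qed
  then show ?thesis using s a l unfolding tmor_def is_tmorphism_def
    by (auto simp: tmap_def)
qed

lemma Hom_tsystem_cat: "Hom (tsystem_cat \<O>) X Y = (if X \<in> \<O> \<and> Y \<in> \<O> then tmor X Y else {})"
  by (auto simp: Hom_def tsystem_cat_def tmor_def)

lemma tsystem_cat_simps [simp]:
  "Ob (tsystem_cat \<O>) = \<O>" "Dom (tsystem_cat \<O>) = source" "Cod (tsystem_cat \<O>) = target"
  "Id (tsystem_cat \<O>) X = tmap X X id id"
  by (auto simp: tsystem_cat_def tmap_def)

lemma Comp_tsystem_cat:
  "f \<in> tmor X Y \<Longrightarrow> g \<in> tmor Y Z \<Longrightarrow>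
    Comp (tsystem_cat \<O>) g f = tmap X Z (on_states g \<circ> on_states f) (on_actions g \<circ> on_actions f)"
  by (auto simp: tsystem_cat_def tmap_def tmor_def compose_def restrict_def)

lemma Comp_tsystem_cat_apply:
  assumes "f \<in> tmor X Y" "g \<in> tmor Y Z"
  shows "x \<in> states X \<Longrightarrow> on_states (Comp (tsystem_cat \<O>) g f) x = on_states g (on_states f x)"
    "u \<in> actions X \<Longrightarrow> on_actions (Comp (tsystem_cat \<O>) g f) u = on_actions g (on_actions f u)"
  by (simp_all add: Comp_tsystem_cat[OF assms])

lemma Comp_in_tmor:
  assumes X: "pre_tsystem \<Sigma> X" and f: "f \<in> tmor X Y" and g: "g \<in> tmor Y Z"
  shows "Comp (tsystem_cat \<O>) g f \<in> tmor X Z"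
  unfolding Comp_tsystem_cat[OF f g]
  by (rule tmap_in_tmor[OF X]) (use tmorD[OF f] tmorD[OF g] in fastforce)+

lemma Comp_eq_iff:
  assumes X: "pre_tsystem \<Sigma> X" and f: "f \<in> tmor X Y" and g: "g \<in> tmor Y Z" and h: "h \<in> tmor X Z"
  shows "Comp (tsystem_cat \<O>) g f = h \<longleftrightarrow>
    (\<forall>x\<in>states X. on_states g (on_states f x) = on_states h x) \<and>
    (\<forall>u\<in>actions X. on_actions g (on_actions f u) = on_actions h u)"
proof
  assume "Comp (tsystem_cat \<O>) g f = h"
  then show "(\<forall>x\<in>states X. on_states g (on_states f x) = on_states h x) \<and>
    (\<forall>u\<in>actions X. on_actions g (on_actions f u) = on_actions h u)"
    using Comp_tsystem_cat_apply[OF f g, where \<O> = \<O>] by metis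
next
  assume "(\<forall>x\<in>states X. on_states g (on_states f x) = on_states h x) \<and>
    (\<forall>u\<in>actions X. on_actions g (on_actions f u) = on_actions h u)"
  then show "Comp (tsystem_cat \<O>) g f = h"
    by (intro tmor_eqI[OF Comp_in_tmor[OF X f g] h]) (simp_all add: Comp_tsystem_cat_apply[OF f g])
qed

lemma tmap_id_in_tmor: "pre_tsystem \<Sigma> X \<Longrightarrow> tmap X X id id \<in> tmor X X"
  by (rule tmap_in_tmor) auto

text \<open>A full subcategory given by a class \<open>\<O>\<close> of systems, later the weak ones or the higher
  dimensional ones. Systems satisfying \<open>pre_tsystem\<close> have their transitions between their own
  states, which composition relies on.\<close>

locale tsystems =
  fixes \<Sigma> :: "'a set" and \<O> :: "('u, 'a) tsystem set"
  assumes pre: "X \<in> \<O> \<Longrightarrow> pre_tsystem \<Sigma> X"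
begin

abbreviation "\<C> \<equiv> tsystem_cat \<O>"

lemma Hom_iff: "f \<in> Hom \<C> X Y \<longleftrightarrow> X \<in> \<O> \<and> Y \<in> \<O> \<and> f \<in> tmor X Y"
  by (auto simp: Hom_tsystem_cat)

lemma tsystem_cat_category: "category \<C>"
proof
  show "f \<in> Ar \<C> \<Longrightarrow> Dom \<C> f \<in> Ob \<C>" "f \<in> Ar \<C> \<Longrightarrow> Cod \<C> f \<in> Ob \<C>" for f
    by (auto simp: tsystem_cat_def)
  show "X \<in> Ob \<C> \<Longrightarrow> Id \<C> X \<in> Hom \<C> X X" for X
    using tmap_id_in_tmor[OF pre] by (simp add: Hom_iff)
  show "f \<in> Hom \<C> X Y \<Longrightarrow> g \<in> Hom \<C> Y Z \<Longrightarrow> Comp \<C> g f \<in> Hom \<C> X Z" for f g X Y Z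
    using Comp_in_tmor[OF pre] by (auto simp: Hom_iff)
  show "Comp \<C> (Id \<C> Y) f = f" "Comp \<C> f (Id \<C> X) = f" if "f \<in> Hom \<C> X Y" for f X Y
  proof -
    have f: "f \<in> tmor X Y" and X: "pre_tsystem \<Sigma> X" and Y: "pre_tsystem \<Sigma> Y"
      using that pre by (auto simp: Hom_iff)
    show "Comp \<C> (Id \<C> Y) f = f"
      using Comp_eq_iff[OF X f tmap_id_in_tmor[OF Y] f, of \<O>] by (simp add: tmorD[OF f])
    show "Comp \<C> f (Id \<C> X) = f"
      using Comp_eq_iff[OF X tmap_id_in_tmor[OF X] f f, of \<O>] by simp
  qed
  show "Comp \<C> h (Comp \<C> g f) = Comp \<C> (Comp \<C> h g) f"
    if "f \<in> Hom \<C> W X" "g \<in> Hom \<C> X Y" "h \<in> Hom \<C> Y Z" for f g h W X Y Z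
  proof -
    have t: "f \<in> tmor W X" "g \<in> tmor X Y" "h \<in> tmor Y Z" and O: "W \<in> \<O>" "X \<in> \<O>"
      using that by (auto simp: Hom_iff)
    have gf: "Comp \<C> g f \<in> tmor W Y" and hg: "Comp \<C> h g \<in> tmor X Z"
      using Comp_in_tmor[OF pre] t O by blast+
    have "Comp \<C> (Comp \<C> h g) f \<in> tmor W Z" using Comp_in_tmor[OF pre[OF O(1)] t(1) hg] .
    then show ?thesis
      by (simp add: Comp_eq_iff[OF pre[OF O(1)] gf t(3)] Comp_tsystem_cat_apply[OF t(1,2)]
          Comp_tsystem_cat_apply[OF t(1) hg] Comp_tsystem_cat_apply[OF t(2,3)] tmorD[OF t(1)])
  qed
qed

lemma cocone_tsystem_iff:
  assumes D: "is_functor J \<C> D"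
  shows "cocone J \<C> D Y c \<longleftrightarrow> Y \<in> \<O> \<and> (\<forall>j\<in>Ob J. c j \<in> tmor (omap D j) Y) \<and>
    (\<forall>a\<in>Ar J. (\<forall>x\<in>states (omap D (Dom J a)).
         on_states (c (Cod J a)) (on_states (amap D a) x) = on_states (c (Dom J a)) x) \<and>
       (\<forall>u\<in>actions (omap D (Dom J a)).
         on_actions (c (Cod J a)) (on_actions (amap D a) u) = on_actions (c (Dom J a)) u))"
proof -
  note D' = is_functorD[OF D]
  interpret J: category J using D'(1) .
  have ob: "omap D j \<in> \<O>" if "j \<in> Ob J" for j using D'(3)[OF that] by simp
  have "Comp \<C> (c (Cod J a)) (amap D a) = c (Dom J a) \<longleftrightarrow>
      (\<forall>x\<in>states (omap D (Dom J a)).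
         on_states (c (Cod J a)) (on_states (amap D a) x) = on_states (c (Dom J a)) x) \<and>
      (\<forall>u\<in>actions (omap D (Dom J a)).
         on_actions (c (Cod J a)) (on_actions (amap D a) u) = on_actions (c (Dom J a)) u)"
    if a: "a \<in> Ar J" and c: "\<forall>j\<in>Ob J. c j \<in> tmor (omap D j) Y" for a
  proof -
    have j: "Dom J a \<in> Ob J" "Cod J a \<in> Ob J" using J.dom_ob J.cod_ob a by auto
    have "amap D a \<in> tmor (omap D (Dom J a)) (omap D (Cod J a))"
      using D'(4)[OF arrow_in_Hom[OF a]] by (simp add: Hom_iff)
    from Comp_eq_iff[OF pre[OF ob[OF j(1)]] this c[rule_format, OF j(2)] c[rule_format, OF j(1)]]
    show ?thesis .
  qed
  then show ?thesis unfolding cocone_def using ob by (auto simp: Hom_iff)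
qed

end

section \<open>Directed colimits of transition systems\<close>

text \<open>A cocone that is a colimit on the sets of states and of actions, and for which every
  transition of the apex comes from a stage. There is no mention of the class of objects, so that
  an apex found in one subcategory can be recognised as a colimit in another.\<close>

definition elementwise_colimit ::
    "'u set \<Rightarrow> 'u rel \<Rightarrow> ('u, 'u \<times> 'u, ('u, 'a) tsystem, ('u, 'a) tmorphism) cfunctor \<Rightarrow>
     ('u, 'a) tsystem \<Rightarrow> ('u \<Rightarrow> ('u, 'a) tmorphism) \<Rightarrow> bool" where
  "elementwise_colimit I r D X c \<longleftrightarrow>
     (\<forall>i\<in>I. c i \<in> tmor (omap D i) X) \<and>
     (\<forall>i j. (i, j) \<in> r \<longrightarrow>
        (\<forall>x\<in>states (omap D i). on_states (c j) (on_states (amap D (i, j)) x) = on_states (c i) x) \<and>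
        (\<forall>u\<in>actions (omap D i). on_actions (c j) (on_actions (amap D (i, j)) u) = on_actions (c i)
            u)) \<and>
     (\<forall>x\<in>states X. \<exists>i\<in>I. \<exists>y\<in>states (omap D i). on_states (c i) y = x) \<and>
     (\<forall>u\<in>actions X. \<exists>i\<in>I. \<exists>v\<in>actions (omap D i). on_actions (c i) v = u) \<and>
     (\<forall>\<alpha> us \<beta>. (\<alpha>, us, \<beta>) \<in> trans X \<longrightarrow> (\<exists>i\<in>I. \<exists>\<alpha>' us' \<beta>'. (\<alpha>', us', \<beta>') \<in> trans (omap D i) \<and>
        on_states (c i) \<alpha>' = \<alpha> \<and> map (on_actions (c i)) us' = us \<and> on_states (c i) \<beta>' = \<beta>)) \<and>
     (\<forall>i\<in>I. \<forall>x\<in>states (omap D i). \<forall>y\<in>states (omap D i). on_states (c i) x = on_states (c i) y \<longrightarrow>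
        (\<exists>j. (i, j) \<in> r \<and> on_states (amap D (i, j)) x = on_states (amap D (i, j)) y)) \<and>
     (\<forall>i\<in>I. \<forall>u\<in>actions (omap D i). \<forall>v\<in>actions (omap D i). on_actions (c i) u = on_actions (c i) v \<longrightarrow>
        (\<exists>j. (i, j) \<in> r \<and> on_actions (amap D (i, j)) u = on_actions (amap D (i, j)) v))"

lemma elementwise_colimitD:
  assumes "elementwise_colimit I r D X c"
  shows "\<And>i. i \<in> I \<Longrightarrow> c i \<in> tmor (omap D i) X"
    "\<And>i j x. (i, j) \<in> r \<Longrightarrow> x \<in> states (omap D i) \<Longrightarrow>
       on_states (c j) (on_states (amap D (i, j)) x) = on_states (c i) x"
    "\<And>i j u. (i, j) \<in> r \<Longrightarrow> u \<in> actions (omap D i) \<Longrightarrow>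
       on_actions (c j) (on_actions (amap D (i, j)) u) = on_actions (c i) u"
    "\<And>x. x \<in> states X \<Longrightarrow> \<exists>i\<in>I. \<exists>y\<in>states (omap D i). on_states (c i) y = x"
    "\<And>u. u \<in> actions X \<Longrightarrow> \<exists>i\<in>I. \<exists>v\<in>actions (omap D i). on_actions (c i) v = u"
    "\<And>\<alpha> us \<beta>. (\<alpha>, us, \<beta>) \<in> trans X \<Longrightarrow> \<exists>i\<in>I. \<exists>\<alpha>' us' \<beta>'. (\<alpha>', us', \<beta>') \<in> trans (omap D i) \<and>
        on_states (c i) \<alpha>' = \<alpha> \<and> map (on_actions (c i)) us' = us \<and> on_states (c i) \<beta>' = \<beta>"
    "\<And>i x y. i \<in> I \<Longrightarrow> x \<in> states (omap D i) \<Longrightarrow> y \<in> states (omap D i) \<Longrightarrow>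
       on_states (c i) x = on_states (c i) y \<Longrightarrow>
       \<exists>j. (i, j) \<in> r \<and> on_states (amap D (i, j)) x = on_states (amap D (i, j)) y"
    "\<And>i u v. i \<in> I \<Longrightarrow> u \<in> actions (omap D i) \<Longrightarrow> v \<in> actions (omap D i) \<Longrightarrow>
       on_actions (c i) u = on_actions (c i) v \<Longrightarrow>
       \<exists>j. (i, j) \<in> r \<and> on_actions (amap D (i, j)) u = on_actions (amap D (i, j)) v"
  using assms unfolding elementwise_colimit_def by blast+

text \<open>Along a directed poset, finitely many properties that hold from some stage on hold together
  from some stage on.\<close>

definition eventually_in :: "'i set \<Rightarrow> 'i rel \<Rightarrow> ('i \<Rightarrow> bool) \<Rightarrow> bool" where
  "eventually_in I r P \<longleftrightarrow> (\<exists>j\<in>I. \<forall>k. (j, k) \<in> r \<longrightarrow> P k)"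

lemma eventually_in_ball:
  assumes dir: "directed_poset natLeq I r" and F: "finite F" "\<And>x. x \<in> F \<Longrightarrow> eventually_in I r (P x)"
  shows "eventually_in I r (\<lambda>k. \<forall>x\<in>F. P x k)"
proof -
  obtain j where j: "\<And>x. x \<in> F \<Longrightarrow> j x \<in> I" "\<And>x k. x \<in> F \<Longrightarrow> (j x, k) \<in> r \<Longrightarrow> P x k"
    using F(2) unfolding eventually_in_def by metis
  obtain b where "b \<in> I" "\<forall>x\<in>F. (j x, b) \<in> r"
    using directed_poset_finite_bound[OF dir, of "j ` F"] F(1) j(1) by auto
  then show ?thesis
    unfolding eventually_in_def using j(2) directed_posetD(3)[OF dir] by blast
qed

lemma eventually_in_mono: "eventually_in I r P \<Longrightarrow> (\<And>k. k \<in> I \<Longrightarrow> P k \<Longrightarrow> Q k) \<Longrightarrow>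
    directed_poset natLeq I r \<Longrightarrow> eventually_in I r Q"
  unfolding eventually_in_def using directed_posetD(1) by metis

lemma eventually_in_conj:
  assumes dir: "directed_poset natLeq I r" and "eventually_in I r P" "eventually_in I r Q"
  shows "eventually_in I r (\<lambda>k. P k \<and> Q k)"
proof -
  have "eventually_in I r (\<lambda>k. \<forall>b\<in>UNIV. if b then P k else Q k)"
  proof (rule eventually_in_ball[OF dir])
    show "eventually_in I r (\<lambda>k. if b then P k else Q k)" for b by (cases b) (use assms in simp_all)
  qed simp
  then show ?thesis by (rule eventually_in_mono[OF _ _ dir]) (auto split: if_splits)
qed

lemma eventually_in_above: "directed_poset natLeq I r \<Longrightarrow> i \<in> I \<Longrightarrow> eventually_in I r (\<lambda>k. (i, k) \<in> r)"
  unfolding eventually_in_def by blast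

lemma eventually_in_ex: "directed_poset natLeq I r \<Longrightarrow> eventually_in I r P \<Longrightarrow> \<exists>k\<in>I. P k"
  unfolding eventually_in_def using directed_posetD(1,2) by metis

text \<open>Elements of two stages are identified when they agree at a later stage; \<open>e\<close> names the
  classes by elements of \<open>'u\<close>.\<close>

lemma directed_colimit_of_sets:
  fixes I :: "'u set" and S :: "'u \<Rightarrow> 'u set"
  assumes U: "universe TYPE('u)" and I: "small TYPE('u) I" and dir: "directed_poset natLeq I r"
    and S: "\<And>i. i \<in> I \<Longrightarrow> small TYPE('u) (S i)"
    and m: "\<And>i j x. (i, j) \<in> r \<Longrightarrow> x \<in> S i \<Longrightarrow> m i j x \<in> S j"
    and comp: "\<And>i j k x. (i, j) \<in> r \<Longrightarrow> (j, k) \<in> r \<Longrightarrow> x \<in> S i \<Longrightarrow> m j k (m i j x) = m i k x"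
  shows "\<exists>e :: 'u \<times> 'u \<Rightarrow> 'u. \<forall>i\<in>I. \<forall>x\<in>S i. \<forall>j\<in>I. \<forall>y\<in>S j.
      e (i, x) = e (j, y) \<longleftrightarrow> (\<exists>k. (i, k) \<in> r \<and> (j, k) \<in> r \<and> m i k x = m j k y)"
proof -
  note r = directed_posetD[OF dir]
  let ?R = "\<lambda>p q. \<exists>k. (fst p, k) \<in> r \<and> (fst q, k) \<in> r \<and> m (fst p) k (snd p) = m (fst q) k (snd q)"
  have trans: "?R p s" if "p \<in> Sigma I S" "q \<in> Sigma I S" "s \<in> Sigma I S" "?R p q" "?R q s"
      for p q s
  proof -
    obtain k l where k: "(fst p, k) \<in> r" "(fst q, k) \<in> r" "m (fst p) k (snd p) = m (fst q) k (snd
        q)"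
      and l: "(fst q, l) \<in> r" "(fst s, l) \<in> r" "m (fst q) l (snd q) = m (fst s) l (snd s)"
      using \<open>?R p q\<close> \<open>?R q s\<close> by blast
    have "k \<in> I" "l \<in> I" using r(1) k(1) l(1) by auto
    then obtain h where h: "(k, h) \<in> r" "(l, h) \<in> r" using r(4) by blast
    have Sp: "snd p \<in> S (fst p)" "snd q \<in> S (fst q)" "snd s \<in> S (fst s)"
      using \<open>p \<in> Sigma I S\<close> \<open>q \<in> Sigma I S\<close> \<open>s \<in> Sigma I S\<close> by auto
    have "m (fst p) h (snd p) = m k h (m (fst q) k (snd q))"
      using comp[OF k(1) h(1) Sp(1)] k(3) by simp
    also have "\<dots> = m l h (m (fst q) l (snd q))"
      using comp[OF k(2) h(1) Sp(2)] comp[OF l(1) h(2) Sp(2)] by simp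
    also have "\<dots> = m (fst s) h (snd s)"
      using comp[OF l(2) h(2) Sp(3)] l(3) by simp
    finally show ?thesis using r(3)[OF k(1) h(1)] r(3)[OF l(2) h(2)] by blast
  qed
  show ?thesis
  proof (rule small_quotient_encode[of "Sigma I S" ?R])
    show "small TYPE('u) (Sigma I S)" by (intro small_Sigma U I S)
    show "?R p p" if "p \<in> Sigma I S" for p using that r(2)[of "fst p"] by auto
    show "?R q p" if "?R p q" for p q using that by metis
    show "?R p s" if "p \<in> Sigma I S" "q \<in> Sigma I S" "s \<in> Sigma I S" "?R p q" "?R q s" for p q s
      by (rule trans[OF that])
    fix e :: "'u \<times> 'u \<Rightarrow> 'u"
    assume e: "\<And>p q. p \<in> Sigma I S \<Longrightarrow> q \<in> Sigma I S \<Longrightarrow> e p = e q \<longleftrightarrow> ?R p q"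
    show ?thesis
    proof (intro exI[of _ e] ballI)
      fix i x j y assume "i \<in> I" "x \<in> S i" "j \<in> I" "y \<in> S j"
      then show "e (i, x) = e (j, y) \<longleftrightarrow> (\<exists>k. (i, k) \<in> r \<and> (j, k) \<in> r \<and> m i k x = m j k y)"
        using e[of "(i, x)" "(j, y)"] by simp
    qed
  qed
qed

locale directed_diagram = tsystems \<Sigma> \<O>
  for \<Sigma> :: "'a set" and \<O> :: "('u, 'a) tsystem set" +
  fixes I :: "'u set" and r :: "'u rel"
    and D :: "('u, 'u \<times> 'u, ('u, 'a) tsystem, ('u, 'a) tmorphism) cfunctor"
  assumes dir: "directed_poset natLeq I r" and D: "is_functor (poset_cat I r) (tsystem_cat \<O>) D"
begin

abbreviation "S i \<equiv> states (omap D i)"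
abbreviation "A i \<equiv> actions (omap D i)"
abbreviation "Ds i j \<equiv> on_states (amap D (i, j))"
abbreviation "Da i j \<equiv> on_actions (amap D (i, j))"

lemmas r = directed_posetD[OF dir]

lemma D_ob: "i \<in> I \<Longrightarrow> omap D i \<in> \<O>"
  using is_functorD(3)[OF D] by simp

lemma D_pre: "i \<in> I \<Longrightarrow> pre_tsystem \<Sigma> (omap D i)"
  using pre D_ob by blast

lemma D_tmor: "(i, j) \<in> r \<Longrightarrow> amap D (i, j) \<in> tmor (omap D i) (omap D j)"
  using is_functorD(4)[OF D poset_Hom] by (auto simp: Hom_iff)

lemma D_comp:
  assumes "(i, j) \<in> r" "(j, k) \<in> r"
  shows "x \<in> S i \<Longrightarrow> Ds j k (Ds i j x) = Ds i k x" "u \<in> A i \<Longrightarrow> Da j k (Da i j u) = Da i k u"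
proof -
  have "amap D (i, k) = Comp \<C> (amap D (j, k)) (amap D (i, j))"
    using is_functorD(6)[OF D poset_Hom[OF assms(1)] poset_Hom[OF assms(2)]] by simp
  then show "x \<in> S i \<Longrightarrow> Ds j k (Ds i j x) = Ds i k x" "u \<in> A i \<Longrightarrow> Da j k (Da i j u) = Da i k u"
    by (simp_all add: Comp_tsystem_cat_apply[OF D_tmor[OF assms(1)] D_tmor[OF assms(2)]])
qed

lemma D_id: "i \<in> I \<Longrightarrow> x \<in> S i \<Longrightarrow> Ds i i x = x" "i \<in> I \<Longrightarrow> u \<in> A i \<Longrightarrow> Da i i u = u"
  using is_functorD(5)[OF D, of i] by simp_all

text \<open>Elements of two stages that agree in the colimit agree at all sufficiently late stages: they
  are moved to a common stage first, where the definition applies.\<close>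

lemma equal_in_colimit_states:
  assumes el: "elementwise_colimit I r D X c"
    and x: "i \<in> I" "x \<in> S i" and y: "j \<in> I" "y \<in> S j" and eq: "on_states (c i) x = on_states (c j)
        y"
  shows "eventually_in I r (\<lambda>k. (i, k) \<in> r \<and> (j, k) \<in> r \<and> Ds i k x = Ds j k y)"
proof -
  note el = elementwise_colimitD[OF el]
  obtain k where k: "(i, k) \<in> r" "(j, k) \<in> r" using r(4)[OF x(1) y(1)] by blast
  have kI: "k \<in> I" using r(1)[OF k(1)] by blast
  have k_in: "Ds i k x \<in> S k" "Ds j k y \<in> S k"
    using tmorD(1)[OF D_tmor[OF k(1)] x(2)] tmorD(1)[OF D_tmor[OF k(2)] y(2)] by auto
  have "on_states (c k) (Ds i k x) = on_states (c k) (Ds j k y)"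
    using el(2)[OF k(1) x(2)] el(2)[OF k(2) y(2)] eq by simp
  then obtain l where l: "(k, l) \<in> r" "Ds k l (Ds i k x) = Ds k l (Ds j k y)"
    using el(7)[OF kI k_in] by blast
  note comp = D_comp(1)
  have eq: "Ds i l x = Ds j l y"
    using l(2) comp[OF k(1) l(1) x(2)] comp[OF k(2) l(1) y(2)] by simp
  have il: "(i, l) \<in> r" "(j, l) \<in> r" using r(3)[OF k(1) l(1)] r(3)[OF k(2) l(1)] by auto
  have "(i, h) \<in> r \<and> (j, h) \<in> r \<and> Ds i h x = Ds j h y" if h: "(l, h) \<in> r" for h
    using comp[OF il(1) h x(2)] comp[OF il(2) h y(2)] eq r(3)[OF il(1) h] r(3)[OF il(2) h] by simp
  then show ?thesis unfolding eventually_in_def using r(1)[OF il(1)] by blast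
qed

lemma equal_in_colimit_actions:
  assumes el: "elementwise_colimit I r D X c"
    and x: "i \<in> I" "x \<in> A i" and y: "j \<in> I" "y \<in> A j" and eq: "on_actions (c i) x = on_actions (c
        j) y"
  shows "eventually_in I r (\<lambda>k. (i, k) \<in> r \<and> (j, k) \<in> r \<and> Da i k x = Da j k y)"
proof -
  note el = elementwise_colimitD[OF el]
  obtain k where k: "(i, k) \<in> r" "(j, k) \<in> r" using r(4)[OF x(1) y(1)] by blast
  have kI: "k \<in> I" using r(1)[OF k(1)] by blast
  have k_in: "Da i k x \<in> A k" "Da j k y \<in> A k"
    using tmorD(2)[OF D_tmor[OF k(1)] x(2)] tmorD(2)[OF D_tmor[OF k(2)] y(2)] by auto
  have "on_actions (c k) (Da i k x) = on_actions (c k) (Da j k y)"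
    using el(3)[OF k(1) x(2)] el(3)[OF k(2) y(2)] eq by simp
  then obtain l where l: "(k, l) \<in> r" "Da k l (Da i k x) = Da k l (Da j k y)"
    using el(8)[OF kI k_in] by blast
  note comp = D_comp(2)
  have eq: "Da i l x = Da j l y"
    using l(2) comp[OF k(1) l(1) x(2)] comp[OF k(2) l(1) y(2)] by simp
  have il: "(i, l) \<in> r" "(j, l) \<in> r" using r(3)[OF k(1) l(1)] r(3)[OF k(2) l(1)] by auto
  have "(i, h) \<in> r \<and> (j, h) \<in> r \<and> Da i h x = Da j h y" if h: "(l, h) \<in> r" for h
    using comp[OF il(1) h x(2)] comp[OF il(2) h y(2)] eq r(3)[OF il(1) h] r(3)[OF il(2) h] by simp
  then show ?thesis unfolding eventually_in_def using r(1)[OF il(1)] by blast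
qed

lemma colimit_if_elementwise:
  assumes X: "X \<in> \<O>" and el: "elementwise_colimit I r D X c"
  shows "is_colimit (poset_cat I r) \<C> D X c"
  unfolding is_colimit_def
proof (intro conjI allI impI)
  note same = equal_in_colimit_states[OF el] equal_in_colimit_actions[OF el]
    and el = elementwise_colimitD[OF el]
  show "cocone (poset_cat I r) \<C> D X c"
    using X el(1-3) by (auto simp: cocone_tsystem_iff[OF D])
  fix Y d assume "cocone (poset_cat I r) \<C> D Y d"
  then have Y: "Y \<in> \<O>" and d: "\<And>i. i \<in> I \<Longrightarrow> d i \<in> tmor (omap D i) Y"
    and dD: "\<And>i j x. (i, j) \<in> r \<Longrightarrow> x \<in> S i \<Longrightarrow> on_states (d j) (Ds i j x) = on_states (d i) x"
      "\<And>i j u. (i, j) \<in> r \<Longrightarrow> u \<in> A i \<Longrightarrow> on_actions (d j) (Da i j u) = on_actions (d i) u"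
    by (auto simp: cocone_tsystem_iff[OF D])
  have wds: "on_states (d i) x = on_states (d j) y"
    if "i \<in> I" "x \<in> S i" "j \<in> I" "y \<in> S j" "on_states (c i) x = on_states (c j) y" for i j x y
  proof -
    note ij = that
    obtain k where "(i, k) \<in> r" "(j, k) \<in> r" "Ds i k x = Ds j k y"
      using eventually_in_ex[OF dir same(1)[OF ij]] by blast
    then show ?thesis using dD(1)[of i k x] dD(1)[of j k y] that by simp
  qed
  have wda: "on_actions (d i) x = on_actions (d j) y"
    if "i \<in> I" "x \<in> A i" "j \<in> I" "y \<in> A j" "on_actions (c i) x = on_actions (c j) y" for i j x y
  proof -
    note ij = that
    obtain k where "(i, k) \<in> r" "(j, k) \<in> r" "Da i k x = Da j k y"
      using eventually_in_ex[OF dir same(2)[OF ij]] by blast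
    then show ?thesis using dD(2)[of i k x] dD(2)[of j k y] that by simp
  qed
  have wds': "on_states (d (fst p)) (snd p) = on_states (d (fst q)) (snd q)"
    if "p \<in> Sigma I S" "q \<in> Sigma I S" "on_states (c (fst p)) (snd p) = on_states (c (fst q)) (snd
        q)" for p q
    using wds[of "fst p" "snd p" "fst q" "snd q"] that by auto
  obtain hs where hs0: "\<And>p. p \<in> Sigma I S \<Longrightarrow> hs (on_states (c (fst p)) (snd p)) = on_states (d (fst
      p)) (snd p)"
    using factor_through_image[of "Sigma I S" "\<lambda>p. on_states (c (fst p)) (snd p)"
        "\<lambda>p. on_states (d (fst p)) (snd p)", OF wds'] by blast
  have hs: "hs (on_states (c i) x) = on_states (d i) x" if "i \<in> I" "x \<in> S i" for i x
    using hs0[of "(i, x)"] that by simp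
  have wda': "on_actions (d (fst p)) (snd p) = on_actions (d (fst q)) (snd q)"
    if "p \<in> Sigma I A" "q \<in> Sigma I A" "on_actions (c (fst p)) (snd p) = on_actions (c (fst q))
        (snd q)" for p q
    using wda[of "fst p" "snd p" "fst q" "snd q"] that by auto
  obtain ha where ha0: "\<And>p. p \<in> Sigma I A \<Longrightarrow> ha (on_actions (c (fst p)) (snd p)) = on_actions (d
      (fst p)) (snd p)"
    using factor_through_image[of "Sigma I A" "\<lambda>p. on_actions (c (fst p)) (snd p)"
        "\<lambda>p. on_actions (d (fst p)) (snd p)", OF wda'] by blast
  have ha: "ha (on_actions (c i) x) = on_actions (d i) x" if "i \<in> I" "x \<in> A i" for i x
    using ha0[of "(i, x)"] that by simp
  let ?h = "tmap X Y hs ha"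
  have h: "?h \<in> tmor X Y"
  proof (rule tmap_in_tmor[OF pre[OF X]])
    fix x assume "x \<in> states X"
    then obtain i y where i: "i \<in> I" "y \<in> S i" "on_states (c i) y = x" using el(4) by blast
    then show "hs x \<in> states Y" using hs[OF i(1,2)] tmorD(1)[OF d[OF i(1)] i(2)] by simp
  next
    fix u assume "u \<in> actions X"
    then obtain i v where i: "i \<in> I" "v \<in> A i" "on_actions (c i) v = u" using el(5) by blast
    then show "ha u \<in> actions Y" using ha[OF i(1,2)] tmorD(2)[OF d[OF i(1)] i(2)] by simp
    show "label Y (ha u) = label X u"
      using ha[OF i(1,2)] tmorD(3)[OF d[OF i(1)] i(2)] tmorD(3)[OF el(1)[OF i(1)] i(2)] i(3) by simp
  next
    fix \<alpha> us \<beta> assume "(\<alpha>, us, \<beta>) \<in> trans X"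
    then obtain i \<alpha>' us' \<beta>' where i: "i \<in> I" and t: "(\<alpha>', us', \<beta>') \<in> trans (omap D i)"
      "on_states (c i) \<alpha>' = \<alpha>" "map (on_actions (c i)) us' = us" "on_states (c i) \<beta>' = \<beta>"
      using el(6) by blast
    note p = pre_tsystem_trans[OF D_pre[OF i] t(1)]
    have "ha (on_actions (c i) v) = on_actions (d i) v" if "v \<in> set us'" for v
      using ha[OF i] p(3) that by blast
    then have "map ha us = map (on_actions (d i)) us'" using t(3) by auto
    then show "(hs \<alpha>, map ha us, hs \<beta>) \<in> trans Y"
      using tmorD(4)[OF d[OF i] t(1)] hs[OF i p(1)] hs[OF i p(2)] t(2,4) by simp
  qed
  have comp_iff: "Comp \<C> k (c i) = d i \<longleftrightarrow> (\<forall>x\<in>S i. on_states k (on_states (c i) x) = on_states (d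
      i) x) \<and>
      (\<forall>u\<in>A i. on_actions k (on_actions (c i) u) = on_actions (d i) u)" if "i \<in> I" "k \<in> tmor X Y"
          for i k
    by (rule Comp_eq_iff[OF D_pre[OF that(1)] el(1)[OF that(1)] that(2) d[OF that(1)]])
  show "\<exists>!h. h \<in> Hom \<C> X Y \<and> (\<forall>j\<in>Ob (poset_cat I r). Comp \<C> h (c j) = d j)"
  proof (rule ex1I[of _ ?h])
    show "?h \<in> Hom \<C> X Y \<and> (\<forall>j\<in>Ob (poset_cat I r). Comp \<C> ?h (c j) = d j)"
      using X Y h hs ha tmorD(1,2)[OF el(1)] by (auto simp: Hom_iff comp_iff)
    fix k assume k: "k \<in> Hom \<C> X Y \<and> (\<forall>j\<in>Ob (poset_cat I r). Comp \<C> k (c j) = d j)"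
    then have kt: "k \<in> tmor X Y" by (simp add: Hom_iff)
    show "k = ?h"
    proof (rule tmor_eqI[OF kt h])
      fix x assume x: "x \<in> states X"
      then obtain i y where i: "i \<in> I" "y \<in> S i" "on_states (c i) y = x" using el(4) by blast
      then show "on_states k x = on_states ?h x"
        using k comp_iff[OF i(1) kt] hs[OF i(1,2)] x by auto
    next
      fix u assume u: "u \<in> actions X"
      then obtain i v where i: "i \<in> I" "v \<in> A i" "on_actions (c i) v = u" using el(5) by blast
      then show "on_actions k u = on_actions ?h u"
        using k comp_iff[OF i(1) kt] ha[OF i(1,2)] u by auto
    qed
  qed
qed

lemma small_S: "i \<in> I \<Longrightarrow> small TYPE('u) (S i)" and small_A: "i \<in> I \<Longrightarrow> small TYPE('u) (A i)"
  using D_pre by (auto simp: pre_tsystem_def)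

text \<open>States and actions are glued as sets, and the transitions are the images of those of the
  stages.\<close>

lemma elementwise_colimit_exists:
  assumes U: "universe TYPE('u)" and I: "small TYPE('u) I"
  obtains Z c where "pre_tsystem \<Sigma> Z" "elementwise_colimit I r D Z c"
proof -
  have exS: "\<exists>e :: 'u \<times> 'u \<Rightarrow> 'u. \<forall>i\<in>I. \<forall>x\<in>S i. \<forall>j\<in>I. \<forall>y\<in>S j.
      e (i, x) = e (j, y) \<longleftrightarrow> (\<exists>k. (i, k) \<in> r \<and> (j, k) \<in> r \<and> Ds i k x = Ds j k y)"
    by (rule directed_colimit_of_sets[OF U I dir])
      (simp_all add: small_S tmorD(1)[OF D_tmor] D_comp(1))
  have exA: "\<exists>e :: 'u \<times> 'u \<Rightarrow> 'u. \<forall>i\<in>I. \<forall>x\<in>A i. \<forall>j\<in>I. \<forall>y\<in>A j.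
      e (i, x) = e (j, y) \<longleftrightarrow> (\<exists>k. (i, k) \<in> r \<and> (j, k) \<in> r \<and> Da i k x = Da j k y)"
    by (rule directed_colimit_of_sets[OF U I dir])
      (simp_all add: small_A tmorD(2)[OF D_tmor] D_comp(2))
  obtain e :: "'u \<times> 'u \<Rightarrow> 'u" where e: "\<And>i j x y. i \<in> I \<Longrightarrow> x \<in> S i \<Longrightarrow> j \<in> I \<Longrightarrow> y \<in> S j \<Longrightarrow>
      e (i, x) = e (j, y) \<longleftrightarrow> (\<exists>k. (i, k) \<in> r \<and> (j, k) \<in> r \<and> Ds i k x = Ds j k y)"
    using exS by blast
  obtain a :: "'u \<times> 'u \<Rightarrow> 'u" where a: "\<And>i j x y. i \<in> I \<Longrightarrow> x \<in> A i \<Longrightarrow> j \<in> I \<Longrightarrow> y \<in> A j \<Longrightarrow>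
      a (i, x) = a (j, y) \<longleftrightarrow> (\<exists>k. (i, k) \<in> r \<and> (j, k) \<in> r \<and> Da i k x = Da j k y)"
    using exA by blast
  have wdl: "label (omap D (fst p)) (snd p) = label (omap D (fst q)) (snd q)"
    if "p \<in> Sigma I A" "q \<in> Sigma I A" "a p = a q" for p q
  proof -
    obtain k where k: "(fst p, k) \<in> r" "(fst q, k) \<in> r" "Da (fst p) k (snd p) = Da (fst q) k (snd
        q)"
      using a[of "fst p" "snd p" "fst q" "snd q"] \<open>p \<in> Sigma I A\<close> \<open>q \<in> Sigma I A\<close> \<open>a p = a q\<close>
          by auto
    have "snd p \<in> A (fst p)" "snd q \<in> A (fst q)" using \<open>p \<in> Sigma I A\<close> \<open>q \<in> Sigma I A\<close> by auto
    then show ?thesis using tmorD(3)[OF D_tmor[OF k(1)]] tmorD(3)[OF D_tmor[OF k(2)]] k(3) by metis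
  qed
  obtain l where l: "l \<in> extensional (a ` Sigma I A)"
    "\<And>p. p \<in> Sigma I A \<Longrightarrow> l (a p) = label (omap D (fst p)) (snd p)"
    using factor_through_image[of "Sigma I A" a "\<lambda>p. label (omap D (fst p)) (snd p)", OF wdl]
        by blast
  define Z where "Z = \<lparr>states = e ` Sigma I S, actions = a ` Sigma I A, label = l,
     trans = {(e (i, \<alpha>), map (\<lambda>u. a (i, u)) us, e (i, \<beta>)) | i \<alpha> us \<beta>. i \<in> I \<and>
         (\<alpha>, us, \<beta>) \<in> trans (omap D i)}\<rparr>"
  have Z: "states Z = e ` Sigma I S" "actions Z = a ` Sigma I A" "label Z = l"
    "trans Z = {(e (i, \<alpha>), map (\<lambda>u. a (i, u)) us, e (i, \<beta>)) | i \<alpha> us \<beta>. i \<in> I \<and>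
        (\<alpha>, us, \<beta>) \<in> trans (omap D i)}"
    by (auto simp: Z_def)
  define c where "c i = tmap (omap D i) Z (\<lambda>x. e (i, x)) (\<lambda>u. a (i, u))" for i
  have tD: "\<alpha> \<in> S i \<and> \<beta> \<in> S i \<and> set us \<subseteq> A i \<and> us \<noteq> []" if "i \<in> I" "(\<alpha>, us, \<beta>) \<in> trans (omap D i)"
      for i \<alpha> us \<beta>
    using pre_tsystem_trans[OF D_pre[OF that(1)] that(2)] by blast
  have pZ: "pre_tsystem \<Sigma> Z"
    unfolding pre_tsystem_def
  proof (intro conjI)
    show "small TYPE('u) (states Z)" "small TYPE('u) (actions Z)"
      unfolding Z by (intro small_image small_Sigma U I small_S small_A; assumption)+
    have "l (a p) \<in> \<Sigma>" if "p \<in> Sigma I A" for p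
      using l(2)[OF that] that pre_tsystem_label[OF D_pre] by auto
    then show "label Z \<in> actions Z \<rightarrow>\<^sub>E \<Sigma>" using l(1) unfolding Z PiE_def by auto
    show "trans Z \<subseteq> {(\<alpha>, us, \<beta>). \<alpha> \<in> states Z \<and> us \<in> lists (actions Z) \<and> us \<noteq> [] \<and> \<beta> \<in> states Z}"
    proof
      fix t assume "t \<in> trans Z"
      then obtain i \<alpha> us \<beta> where t: "t = (e (i, \<alpha>), map (\<lambda>u. a (i, u)) us, e (i, \<beta>))" "i \<in> I"
        "(\<alpha>, us, \<beta>) \<in> trans (omap D i)" unfolding Z by blast
      then show "t \<in> {(\<alpha>, us, \<beta>). \<alpha> \<in> states Z \<and> us \<in> lists (actions Z) \<and> us \<noteq> [] \<and> \<beta> \<in> states Z}"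
        using tD[OF t(2,3)] unfolding Z by (auto intro!: image_eqI[of "a (i, _)" a])
    qed
  qed
  have c: "c i \<in> tmor (omap D i) Z" if i: "i \<in> I" for i
    unfolding c_def
  proof (rule tmap_in_tmor[OF D_pre[OF i]])
    show "label Z (a (i, u)) = label (omap D i) u" if "u \<in> A i" for u
      using l(2)[of "(i, u)"] i that unfolding Z by simp
    show "(e (i, \<alpha>), map (\<lambda>u. a (i, u)) us, e (i, \<beta>)) \<in> trans Z"
        if "(\<alpha>, us, \<beta>) \<in> trans (omap D i)" for \<alpha> us \<beta>
      using i that unfolding Z by blast
  qed (use i Z in auto)
  have ap: "\<And>i x. x \<in> S i \<Longrightarrow> on_states (c i) x = e (i, x)" "\<And>i u. u \<in> A i \<Longrightarrow> on_actions (c i) u =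
      a (i, u)"
    by (auto simp: c_def)
  have "elementwise_colimit I r D Z c"
    unfolding elementwise_colimit_def
  proof (intro conjI ballI allI impI)
    show "c i \<in> tmor (omap D i) Z" if "i \<in> I" for i using c[OF that] .
    show "on_states (c j) (Ds i j x) = on_states (c i) x" if ij: "(i, j) \<in> r" and x: "x \<in> S i"
        for i j x
    proof -
      have I: "i \<in> I" "j \<in> I" using r(1)[OF ij] by auto
      have y: "Ds i j x \<in> S j" using tmorD(1)[OF D_tmor[OF ij] x] .
      have "e (j, Ds i j x) = e (i, x)"
        using e[OF I(2) y I(1) x] ij r(2)[OF I(2)] D_id(1)[OF I(2) y] by auto
      then show ?thesis using ap(1)[OF y] ap(1)[OF x] by simp
    qed
    show "on_actions (c j) (Da i j x) = on_actions (c i) x" if ij: "(i, j) \<in> r" and x: "x \<in> A i"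
        for i j x
    proof -
      have I: "i \<in> I" "j \<in> I" using r(1)[OF ij] by auto
      have y: "Da i j x \<in> A j" using tmorD(2)[OF D_tmor[OF ij] x] .
      have "a (j, Da i j x) = a (i, x)"
        using a[OF I(2) y I(1) x] ij r(2)[OF I(2)] D_id(2)[OF I(2) y] by auto
      then show ?thesis using ap(2)[OF y] ap(2)[OF x] by simp
    qed
    show "\<exists>i\<in>I. \<exists>y\<in>S i. on_states (c i) y = x" if "x \<in> states Z" for x
      using that ap(1) unfolding Z by auto
    show "\<exists>i\<in>I. \<exists>y\<in>A i. on_actions (c i) y = x" if "x \<in> actions Z" for x
      using that ap(2) unfolding Z by auto
    show "\<exists>i\<in>I. \<exists>\<alpha>' us' \<beta>'. (\<alpha>', us', \<beta>') \<in> trans (omap D i) \<and>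
        on_states (c i) \<alpha>' = \<alpha> \<and> map (on_actions (c i)) us' = us \<and> on_states (c i) \<beta>' = \<beta>"
      if "(\<alpha>, us, \<beta>) \<in> trans Z" for \<alpha> us \<beta>
    proof -
      obtain i \<alpha>' us' \<beta>' where t: "i \<in> I" "(\<alpha>', us', \<beta>') \<in> trans (omap D i)"
        "\<alpha> = e (i, \<alpha>')" "us = map (\<lambda>u. a (i, u)) us'" "\<beta> = e (i, \<beta>')"
        using \<open>(\<alpha>, us, \<beta>) \<in> trans Z\<close> unfolding Z by blast
      note td = tD[OF t(1,2)]
      have m: "map (on_actions (c i)) us' = us" using td ap(2) t(4) by auto
      show ?thesis
        by (intro bexI[OF _ t(1)] exI[of _ \<alpha>'] exI[of _ us'] exI[of _ \<beta>']) (use m td ap(1) t in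
            auto)
    qed
    show "\<exists>j. (i, j) \<in> r \<and> Ds i j x = Ds i j y"
      if "i \<in> I" "x \<in> S i" "y \<in> S i" "on_states (c i) x = on_states (c i) y" for i x y
      using e[of i x i y] ap(1) that by auto
    show "\<exists>j. (i, j) \<in> r \<and> Da i j x = Da i j y"
      if "i \<in> I" "x \<in> A i" "y \<in> A i" "on_actions (c i) x = on_actions (c i) y" for i x y
      using a[of i x i y] ap(2) that by auto
  qed
  then show ?thesis using that pZ by blast
qed

text \<open>Finitely many states, actions and transitions of a directed colimit, possibly named with
  repetitions, occur together at one stage.\<close>

lemma finite_lift:
  assumes el: "elementwise_colimit I r D X c"
    and fin: "finite Fs" "finite Fa" "finite Ft"
    and fs: "\<And>x. x \<in> Fs \<Longrightarrow> fs x \<in> states X" and fa: "\<And>u. u \<in> Fa \<Longrightarrow> fa u \<in> actions X"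
    and Ft: "\<And>\<alpha> us \<beta>. (\<alpha>, us, \<beta>) \<in> Ft \<Longrightarrow> \<alpha> \<in> Fs \<and> set us \<subseteq> Fa \<and> \<beta> \<in> Fs \<and>
      (fs \<alpha>, map fa us, fs \<beta>) \<in> trans X"
  obtains i gs ga where "i \<in> I" "\<And>x. x \<in> Fs \<Longrightarrow> gs x \<in> S i \<and> on_states (c i) (gs x) = fs x"
    "\<And>u. u \<in> Fa \<Longrightarrow> ga u \<in> A i \<and> on_actions (c i) (ga u) = fa u"
    "\<And>\<alpha> us \<beta>. (\<alpha>, us, \<beta>) \<in> Ft \<Longrightarrow> (gs \<alpha>, map ga us, gs \<beta>) \<in> trans (omap D i)"
proof -
  note elX = el and el = elementwise_colimitD[OF el]
  have "eventually_in I r (\<lambda>k. \<exists>y\<in>S k. on_states (c k) y = fs x)" if x: "x \<in> Fs" for x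
  proof -
    obtain i y where i: "i \<in> I" "y \<in> S i" "on_states (c i) y = fs x" using el(4)[OF fs[OF x]]
        by blast
    have "\<exists>y\<in>S k. on_states (c k) y = fs x" if k: "(i, k) \<in> r" for k
      using el(2)[OF k i(2)] tmorD(1)[OF D_tmor[OF k] i(2)] i(3) by metis
    then show ?thesis unfolding eventually_in_def using i(1) by blast
  qed
  then have evs: "eventually_in I r (\<lambda>k. \<forall>x\<in>Fs. \<exists>y\<in>S k. on_states (c k) y = fs x)"
    by (rule eventually_in_ball[OF dir fin(1)])
  have "eventually_in I r (\<lambda>k. \<exists>v\<in>A k. on_actions (c k) v = fa u)" if u: "u \<in> Fa" for u
  proof -
    obtain i v where i: "i \<in> I" "v \<in> A i" "on_actions (c i) v = fa u" using el(5)[OF fa[OF u]]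
        by blast
    have "\<exists>v\<in>A k. on_actions (c k) v = fa u" if k: "(i, k) \<in> r" for k
      using el(3)[OF k i(2)] tmorD(2)[OF D_tmor[OF k] i(2)] i(3) by metis
    then show ?thesis unfolding eventually_in_def using i(1) by blast
  qed
  then have eva: "eventually_in I r (\<lambda>k. \<forall>u\<in>Fa. \<exists>v\<in>A k. on_actions (c k) v = fa u)"
    by (rule eventually_in_ball[OF dir fin(2)])
  \<comment> \<open>All the names get values at one stage \<open>i0\<close>. Each transition is then found at a later stage,
    where its ends and its actions agree with the images of these values.\<close>
  obtain i0 where i0: "i0 \<in> I" "\<forall>x\<in>Fs. \<exists>y\<in>S i0. on_states (c i0) y = fs x"
    "\<forall>u\<in>Fa. \<exists>v\<in>A i0. on_actions (c i0) v = fa u"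
    using eventually_in_ex[OF dir eventually_in_conj[OF dir evs eva]] by blast
  obtain gs where gs: "\<And>x. x \<in> Fs \<Longrightarrow> gs x \<in> S i0" "\<And>x. x \<in> Fs \<Longrightarrow> on_states (c i0) (gs x) = fs x"
    using i0(2) by metis
  obtain ga where ga: "\<And>u. u \<in> Fa \<Longrightarrow> ga u \<in> A i0" "\<And>u. u \<in> Fa \<Longrightarrow> on_actions (c i0) (ga u) = fa u"
    using i0(3) by metis
  let ?T = "\<lambda>t k. (Ds i0 k (gs (fst t)), map (\<lambda>u. Da i0 k (ga u)) (fst (snd t)), Ds i0 k (gs (snd
      (snd t))))
      \<in> trans (omap D k)"
  have "eventually_in I r (?T t)" if t: "t \<in> Ft" for t
  proof -
    obtain \<alpha> us \<beta> where t': "t = (\<alpha>, us, \<beta>)" by (cases t)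
    have F: "\<alpha> \<in> Fs" "set us \<subseteq> Fa" "\<beta> \<in> Fs" "(fs \<alpha>, map fa us, fs \<beta>) \<in> trans X"
      using Ft t unfolding t' by blast+
    obtain i \<alpha>' us' \<beta>' where i: "i \<in> I" and i': "(\<alpha>', us', \<beta>') \<in> trans (omap D i)"
      "on_states (c i) \<alpha>' = fs \<alpha>" "map (on_actions (c i)) us' = map fa us"
          "on_states (c i) \<beta>' = fs \<beta>"
      using el(6)[OF F(4)] by blast
    note p = pre_tsystem_trans[OF D_pre[OF i] i'(1)]
    have len: "length us' = length us" using arg_cong[OF i'(3), of length] by simp
    have nth: "us ! n \<in> Fa \<and> us' ! n \<in> A i \<and> on_actions (c i) (us' ! n) = fa (us ! n)"
        if "n < length us" for n
    proof -
      have "us ! n \<in> set us" "us' ! n \<in> set us'" using that len by auto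
      moreover have "map (on_actions (c i)) us' ! n = map fa us ! n" using i'(3) by simp
      ultimately show ?thesis using that len F(2) p(3) by auto
    qed
    let ?e = "\<lambda>x y k. (i0, k) \<in> r \<and> (i, k) \<in> r \<and> Ds i0 k x = Ds i k y"
    have e1: "eventually_in I r (?e (gs \<alpha>) \<alpha>')" "eventually_in I r (?e (gs \<beta>) \<beta>')"
      by (rule equal_in_colimit_states[OF elX]; use i0(1) gs F(1,3) i p(1,2) i'(2,4) in simp)+
    have e2: "eventually_in I r (\<lambda>k. \<forall>n\<in>{..<length us}. (i0, k) \<in> r \<and> (i, k) \<in> r \<and>
        Da i0 k (ga (us ! n)) = Da i k (us' ! n))"
      by (rule eventually_in_ball[OF dir], simp, rule equal_in_colimit_actions[OF elX]) (use i0(1)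
          ga i nth in auto)
    show ?thesis
    proof (rule eventually_in_mono[OF eventually_in_conj[OF dir eventually_in_conj[OF dir e1] e2]
        _ dir])
      fix k assume k: "(?e (gs \<alpha>) \<alpha>' k \<and> ?e (gs \<beta>) \<beta>' k) \<and>
          (\<forall>n\<in>{..<length us}. (i0, k) \<in> r \<and> (i, k) \<in> r \<and> Da i0 k (ga (us ! n)) = Da i k (us' ! n))"
      then have "map (\<lambda>u. Da i0 k (ga u)) us = map (Da i k) us'"
        using len by (auto intro: nth_equalityI)
      then show "?T t k" using tmorD(4)[OF D_tmor i'(1), of k] k unfolding t' by simp
    qed
  qed
  then have "eventually_in I r (\<lambda>k. \<forall>t\<in>Ft. ?T t k)" by (rule eventually_in_ball[OF dir fin(3)])
  from eventually_in_ex[OF dir eventually_in_conj[OF dir eventually_in_above[OF dir i0(1)] this]]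
  obtain k where k: "k \<in> I" "(i0, k) \<in> r" "\<And>t. t \<in> Ft \<Longrightarrow> ?T t k" by blast
  show ?thesis
  proof (rule that[OF k(1)])
    show "Ds i0 k (gs x) \<in> S k \<and> on_states (c k) (Ds i0 k (gs x)) = fs x" if "x \<in> Fs" for x
      using gs[OF that] el(2)[OF k(2)] tmorD(1)[OF D_tmor[OF k(2)]] by simp
    show "Da i0 k (ga u) \<in> A k \<and> on_actions (c k) (Da i0 k (ga u)) = fa u" if "u \<in> Fa" for u
      using ga[OF that] el(3)[OF k(2)] tmorD(2)[OF D_tmor[OF k(2)]] by simp
    show "(Ds i0 k (gs \<alpha>), map (\<lambda>u. Da i0 k (ga u)) us, Ds i0 k (gs \<beta>)) \<in> trans (omap D k)"
      if "(\<alpha>, us, \<beta>) \<in> Ft" for \<alpha> us \<beta>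
      using k(3)[OF that] by simp
  qed
qed

text \<open>Stage \<open>i\<close> contains a copy of \<open>T\<close>, along \<open>gs\<close> on states and \<open>ga\<close> on actions, that the leg \<open>c
  i\<close> sends back to \<open>T\<close> itself.\<close>

definition lifts_to ::
    "('u \<Rightarrow> ('u, 'a) tmorphism) \<Rightarrow> 'u \<Rightarrow> ('u \<Rightarrow> 'u) \<Rightarrow> ('u \<Rightarrow> 'u) \<Rightarrow> ('u \<times> 'u list \<times> 'u) set \<Rightarrow> bool" where
  "lifts_to c i gs ga T \<longleftrightarrow> (\<forall>\<alpha> us \<beta>. (\<alpha>, us, \<beta>) \<in> T \<longrightarrow>
      (gs \<alpha>, map ga us, gs \<beta>) \<in> trans (omap D i) \<and> on_states (c i) (gs \<alpha>) = \<alpha> \<and>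
      on_states (c i) (gs \<beta>) = \<beta> \<and> (\<forall>u\<in>set us. ga u \<in> A i \<and> on_actions (c i) (ga u) = u))"

lemma lifts_toD:
  assumes "lifts_to c i gs ga T" "(\<alpha>, us, \<beta>) \<in> T"
  shows "(gs \<alpha>, map ga us, gs \<beta>) \<in> trans (omap D i) \<and> on_states (c i) (gs \<alpha>) = \<alpha> \<and>
      on_states (c i) (gs \<beta>) = \<beta> \<and> (\<forall>u\<in>set us. ga u \<in> A i \<and> on_actions (c i) (ga u) = u)"
  using assms unfolding lifts_to_def by blast

lemma finite_lift_transitions:
  assumes X: "pre_tsystem \<Sigma> X" and el: "elementwise_colimit I r D X c"
    and T: "finite T" "T \<subseteq> trans X"
  obtains i gs ga where "i \<in> I" "lifts_to c i gs ga T"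
proof -
  let ?Fs = "fst ` T \<union> (\<lambda>t. snd (snd t)) ` T" and ?Fa = "\<Union>t\<in>T. set (fst (snd t))"
  have Fs: "\<alpha> \<in> ?Fs" "\<beta> \<in> ?Fs" "set us \<subseteq> ?Fa" if "(\<alpha>, us, \<beta>) \<in> T" for \<alpha> us \<beta>
    using that by (auto intro: rev_image_eqI rev_bexI)
  have t: "x \<in> states X" if "x \<in> ?Fs" for x using that T(2) pre_tsystem_trans(1,2)[OF X]
      by fastforce
  have a: "u \<in> actions X" if "u \<in> ?Fa" for u using that T(2) pre_tsystem_trans(3)[OF X] by fastforce
  obtain i gs ga where i: "i \<in> I" "\<And>x. x \<in> ?Fs \<Longrightarrow> gs x \<in> S i \<and> on_states (c i) (gs x) = id x"
    "\<And>u. u \<in> ?Fa \<Longrightarrow> ga u \<in> A i \<and> on_actions (c i) (ga u) = id u"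
    "\<And>\<alpha> us \<beta>. (\<alpha>, us, \<beta>) \<in> T \<Longrightarrow> (gs \<alpha>, map ga us, gs \<beta>) \<in> trans (omap D i)"
  proof (rule finite_lift[OF el, of ?Fs ?Fa T id id])
    show "finite ?Fs" "finite ?Fa" "finite T" using T(1) by auto
    show "\<alpha> \<in> ?Fs \<and> set us \<subseteq> ?Fa \<and> \<beta> \<in> ?Fs \<and> (id \<alpha>, map id us, id \<beta>) \<in> trans X"
        if "(\<alpha>, us, \<beta>) \<in> T" for \<alpha> us \<beta>
      using Fs[OF that] T(2) that by auto
  qed (use t a in auto)
  show ?thesis
  proof (rule that[OF i(1)], unfold lifts_to_def, intro allI impI)
    fix \<alpha> us \<beta> assume T: "(\<alpha>, us, \<beta>) \<in> T"
    show "(gs \<alpha>, map ga us, gs \<beta>) \<in> trans (omap D i) \<and> on_states (c i) (gs \<alpha>) = \<alpha> \<and>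
      on_states (c i) (gs \<beta>) = \<beta> \<and> (\<forall>u\<in>set us. ga u \<in> A i \<and> on_actions (c i) (ga u) = u)"
    proof (intro conjI ballI)
      fix u assume "u \<in> set us"
      then have "u \<in> ?Fa" using Fs(3)[OF T] by blast
      then show "ga u \<in> A i" "on_actions (c i) (ga u) = u" using i(3) by simp_all
    qed (use i(4)[OF T] i(2)[OF Fs(1)[OF T]] i(2)[OF Fs(2)[OF T]] in simp_all)
  qed
qed

end

section \<open>Axioms and finite systems in directed colimits\<close>

text \<open>Coherence follows from the uniqueness of intermediate states: splitting \<open>(\<nu>1, drop p us, \<beta>)\<close>
  and \<open>(\<alpha>, take (p + q) us, \<nu>2)\<close> gives a second pair of intermediate states, which the third axiom
  identifies with \<open>\<nu>1\<close> and \<open>\<nu>2\<close>.\<close>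

lemma hdts_imp_weak_hdts:
  assumes "hdts \<Sigma> X"
  shows "weak_hdts \<Sigma> X"
proof -
  have "coherence_axiom X"
    unfolding coherence_axiom_def
  proof (intro allI impI, elim conjE)
    fix \<alpha> us \<beta> \<nu>1 \<nu>2 p q
    assume pq: "1 \<le> p" "1 \<le> q" "p + q < length us" and t: "(\<alpha>, us, \<beta>) \<in> trans X"
      "(\<alpha>, take p us, \<nu>1) \<in> trans X" "(\<nu>1, drop p us, \<beta>) \<in> trans X"
      "(\<alpha>, take (p + q) us, \<nu>2) \<in> trans X" "(\<nu>2, drop (p + q) us, \<beta>) \<in> trans X"
    have csa2: "CSA2 X" and csa3: "CSA3 X" using assms by (auto simp: hdts_def)
    have split: "\<exists>\<nu>. (\<alpha>, take p us, \<nu>) \<in> trans X \<and> (\<nu>, drop p us, \<beta>) \<in> trans X"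
      if "1 \<le> p" "p < length us" "(\<alpha>, us, \<beta>) \<in> trans X" for \<alpha> us \<beta> p
    proof -
      have "2 \<le> length us" using that by simp
      then show ?thesis using csa2 that unfolding CSA2_def by blast
    qed
    obtain \<nu>2' where n2: "(\<nu>1, take q (drop p us), \<nu>2') \<in> trans X"
        "(\<nu>2', drop (p + q) us, \<beta>) \<in> trans X"
    proof -
      have "q < length (drop p us)" using pq(3) by simp
      from split[OF pq(2) this t(3)] show ?thesis using that by (auto simp: add.commute)
    qed
    obtain \<nu>1' where n1: "(\<alpha>, take p us, \<nu>1') \<in> trans X" "(\<nu>1', take q (drop p us), \<nu>2) \<in> trans X"
      using split[OF pq(1) _ t(4)] pq(2,3) by (auto simp: drop_take min_def split: if_splits)
    have "\<nu>1 = \<nu>1' \<and> \<nu>2' = \<nu>2"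
      using csa3[unfolded CSA3_def, rule_format, of p q us \<alpha> \<beta> \<nu>1 \<nu>2' \<nu>2 \<nu>1'] pq t n1 n2 by blast
    then show "(\<nu>1, take q (drop p us), \<nu>2) \<in> trans X" using n1 by simp
  qed
  then show ?thesis using assms by (simp add: hdts_def weak_hdts_def)
qed

text \<open>Each axiom is verified in the same way: the transitions in its premise are lifted to one
  stage, the axiom is applied there, and the conclusion is sent back to the colimit.\<close>

context directed_diagram
begin

lemma push_transition:
  assumes "c \<in> tmor (omap D i) X" "(\<alpha>', map ga vs, \<beta>') \<in> trans (omap D i)"
    and "\<And>u. u \<in> set vs \<Longrightarrow> on_actions c (ga u) = u"
  shows "(on_states c \<alpha>', vs, on_states c \<beta>') \<in> trans X"
proof -
  have "map (on_actions c) (map ga vs) = vs" using assms(3) by (simp add: map_idI)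
  then show ?thesis using tmorD(4)[OF assms(1,2)] by simp
qed

lemma multiset_axiom_elementwise:
  assumes X: "pre_tsystem \<Sigma> X" and el: "elementwise_colimit I r D X c"
    and D: "\<And>i. i \<in> I \<Longrightarrow> multiset_axiom (omap D i)"
  shows "multiset_axiom X"
  unfolding multiset_axiom_def
proof (intro allI impI, elim conjE)
  fix \<alpha> us \<beta> \<sigma>
  assume len: "2 \<le> length us" and s: "\<sigma> permutes {..<length us}" and t: "(\<alpha>, us, \<beta>) \<in> trans X"
  obtain i gs ga where i: "i \<in> I" and l: "lifts_to c i gs ga {(\<alpha>, us, \<beta>)}"
    by (rule finite_lift_transitions[OF X el, of "{(\<alpha>, us, \<beta>)}"]) (use t in auto)
  note g = lifts_toD[OF l]
  have "(gs \<alpha>, permute_list \<sigma> (map ga us), gs \<beta>) \<in> trans (omap D i)"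
    using D[OF i] len s g[of \<alpha> us \<beta>] unfolding multiset_axiom_def by simp
  moreover have "permute_list \<sigma> (map ga us) = map ga (permute_list \<sigma> us)"
    by (rule permute_list_map[OF s])
  ultimately have "(gs \<alpha>, map ga (permute_list \<sigma> us), gs \<beta>) \<in> trans (omap D i)" by metis
  from push_transition[OF elementwise_colimitD(1)[OF el i] this]
  show "(\<alpha>, permute_list \<sigma> us, \<beta>) \<in> trans X" using g[of \<alpha> us \<beta>] s by simp
qed

lemma coherence_axiom_elementwise:
  assumes X: "pre_tsystem \<Sigma> X" and el: "elementwise_colimit I r D X c"
    and D: "\<And>i. i \<in> I \<Longrightarrow> coherence_axiom (omap D i)"
  shows "coherence_axiom X"
  unfolding coherence_axiom_def
proof (intro allI impI, elim conjE)
  fix \<alpha> us \<beta> \<nu>1 \<nu>2 p q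
  assume pq: "3 \<le> length us" "1 \<le> p" "1 \<le> q" "p + q < length us" and t: "(\<alpha>, us, \<beta>) \<in> trans X"
      "(\<alpha>, take p us, \<nu>1) \<in> trans X" "(\<nu>1, drop p us, \<beta>) \<in> trans X"
      "(\<alpha>, take (p + q) us, \<nu>2) \<in> trans X" "(\<nu>2, drop (p + q) us, \<beta>) \<in> trans X"
  let ?T = "{(\<alpha>, us, \<beta>), (\<alpha>, take p us, \<nu>1), (\<nu>1, drop p us, \<beta>), (\<alpha>, take (p + q) us, \<nu>2),
      (\<nu>2, drop (p + q) us, \<beta>)}"
  obtain i gs ga where i: "i \<in> I" and l: "lifts_to c i gs ga ?T"
    by (rule finite_lift_transitions[OF X el, of ?T]) (use t in auto)
  note g = lifts_toD[OF l]
  have "(gs \<nu>1, take q (drop p (map ga us)), gs \<nu>2) \<in> trans (omap D i)"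
    by (rule D[OF i, unfolded coherence_axiom_def, rule_format, of "map ga us" p q "gs \<alpha>" "gs \<beta>"])
      (use pq g in \<open>auto simp: take_map drop_map\<close>)
  then have "(gs \<nu>1, map ga (take q (drop p us)), gs \<nu>2) \<in> trans (omap D i)"
    by (simp add: take_map drop_map)
  from push_transition[OF elementwise_colimitD(1)[OF el i] this]
  show "(\<nu>1, take q (drop p us), \<nu>2) \<in> trans X"
    using g[of \<alpha> us \<beta>] g[of \<alpha> "take p us" \<nu>1] g[of \<alpha> "take (p + q) us" \<nu>2]
    by (auto dest!: in_set_takeD in_set_dropD)
qed

lemma CSA1_elementwise:
  assumes X: "pre_tsystem \<Sigma> X" and el: "elementwise_colimit I r D X c"
    and D: "\<And>i. i \<in> I \<Longrightarrow> CSA1 (omap D i)"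
  shows "CSA1 X"
  unfolding CSA1_def
proof (intro allI impI, elim conjE)
  fix \<alpha> \<beta> u u'
  assume t: "(\<alpha>, [u], \<beta>) \<in> trans X" "(\<alpha>, [u'], \<beta>) \<in> trans X" and lab: "label X u = label X u'"
  let ?T = "{(\<alpha>, [u], \<beta>), (\<alpha>, [u'], \<beta>)}"
  obtain i gs ga where i: "i \<in> I" and l: "lifts_to c i gs ga ?T"
    by (rule finite_lift_transitions[OF X el, of ?T]) (use t in auto)
  note g = lifts_toD[OF l]
  have u: "ga u \<in> A i" "ga u' \<in> A i" "on_actions (c i) (ga u) = u" "on_actions (c i) (ga u') = u'"
    and t': "(gs \<alpha>, [ga u], gs \<beta>) \<in> trans (omap D i)" "(gs \<alpha>, [ga u'], gs \<beta>) \<in> trans (omap D i)"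
    using g[of \<alpha> "[u]" \<beta>] g[of \<alpha> "[u']" \<beta>] by auto
  have "label (omap D i) (ga u) = label (omap D i) (ga u')"
    using tmorD(3)[OF elementwise_colimitD(1)[OF el i]] u lab by metis
  then have "ga u = ga u'" using D[OF i] t' unfolding CSA1_def by blast
  then show "u = u'" using u by metis
qed

lemma CSA2_elementwise:
  assumes X: "pre_tsystem \<Sigma> X" and el: "elementwise_colimit I r D X c"
    and D: "\<And>i. i \<in> I \<Longrightarrow> CSA2 (omap D i)"
  shows "CSA2 X"
proof -
  have split: "\<exists>!\<nu>. \<nu> \<in> states X \<and> (\<alpha>, xs, \<nu>) \<in> trans X \<and> (\<nu>, ys, \<beta>) \<in> trans X"
    if t: "(\<alpha>, us, \<beta>) \<in> trans X" and xs: "set xs \<subseteq> set us" and ys: "set ys \<subseteq> set us"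
      and Di: "\<And>i gs ga. i \<in> I \<Longrightarrow> (gs \<alpha>, map ga us, gs \<beta>) \<in> trans (omap D i) \<Longrightarrow>
        \<exists>!\<nu>. \<nu> \<in> S i \<and> (gs \<alpha>, map ga xs, \<nu>) \<in> trans (omap D i) \<and> (\<nu>, map ga ys, gs \<beta>) \<in> trans
            (omap D i)"
    for \<alpha> us \<beta> xs ys
  proof -
    obtain i gs ga where i: "i \<in> I" and l: "lifts_to c i gs ga {(\<alpha>, us, \<beta>)}"
      by (rule finite_lift_transitions[OF X el, of "{(\<alpha>, us, \<beta>)}"]) (use t in auto)
    note g = lifts_toD[OF l]
    have g': "(gs \<alpha>, map ga us, gs \<beta>) \<in> trans (omap D i)" "on_states (c i) (gs \<alpha>) = \<alpha>"
      "on_states (c i) (gs \<beta>) = \<beta>" "\<And>u. u \<in> set us \<Longrightarrow> on_actions (c i) (ga u) = u"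
      using g[of \<alpha> us \<beta>] by auto
    obtain \<nu> where n: "(gs \<alpha>, map ga xs, \<nu>) \<in> trans (omap D i)"
        "(\<nu>, map ga ys, gs \<beta>) \<in> trans (omap D i)"
      using Di[OF i g'(1)] by blast
    note ci = elementwise_colimitD(1)[OF el i]
    have "(\<alpha>, xs, on_states (c i) \<nu>) \<in> trans X" "(on_states (c i) \<nu>, ys, \<beta>) \<in> trans X"
      using push_transition[OF ci n(1)] push_transition[OF ci n(2)] g' xs ys by auto
    moreover have "\<nu> = \<nu>'" if n: "(\<alpha>, xs, \<nu>) \<in> trans X" "(\<nu>, ys, \<beta>) \<in> trans X"
      "(\<alpha>, xs, \<nu>') \<in> trans X" "(\<nu>', ys, \<beta>) \<in> trans X" for \<nu> \<nu>'
    proof -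
      let ?T = "{(\<alpha>, us, \<beta>), (\<alpha>, xs, \<nu>), (\<nu>, ys, \<beta>), (\<alpha>, xs, \<nu>'), (\<nu>', ys, \<beta>)}"
      obtain i gs ga where i: "i \<in> I" and l: "lifts_to c i gs ga ?T"
        by (rule finite_lift_transitions[OF X el, of ?T]) (use t n in auto)
      note g = lifts_toD[OF l]
      have t': "(gs \<alpha>, map ga us, gs \<beta>) \<in> trans (omap D i)"
        "(gs \<alpha>, map ga xs, gs \<nu>) \<in> trans (omap D i)" "(gs \<nu>, map ga ys, gs \<beta>) \<in> trans (omap D i)"
        "(gs \<alpha>, map ga xs, gs \<nu>') \<in> trans (omap D i)" "(gs \<nu>', map ga ys, gs \<beta>) \<in> trans (omap D i)"
        and c: "on_states (c i) (gs \<nu>) = \<nu>" "on_states (c i) (gs \<nu>') = \<nu>'"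
        using g[of \<alpha> us \<beta>] g[of \<alpha> xs \<nu>] g[of \<nu> ys \<beta>] g[of \<alpha> xs \<nu>'] g[of \<nu>' ys \<beta>] by simp_all
      have "gs \<nu> \<in> S i" "gs \<nu>' \<in> S i" using pre_tsystem_trans(1)[OF D_pre[OF i]] t' by blast+
      then have "gs \<nu> = gs \<nu>'" using Di[OF i t'(1)] t' by blast
      then show ?thesis using c by metis
    qed
    moreover have "\<nu> \<in> states X" if "(\<alpha>, xs, \<nu>) \<in> trans X" for \<nu>
        using pre_tsystem_trans[OF X that] by simp
    ultimately show ?thesis by blast
  qed
  show ?thesis
    unfolding CSA2_def
  proof (intro allI impI, elim conjE)
    fix \<alpha> us \<beta> p assume p: "2 \<le> length us" "1 \<le> p" "p < length us" and t: "(\<alpha>, us, \<beta>) \<in> trans X"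
    have Di: "(\<exists>!\<nu>. \<nu> \<in> S i \<and> (gs \<alpha>, map ga (take p us), \<nu>) \<in> trans (omap D i) \<and>
          (\<nu>, map ga (drop p us), gs \<beta>) \<in> trans (omap D i)) \<and>
        (\<exists>!\<nu>. \<nu> \<in> S i \<and> (gs \<alpha>, map ga (drop p us), \<nu>) \<in> trans (omap D i) \<and>
          (\<nu>, map ga (take p us), gs \<beta>) \<in> trans (omap D i))"
      if "i \<in> I" "(gs \<alpha>, map ga us, gs \<beta>) \<in> trans (omap D i)" for i gs ga
      using D[OF that(1), unfolded CSA2_def, rule_format, of "map ga us" p "gs \<alpha>" "gs \<beta>"] p that(2)
      unfolding take_map[symmetric] drop_map[symmetric] by simp
    show "(\<exists>!\<nu>1. \<nu>1 \<in> states X \<and> (\<alpha>, take p us, \<nu>1) \<in> trans X \<and> (\<nu>1, drop p us, \<beta>) \<in> trans X) \<and>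
        (\<exists>!\<nu>2. \<nu>2 \<in> states X \<and> (\<alpha>, drop p us, \<nu>2) \<in> trans X \<and> (\<nu>2, take p us, \<beta>) \<in> trans X)"
      by (intro conjI split[OF t] set_take_subset set_drop_subset)
        (rule Di[THEN conjunct1] Di[THEN conjunct2]; assumption)+
  qed
qed

lemma CSA3_elementwise:
  assumes X: "pre_tsystem \<Sigma> X" and el: "elementwise_colimit I r D X c"
    and D: "\<And>i. i \<in> I \<Longrightarrow> CSA3 (omap D i)"
  shows "CSA3 X"
  unfolding CSA3_def
proof (intro allI impI, elim conjE)
  fix \<alpha> us \<beta> \<nu>1 \<nu>2 \<nu>1' \<nu>2' p q
  assume pq: "1 \<le> p" "1 \<le> q" "p + q < length us" and t: "(\<alpha>, us, \<beta>) \<in> trans X"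
      "(\<alpha>, take p us, \<nu>1) \<in> trans X" "(\<nu>1, drop p us, \<beta>) \<in> trans X"
      "(\<nu>1, take q (drop p us), \<nu>2) \<in> trans X" "(\<nu>2, drop (p + q) us, \<beta>) \<in> trans X"
      "(\<alpha>, take (p + q) us, \<nu>2') \<in> trans X" "(\<nu>2', drop (p + q) us, \<beta>) \<in> trans X"
      "(\<alpha>, take p us, \<nu>1') \<in> trans X" "(\<nu>1', take q (drop p us), \<nu>2') \<in> trans X"
  let ?T = "{(\<alpha>, us, \<beta>), (\<alpha>, take p us, \<nu>1), (\<nu>1, drop p us, \<beta>), (\<nu>1, take q (drop p us), \<nu>2),
      (\<nu>2, drop (p + q) us, \<beta>), (\<alpha>, take (p + q) us, \<nu>2'), (\<nu>2', drop (p + q) us, \<beta>),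
      (\<alpha>, take p us, \<nu>1'), (\<nu>1', take q (drop p us), \<nu>2')}"
  obtain i gs ga where i: "i \<in> I" and l: "lifts_to c i gs ga ?T"
    by (rule finite_lift_transitions[OF X el, of ?T]) (use t in auto)
  note g = lifts_toD[OF l]
  have t': "(gs \<alpha>', map ga us', gs \<beta>') \<in> trans (omap D i)" if "(\<alpha>', us', \<beta>') \<in> ?T" for \<alpha>' us' \<beta>'
    using g[OF that] by blast
  have "gs \<nu>1 = gs \<nu>1' \<and> gs \<nu>2 = gs \<nu>2'"
    by (rule D[OF i, unfolded CSA3_def, rule_format, of p q "map ga us" "gs \<alpha>" "gs \<beta>"])
      (use pq t' in \<open>simp add: take_map drop_map\<close>)
  moreover have "on_states (c i) (gs \<nu>) = \<nu>" if "\<nu> \<in> {\<nu>1, \<nu>1', \<nu>2, \<nu>2'}" for \<nu>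
    using that g[of \<alpha> "take p us" \<nu>1] g[of \<alpha> "take p us" \<nu>1'] g[of \<nu>1 "take q (drop p us)" \<nu>2]
      g[of \<alpha> "take (p + q) us" \<nu>2'] by auto
  ultimately show "\<nu>1 = \<nu>1' \<and> \<nu>2 = \<nu>2'" by (metis insertI1 insertI2)
qed

lemma weak_hdts_elementwise:
  assumes "pre_tsystem \<Sigma> X" "elementwise_colimit I r D X c" "\<And>i. i \<in> I \<Longrightarrow> weak_hdts \<Sigma> (omap D i)"
  shows "weak_hdts \<Sigma> X"
  using assms multiset_axiom_elementwise[OF assms(1,2)] coherence_axiom_elementwise[OF assms(1,2)]
  unfolding weak_hdts_def by blast

lemma hdts_elementwise:
  assumes "pre_tsystem \<Sigma> X" "elementwise_colimit I r D X c" "\<And>i. i \<in> I \<Longrightarrow> hdts \<Sigma> (omap D i)"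
  shows "hdts \<Sigma> X"
  using assms multiset_axiom_elementwise[OF assms(1,2)] CSA1_elementwise[OF assms(1,2)]
    CSA2_elementwise[OF assms(1,2)] CSA3_elementwise[OF assms(1,2)]
  unfolding hdts_def by blast

text \<open>The description of a colimit by elements does not depend on the chosen representative.\<close>

lemma elementwise_colimit_iso:
  assumes el: "elementwise_colimit I r D Z e" and h: "h \<in> tmor Z X" and k: "k \<in> tmor X Z"
    and hk: "\<And>x. x \<in> states X \<Longrightarrow> on_states h (on_states k x) = x"
      "\<And>u. u \<in> actions X \<Longrightarrow> on_actions h (on_actions k u) = u"
    and kh: "\<And>x. x \<in> states Z \<Longrightarrow> on_states k (on_states h x) = x"
      "\<And>u. u \<in> actions Z \<Longrightarrow> on_actions k (on_actions h u) = u"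
    and X: "pre_tsystem \<Sigma> X"
    and c: "\<And>i. i \<in> I \<Longrightarrow> c i \<in> tmor (omap D i) X"
      "\<And>i x. i \<in> I \<Longrightarrow> x \<in> S i \<Longrightarrow> on_states (c i) x = on_states h (on_states (e i) x)"
      "\<And>i u. i \<in> I \<Longrightarrow> u \<in> A i \<Longrightarrow> on_actions (c i) u = on_actions h (on_actions (e i) u)"
  shows "elementwise_colimit I r D X c"
proof -
  note el = elementwise_colimitD[OF el]
  have inj: "on_states (e i) x = on_states (e j) y \<longleftrightarrow> on_states (c i) x = on_states (c j) y"
    if "i \<in> I" "x \<in> S i" "j \<in> I" "y \<in> S j" for i x j y
    using c(2) that kh(1) tmorD(1)[OF el(1)] by metis
  have inja: "on_actions (e i) x = on_actions (e j) y \<longleftrightarrow> on_actions (c i) x = on_actions (c j) y"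
    if "i \<in> I" "x \<in> A i" "j \<in> I" "y \<in> A j" for i x j y
    using c(3) that kh(2) tmorD(2)[OF el(1)] by metis
  show ?thesis
    unfolding elementwise_colimit_def
  proof (intro conjI ballI allI impI)
    show "c i \<in> tmor (omap D i) X" if "i \<in> I" for i using c(1)[OF that] .
    show "on_states (c j) (Ds i j x) = on_states (c i) x" if "(i, j) \<in> r" "x \<in> S i" for i j x
      using el(2)[OF that] c(2) r(1)[OF that(1)] tmorD(1)[OF D_tmor[OF that(1)] that(2)] that(2)
          by simp
    show "on_actions (c j) (Da i j x) = on_actions (c i) x" if "(i, j) \<in> r" "x \<in> A i" for i j x
      using el(3)[OF that] c(3) r(1)[OF that(1)] tmorD(2)[OF D_tmor[OF that(1)] that(2)] that(2)
          by simp
    show "\<exists>i\<in>I. \<exists>y\<in>S i. on_states (c i) y = x" if "x \<in> states X" for x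
      using el(4)[OF tmorD(1)[OF k that]] hk(1)[OF that] c(2) by metis
    show "\<exists>i\<in>I. \<exists>y\<in>A i. on_actions (c i) y = x" if "x \<in> actions X" for x
      using el(5)[OF tmorD(2)[OF k that]] hk(2)[OF that] c(3) by metis
    show "\<exists>i\<in>I. \<exists>\<alpha>' us' \<beta>'. (\<alpha>', us', \<beta>') \<in> trans (omap D i) \<and>
        on_states (c i) \<alpha>' = \<alpha> \<and> map (on_actions (c i)) us' = us \<and> on_states (c i) \<beta>' = \<beta>"
      if t: "(\<alpha>, us, \<beta>) \<in> trans X" for \<alpha> us \<beta>
    proof -
      obtain i \<alpha>' us' \<beta>' where i: "i \<in> I" "(\<alpha>', us', \<beta>') \<in> trans (omap D i)"
        "on_states (e i) \<alpha>' = on_states k \<alpha>" "map (on_actions (e i)) us' = map (on_actions k) us"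
        "on_states (e i) \<beta>' = on_states k \<beta>"
        using el(6)[OF tmorD(4)[OF k t]] by blast
      note p = pre_tsystem_trans[OF D_pre[OF i(1)] i(2)] and p' = pre_tsystem_trans[OF X t]
      have "map (on_actions (c i)) us' = map (on_actions h) (map (on_actions (e i)) us')"
        using c(3)[OF i(1)] p(3) by (simp add: subset_iff)
      also have "\<dots> = map (\<lambda>u. on_actions h (on_actions k u)) us" unfolding i(4) by simp
      also have "\<dots> = us" using hk(2) p'(3) by (simp add: subset_iff map_idI)
      finally have m: "map (on_actions (c i)) us' = us" .
      show ?thesis
        by (intro bexI[OF _ i(1)] exI[of _ \<alpha>'] exI[of _ us'] exI[of _ \<beta>'])
          (use m i p p' c(2)[OF i(1)] hk(1) in simp)
    qed
    show "\<exists>j. (i, j) \<in> r \<and> Ds i j x = Ds i j y"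
      if "i \<in> I" "x \<in> S i" "y \<in> S i" "on_states (c i) x = on_states (c i) y" for i x y
      using el(7)[OF that(1-3)] inj[OF that(1,2,1,3)] that(4) by blast
    show "\<exists>j. (i, j) \<in> r \<and> Da i j x = Da i j y"
      if "i \<in> I" "x \<in> A i" "y \<in> A i" "on_actions (c i) x = on_actions (c i) y" for i x y
      using el(8)[OF that(1-3)] inja[OF that(1,2,1,3)] that(4) by blast
  qed
qed

text \<open>The elementwise colimit exists and lies in the class by assumption, so any colimit is
  isomorphic to it.\<close>

lemma elementwise_if_colimit:
  assumes U: "universe TYPE('u)" and I: "small TYPE('u) I"
    and closed: "\<And>Z e. pre_tsystem \<Sigma> Z \<Longrightarrow> elementwise_colimit I r D Z e \<Longrightarrow> Z \<in> \<O>"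
    and X: "is_colimit (poset_cat I r) \<C> D X c"
  shows "elementwise_colimit I r D X c"
proof -
  obtain Z e where Z: "pre_tsystem \<Sigma> Z" and el: "elementwise_colimit I r D Z e"
    by (rule elementwise_colimit_exists[OF U I])
  have ZO: "Z \<in> \<O>" by (rule closed[OF Z el])
  have c: "X \<in> \<O>" "\<And>i. i \<in> I \<Longrightarrow> c i \<in> tmor (omap D i) X"
    using X by (auto simp: is_colimit_def cocone_tsystem_iff[OF D])
  note e = elementwise_colimitD(1)[OF el]
  obtain h k where h: "h \<in> Hom \<C> Z X" and k: "k \<in> Hom \<C> X Z" and kh: "Comp \<C> k h = Id \<C> Z"
    and hk: "Comp \<C> h k = Id \<C> X" and he: "\<And>i. i \<in> Ob (poset_cat I r) \<Longrightarrow> Comp \<C> h (e i) = c i"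
    and "\<And>i. i \<in> Ob (poset_cat I r) \<Longrightarrow> Comp \<C> k (c i) = e i"
    by (rule colimit_unique[OF D colimit_if_elementwise[OF ZO el] X], rule that, blast+)
  have h': "h \<in> tmor Z X" and k': "k \<in> tmor X Z" using h k by (auto simp: Hom_iff)
  have "\<forall>i\<in>I. (\<forall>x\<in>S i. on_states h (on_states (e i) x) = on_states (c i) x) \<and>
     (\<forall>u\<in>A i. on_actions h (on_actions (e i) u) = on_actions (c i) u)"
    using he Comp_eq_iff[OF D_pre e h' c(2)] by auto
  moreover have "(\<forall>x\<in>states Z. on_states k (on_states h x) = x) \<and>
     (\<forall>u\<in>actions Z. on_actions k (on_actions h u) = u)"
    using kh Comp_eq_iff[OF Z h' k' tmap_id_in_tmor[OF Z]] by simp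
  moreover have "(\<forall>x\<in>states X. on_states h (on_states k x) = x) \<and>
     (\<forall>u\<in>actions X. on_actions h (on_actions k u) = u)"
    using hk Comp_eq_iff[OF pre[OF c(1)] k' h' tmap_id_in_tmor[OF pre[OF c(1)]]] by simp
  ultimately show ?thesis
    by (intro elementwise_colimit_iso[OF el h' k' _ _ _ _ pre[OF c(1)] c(2)]) simp_all
qed

end

text \<open>A morphism from a finite system \<open>K\<close> amounts to finitely many states, actions and transitions
  of the target indexed by those of \<open>K\<close>, and an equality of two such morphisms is a finite
  conjunction of equalities.\<close>

lemma (in tsystems) finite_directed_lifting:
  assumes U: "universe TYPE('u)"
    and closed: "\<And>(I :: 'u set) r D Z e. directed_diagram \<Sigma> \<O> I r D \<Longrightarrow> pre_tsystem \<Sigma> Z \<Longrightarrow>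
      elementwise_colimit I r D Z e \<Longrightarrow> Z \<in> \<O>"
    and K: "K \<in> \<O>" "finite (states K)" "finite (actions K)" "finite (trans K)"
  shows "directed_lifting TYPE('u) \<C> K"
  unfolding directed_lifting_def
proof (intro conjI allI impI)
  show "K \<in> Ob \<C>" using K by simp
  fix I :: "'u set" and r D X c
  assume a: "small TYPE('u) I \<and> directed_poset natLeq I r \<and> is_functor (poset_cat I r) \<C> D \<and>
      is_colimit (poset_cat I r) \<C> D X c"
  then interpret dd: directed_diagram \<Sigma> \<O> I r D by unfold_locales auto
  have "elementwise_colimit I r D X c"
    by (rule dd.elementwise_if_colimit[OF U]) (use a closed[OF dd.directed_diagram_axioms] in auto)
  note elX = this and el = elementwise_colimitD[OF this]
  have X: "X \<in> \<O>" using a by (auto simp: is_colimit_def cocone_def)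
  show "\<forall>f\<in>Hom \<C> K X. \<exists>i\<in>I. \<exists>g\<in>Hom \<C> K (omap D i). Comp \<C> (c i) g = f"
  proof
    fix f assume "f \<in> Hom \<C> K X"
    then have f: "f \<in> tmor K X" by (simp add: Hom_iff)
    obtain i gs ga where i: "i \<in> I"
      and gs: "\<And>x. x \<in> states K \<Longrightarrow> gs x \<in> dd.S i \<and> on_states (c i) (gs x) = on_states f x"
      and ga: "\<And>u. u \<in> actions K \<Longrightarrow> ga u \<in> dd.A i \<and> on_actions (c i) (ga u) = on_actions f u"
      and t: "\<And>\<alpha> us \<beta>. (\<alpha>, us, \<beta>) \<in> trans K \<Longrightarrow> (gs \<alpha>, map ga us, gs \<beta>) \<in> trans (omap D i)"
    proof (rule dd.finite_lift[OF elX K(2,3,4), of "on_states f" "on_actions f"])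
      show "\<alpha> \<in> states K \<and> set us \<subseteq> actions K \<and> \<beta> \<in> states K \<and>
        (on_states f \<alpha>, map (on_actions f) us, on_states f \<beta>) \<in> trans X" if "(\<alpha>, us, \<beta>) \<in> trans K"
            for \<alpha> us \<beta>
        using pre_tsystem_trans[OF pre[OF K(1)] that] tmorD(4)[OF f that] by simp
    qed (use tmorD(1,2)[OF f] in auto)
    have "label (omap D i) (ga u) = label K u" if "u \<in> actions K" for u
      using ga[OF that] tmorD(3)[OF el(1)[OF i]] tmorD(3)[OF f that] by metis
    then have g: "tmap K (omap D i) gs ga \<in> tmor K (omap D i)"
      by (intro tmap_in_tmor[OF pre[OF K(1)]]) (use gs ga t in auto)
    moreover have "Comp \<C> (c i) (tmap K (omap D i) gs ga) = f"
      using gs ga by (simp add: Comp_eq_iff[OF pre[OF K(1)] g el(1)[OF i] f])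
    moreover have "tmap K (omap D i) gs ga \<in> Hom \<C> K (omap D i)"
      using g K(1) dd.D_ob[OF i] by (simp add: Hom_iff)
    ultimately show "\<exists>i\<in>I. \<exists>g\<in>Hom \<C> K (omap D i). Comp \<C> (c i) g = f"
      using i by blast
  qed
  show "\<forall>i\<in>I. \<forall>g\<in>Hom \<C> K (omap D i). \<forall>g'\<in>Hom \<C> K (omap D i). Comp \<C> (c i) g = Comp \<C> (c i) g' \<longrightarrow>
      (\<exists>j. (i, j) \<in> r \<and> Comp \<C> (amap D (i, j)) g = Comp \<C> (amap D (i, j)) g')"
  proof (intro ballI impI)
    fix i g g' assume i: "i \<in> I" and "g \<in> Hom \<C> K (omap D i)" "g' \<in> Hom \<C> K (omap D i)"
      and eq: "Comp \<C> (c i) g = Comp \<C> (c i) g'"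
    then have g: "g \<in> tmor K (omap D i)" and g': "g' \<in> tmor K (omap D i)" by (auto simp: Hom_iff)
    note ci = el(1)[OF i]
    have eqs: "on_states (c i) (on_states g x) = on_states (c i) (on_states g' x)"
        if "x \<in> states K" for x
      using eq Comp_tsystem_cat_apply(1)[OF g ci that, of \<O>] Comp_tsystem_cat_apply(1)[OF g' ci
          that, of \<O>] by simp
    have eqa: "on_actions (c i) (on_actions g x) = on_actions (c i) (on_actions g' x)"
        if "x \<in> actions K" for x
      using eq Comp_tsystem_cat_apply(2)[OF g ci that, of \<O>] Comp_tsystem_cat_apply(2)[OF g' ci
          that, of \<O>] by simp
    have "eventually_in I r (\<lambda>k. (i, k) \<in> r \<and> (i, k) \<in> r \<and> dd.Ds i k (on_states g x) =
        dd.Ds i k (on_states g' x))"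
      if x: "x \<in> states K" for x
      by (rule dd.equal_in_colimit_states[OF elX i tmorD(1)[OF g x] i tmorD(1)[OF g' x] eqs[OF x]])
    then have evs: "eventually_in I r (\<lambda>k. \<forall>x\<in>states K. (i, k) \<in> r \<and> (i, k) \<in> r \<and>
        dd.Ds i k (on_states g x) = dd.Ds i k (on_states g' x))"
      by (rule eventually_in_ball[OF dd.dir K(2)])
    have "eventually_in I r (\<lambda>k. (i, k) \<in> r \<and> (i, k) \<in> r \<and> dd.Da i k (on_actions g x) =
        dd.Da i k (on_actions g' x))"
      if x: "x \<in> actions K" for x
      by (rule dd.equal_in_colimit_actions[OF elX i tmorD(2)[OF g x] i tmorD(2)[OF g' x] eqa[OF x]])
    then have eva: "eventually_in I r (\<lambda>k. \<forall>x\<in>actions K. (i, k) \<in> r \<and> (i, k) \<in> r \<and>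
        dd.Da i k (on_actions g x) = dd.Da i k (on_actions g' x))"
      by (rule eventually_in_ball[OF dd.dir K(3)])
    obtain k where k: "(i, k) \<in> r" "\<forall>x\<in>states K. dd.Ds i k (on_states g x) = dd.Ds i k (on_states
        g' x)"
      "\<forall>x\<in>actions K. dd.Da i k (on_actions g x) = dd.Da i k (on_actions g' x)"
      using eventually_in_ex[OF dd.dir eventually_in_conj[OF dd.dir eventually_in_above[OF dd.dir
          i] eventually_in_conj[OF dd.dir evs eva]]] by blast
    note Dk = dd.D_tmor[OF k(1)]
    have "Comp \<C> (amap D (i, k)) g = Comp \<C> (amap D (i, k)) g'"
      using k(2,3) by (subst Comp_eq_iff[OF pre[OF K(1)] g Dk Comp_in_tmor[OF pre[OF K(1)] g' Dk]])
        (simp add: Comp_tsystem_cat_apply[OF g' Dk])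
    then show "\<exists>j. (i, j) \<in> r \<and> Comp \<C> (amap D (i, j)) g = Comp \<C> (amap D (i, j)) g'"
      using k(1) by blast
  qed
qed

section \<open>Initial families and joint images\<close>

text \<open>The transitions of \<open>Z\<close> are as many as the morphisms in \<open>Q\<close> allow. The set \<open>N\<close> of admitted
  lengths is either everything, for joint images, or an initial segment, for finite pieces of a
  system.\<close>

definition initial_along :: "nat set \<Rightarrow> ('u, 'a) tsystem \<Rightarrow> ('u, 'a) tmorphism set \<Rightarrow> bool" where
  "initial_along N Z Q \<longleftrightarrow>
     (\<forall>\<alpha> us \<beta>. (\<alpha>, us, \<beta>) \<in> trans Z \<longleftrightarrow>
        \<alpha> \<in> states Z \<and> \<beta> \<in> states Z \<and> us \<in> lists (actions Z) \<and> us \<noteq> [] \<and> length us \<in> N \<and>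
        (\<forall>\<pi>\<in>Q. (on_states \<pi> \<alpha>, map (on_actions \<pi>) us, on_states \<pi> \<beta>) \<in> trans (target \<pi>)))"

text \<open>Actions with different labels count as separated, so that the condition is meaningful for an
  empty family too.\<close>

definition jointly_monic :: "('u, 'a) tsystem \<Rightarrow> ('u, 'a) tmorphism set \<Rightarrow> bool" where
  "jointly_monic Z Q \<longleftrightarrow>
     (\<forall>x\<in>states Z. \<forall>y\<in>states Z. (\<forall>\<pi>\<in>Q. on_states \<pi> x = on_states \<pi> y) \<longrightarrow> x = y) \<and>
     (\<forall>u\<in>actions Z. \<forall>v\<in>actions Z. label Z u = label Z v \<longrightarrow>
        (\<forall>\<pi>\<in>Q. on_actions \<pi> u = on_actions \<pi> v) \<longrightarrow> u = v)"

lemma initial_alongD: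
  assumes "initial_along N Z Q" "(\<alpha>, us, \<beta>) \<in> trans Z"
  shows "\<alpha> \<in> states Z" "\<beta> \<in> states Z" "set us \<subseteq> actions Z" "us \<noteq> []" "length us \<in> N"
    "\<And>\<pi>. \<pi> \<in> Q \<Longrightarrow> (on_states \<pi> \<alpha>, map (on_actions \<pi>) us, on_states \<pi> \<beta>) \<in> trans (target \<pi>)"
proof -
  have "\<alpha> \<in> states Z \<and> \<beta> \<in> states Z \<and> us \<in> lists (actions Z) \<and> us \<noteq> [] \<and> length us \<in> N \<and>
        (\<forall>\<pi>\<in>Q. (on_states \<pi> \<alpha>, map (on_actions \<pi>) us, on_states \<pi> \<beta>) \<in> trans (target \<pi>))"
    using assms unfolding initial_along_def by blast
  then show "\<alpha> \<in> states Z" "\<beta> \<in> states Z" "set us \<subseteq> actions Z" "us \<noteq> []" "length us \<in> N"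
    "\<And>\<pi>. \<pi> \<in> Q \<Longrightarrow> (on_states \<pi> \<alpha>, map (on_actions \<pi>) us, on_states \<pi> \<beta>) \<in> trans (target \<pi>)"
    by auto
qed

lemma initial_alongI:
  assumes "initial_along N Z Q" "\<alpha> \<in> states Z" "\<beta> \<in> states Z" "set us \<subseteq> actions Z" "us \<noteq> []"
    "length us \<in> N"
    "\<And>\<pi>. \<pi> \<in> Q \<Longrightarrow> (on_states \<pi> \<alpha>, map (on_actions \<pi>) us, on_states \<pi> \<beta>) \<in> trans (target \<pi>)"
  shows "(\<alpha>, us, \<beta>) \<in> trans Z"
proof -
  have "us \<in> lists (actions Z)" using assms(4) by auto
  then show ?thesis using assms unfolding initial_along_def by blast
qed

lemma multiset_axiom_initial:
  assumes Z: "initial_along N Z Q" and Q: "\<And>\<pi>. \<pi> \<in> Q \<Longrightarrow> multiset_axiom (target \<pi>)"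
  shows "multiset_axiom Z"
  unfolding multiset_axiom_def
proof (intro allI impI, elim conjE)
  fix \<alpha> us \<beta> \<sigma>
  assume len: "2 \<le> length us" and s: "\<sigma> permutes {..<length us}" and t: "(\<alpha>, us, \<beta>) \<in> trans Z"
  note d = initial_alongD[OF Z t]
  have ne: "permute_list \<sigma> us \<noteq> []" using len length_permute_list[of \<sigma> us] by force
  show "(\<alpha>, permute_list \<sigma> us, \<beta>) \<in> trans Z"
  proof (rule initial_alongI[OF Z d(1,2)])
    fix \<pi> assume pi: "\<pi> \<in> Q"
    have "(on_states \<pi> \<alpha>, permute_list \<sigma> (map (on_actions \<pi>) us), on_states \<pi> \<beta>) \<in> trans (target \<pi>)"
      using Q[OF pi] d(6)[OF pi] len s unfolding multiset_axiom_def by simp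
    moreover have "permute_list \<sigma> (map (on_actions \<pi>) us) = map (on_actions \<pi>) (permute_list \<sigma> us)"
      by (rule permute_list_map[OF s])
    ultimately show "(on_states \<pi> \<alpha>, map (on_actions \<pi>) (permute_list \<sigma> us), on_states \<pi> \<beta>) \<in>
        trans (target \<pi>)"
      by metis
  qed (use d s ne in simp_all)
qed

lemma coherence_axiom_initial:
  assumes Z: "initial_along N Z Q" and Q: "\<And>\<pi>. \<pi> \<in> Q \<Longrightarrow> coherence_axiom (target \<pi>)"
    and N: "\<And>m n. n \<in> N \<Longrightarrow> m \<le> n \<Longrightarrow> m \<in> N"
  shows "coherence_axiom Z"
  unfolding coherence_axiom_def
proof (intro allI impI, elim conjE)
  fix \<alpha> us \<beta> \<nu>1 \<nu>2 p q
  assume pq: "3 \<le> length us" "1 \<le> p" "1 \<le> q" "p + q < length us" and t: "(\<alpha>, us, \<beta>) \<in> trans Z"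
      "(\<alpha>, take p us, \<nu>1) \<in> trans Z" "(\<nu>1, drop p us, \<beta>) \<in> trans Z"
      "(\<alpha>, take (p + q) us, \<nu>2) \<in> trans Z" "(\<nu>2, drop (p + q) us, \<beta>) \<in> trans Z"
  note d = initial_alongD[OF Z t(1)]
  show "(\<nu>1, take q (drop p us), \<nu>2) \<in> trans Z"
  proof (rule initial_alongI[OF Z])
    show "\<nu>1 \<in> states Z" "\<nu>2 \<in> states Z"
      using initial_alongD(2)[OF Z t(2)] initial_alongD(2)[OF Z t(4)] by auto
    show "set (take q (drop p us)) \<subseteq> actions Z"
      using d(3) by (auto dest!: in_set_takeD in_set_dropD)
    show "take q (drop p us) \<noteq> []" using pq by simp
    show "length (take q (drop p us)) \<in> N" by (rule N[OF d(5)]) simp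
    fix \<pi> assume pi: "\<pi> \<in> Q"
    note m = initial_alongD(6)[OF Z _ pi]
    have "(on_states \<pi> \<nu>1, take q (drop p (map (on_actions \<pi>) us)), on_states \<pi> \<nu>2) \<in> trans
        (target \<pi>)"
      by (rule Q[OF pi, unfolded coherence_axiom_def, rule_format, of "map (on_actions \<pi>) us" p q
            "on_states \<pi> \<alpha>" "on_states \<pi> \<beta>"])
        (use pq t[THEN m] in \<open>simp add: take_map drop_map\<close>)
    then show "(on_states \<pi> \<nu>1, map (on_actions \<pi>) (take q (drop p us)), on_states \<pi> \<nu>2) \<in> trans
        (target \<pi>)"
      by (simp add: take_map drop_map)
  qed
qed

lemma weak_hdts_initial:
  assumes "pre_tsystem \<Sigma> Z" "initial_along N Z Q" "\<And>\<pi>. \<pi> \<in> Q \<Longrightarrow> weak_hdts \<Sigma> (target \<pi>)"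
    and "\<And>m n. n \<in> N \<Longrightarrow> m \<le> n \<Longrightarrow> m \<in> N"
  shows "weak_hdts \<Sigma> Z"
proof -
  have Q: "multiset_axiom (target \<pi>)" "coherence_axiom (target \<pi>)" if "\<pi> \<in> Q" for \<pi>
    using assms(3)[OF that] by (auto simp: weak_hdts_def)
  have "multiset_axiom Z" by (rule multiset_axiom_initial[OF assms(2) Q(1)])
  moreover have "coherence_axiom Z"
    by (rule coherence_axiom_initial[OF assms(2) Q(2)]) (use assms(4) in auto)
  ultimately show ?thesis using assms(1) by (simp add: weak_hdts_def)
qed

text \<open>The form of the multiset axiom in which the second half of \<open>CSA2\<close> follows from the first:
  rotate the list of actions.\<close>

lemma multiset_axiom_mset:
  assumes "multiset_axiom X" "(\<alpha>, us, \<beta>) \<in> trans X" "2 \<le> length us" "mset vs = mset us"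
  shows "(\<alpha>, vs, \<beta>) \<in> trans X"
proof -
  obtain \<sigma> where "\<sigma> permutes {..<length us}" "permute_list \<sigma> us = vs"
    using mset_eq_permutation[OF assms(4)] by blast
  then show ?thesis using assms unfolding multiset_axiom_def by blast
qed

lemma CSA1_initial:
  assumes X: "pre_tsystem \<Sigma> Z" and Z: "initial_along N Z Q" and mono: "jointly_monic Z Q"
    and Q: "\<And>\<pi>. \<pi> \<in> Q \<Longrightarrow> \<pi> \<in> tmor Z (target \<pi>) \<and> CSA1 (target \<pi>)"
  shows "CSA1 Z"
  unfolding CSA1_def
proof (intro allI impI, elim conjE)
  fix \<alpha> \<beta> u u' assume t: "(\<alpha>, [u], \<beta>) \<in> trans Z" "(\<alpha>, [u'], \<beta>) \<in> trans Z" and l: "label Z u =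
      label Z u'"
  have u: "u \<in> actions Z" "u' \<in> actions Z" using t[THEN initial_alongD(3)[OF Z]] by auto
  have "on_actions \<pi> u = on_actions \<pi> u'" if pi: "\<pi> \<in> Q" for \<pi>
  proof -
    have p: "\<pi> \<in> tmor Z (target \<pi>)" and C: "CSA1 (target \<pi>)" using Q[OF pi] by auto
    have "label (target \<pi>) (on_actions \<pi> u) = label (target \<pi>) (on_actions \<pi> u')"
      using tmorD(3)[OF p u(1)] tmorD(3)[OF p u(2)] l by simp
    then show ?thesis
      using C[unfolded CSA1_def] t[THEN initial_alongD(6)[OF Z _ pi]] by auto
  qed
  then show "u = u'" using mono u l unfolding jointly_monic_def by blast
qed

lemma CSA3_initial:
  assumes Z: "initial_along N Z Q" and mono: "jointly_monic Z Q"
    and Q: "\<And>\<pi>. \<pi> \<in> Q \<Longrightarrow> CSA3 (target \<pi>)"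
  shows "CSA3 Z"
  unfolding CSA3_def
proof (intro allI impI, elim conjE)
  fix \<alpha> us \<beta> \<nu>1 \<nu>2 \<nu>1' \<nu>2' p q
  assume pq: "1 \<le> p" "1 \<le> q" "p + q < length us" and t: "(\<alpha>, us, \<beta>) \<in> trans Z"
      "(\<alpha>, take p us, \<nu>1) \<in> trans Z" "(\<nu>1, drop p us, \<beta>) \<in> trans Z"
      "(\<nu>1, take q (drop p us), \<nu>2) \<in> trans Z" "(\<nu>2, drop (p + q) us, \<beta>) \<in> trans Z"
      "(\<alpha>, take (p + q) us, \<nu>2') \<in> trans Z" "(\<nu>2', drop (p + q) us, \<beta>) \<in> trans Z"
      "(\<alpha>, take p us, \<nu>1') \<in> trans Z" "(\<nu>1', take q (drop p us), \<nu>2') \<in> trans Z"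
  have "on_states \<pi> \<nu>1 = on_states \<pi> \<nu>1' \<and> on_states \<pi> \<nu>2 = on_states \<pi> \<nu>2'" if pi: "\<pi> \<in> Q" for \<pi>
    by (rule Q[OF pi, unfolded CSA3_def, rule_format, of p q "map (on_actions \<pi>) us"
          "on_states \<pi> \<alpha>" "on_states \<pi> \<beta>"])
      (use pq t[THEN initial_alongD(6)[OF Z _ pi]] in \<open>simp add: take_map drop_map\<close>)
  moreover have "\<nu>1 \<in> states Z" "\<nu>1' \<in> states Z" "\<nu>2 \<in> states Z" "\<nu>2' \<in> states Z"
    using t[THEN initial_alongD(2)[OF Z]] by auto
  ultimately show "\<nu>1 = \<nu>1' \<and> \<nu>2 = \<nu>2'" using mono unfolding jointly_monic_def by blast
qed

text \<open>Uniqueness is tested under each morphism of the family. Existence is a hypothesis: the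
  intermediate states in the targets have to be the images of one state of \<open>Z\<close>.\<close>

lemma CSA2_initial:
  assumes Z: "initial_along UNIV Z Q" and mono: "jointly_monic Z Q"
    and Q: "\<And>\<pi>. \<pi> \<in> Q \<Longrightarrow> \<pi> \<in> tmor Z (target \<pi>) \<and> CSA2 (target \<pi>)" and ms: "multiset_axiom Z"
    and split: "\<And>\<alpha> us \<beta> p. (\<alpha>, us, \<beta>) \<in> trans Z \<Longrightarrow> 1 \<le> p \<Longrightarrow> p < length us \<Longrightarrow>
      \<exists>\<nu>\<in>states Z. \<forall>\<pi>\<in>Q. (on_states \<pi> \<alpha>, map (on_actions \<pi>) (take p us), on_states \<pi> \<nu>) \<in> trans
          (target \<pi>) \<and>
        (on_states \<pi> \<nu>, map (on_actions \<pi>) (drop p us), on_states \<pi> \<beta>) \<in> trans (target \<pi>)"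
  shows "CSA2 Z"
proof -
  have main: "\<exists>!\<nu>. \<nu> \<in> states Z \<and> (\<alpha>, take p us, \<nu>) \<in> trans Z \<and> (\<nu>, drop p us, \<beta>) \<in> trans Z"
    if t: "(\<alpha>, us, \<beta>) \<in> trans Z" and p: "1 \<le> p" "p < length us" for \<alpha> us \<beta> p
  proof -
    note d = initial_alongD[OF Z t]
    obtain \<nu> where n: "\<nu> \<in> states Z"
      "\<And>\<pi>. \<pi> \<in> Q \<Longrightarrow> (on_states \<pi> \<alpha>, map (on_actions \<pi>) (take p us), on_states \<pi> \<nu>) \<in> trans (target
          \<pi>)"
      "\<And>\<pi>. \<pi> \<in> Q \<Longrightarrow> (on_states \<pi> \<nu>, map (on_actions \<pi>) (drop p us), on_states \<pi> \<beta>) \<in> trans (target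
          \<pi>)"
      using split[OF t p] by blast
    have "set (take p us) \<subseteq> actions Z" "set (drop p us) \<subseteq> actions Z"
      using d(3) set_take_subset[of p us] set_drop_subset[of p us] by auto
    then have "(\<alpha>, take p us, \<nu>) \<in> trans Z" "(\<nu>, drop p us, \<beta>) \<in> trans Z"
      using p d(1,2) n by (auto intro!: initial_alongI[OF Z])
    moreover have "\<nu> = \<nu>'" if nn: "(\<alpha>, take p us, \<nu>) \<in> trans Z" "(\<nu>, drop p us, \<beta>) \<in> trans Z"
      "(\<alpha>, take p us, \<nu>') \<in> trans Z" "(\<nu>', drop p us, \<beta>) \<in> trans Z" for \<nu> \<nu>'
    proof -
      have nZ: "\<nu> \<in> states Z" "\<nu>' \<in> states Z" using nn[THEN initial_alongD(1)[OF Z]] by auto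
      have "on_states \<pi> \<nu> = on_states \<pi> \<nu>'" if pi: "\<pi> \<in> Q" for \<pi>
      proof -
        have pt: "\<pi> \<in> tmor Z (target \<pi>)" and C: "CSA2 (target \<pi>)" using Q[OF pi] by auto
        have ex1: "\<exists>!\<mu>. \<mu> \<in> states (target \<pi>) \<and> (on_states \<pi> \<alpha>, take p (map (on_actions \<pi>) us),
            \<mu>) \<in> trans (target \<pi>) \<and>
            (\<mu>, drop p (map (on_actions \<pi>) us), on_states \<pi> \<beta>) \<in> trans (target \<pi>)"
          using C[unfolded CSA2_def, rule_format, of "map (on_actions \<pi>) us" p "on_states \<pi> \<alpha>"
              "on_states \<pi> \<beta>"]
            p d(6)[OF pi] by simp
        show ?thesis
          using ex1 nn[THEN initial_alongD(6)[OF Z _ pi]] tmorD(1)[OF pt nZ(1)] tmorD(1)[OF pt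
              nZ(2)]
          unfolding take_map drop_map by blast
      qed
      then show ?thesis using mono nZ unfolding jointly_monic_def by blast
    qed
    ultimately show ?thesis using n(1) by blast
  qed
  show ?thesis
    unfolding CSA2_def
  proof (intro allI impI, elim conjE)
    fix \<alpha> us \<beta> p assume p: "2 \<le> length us" "1 \<le> p" "p < length us" and t: "(\<alpha>, us, \<beta>) \<in> trans Z"
    have "mset (drop p us @ take p us) = mset us"
      by (metis append_take_drop_id mset_append union_commute)
    then have t': "(\<alpha>, drop p us @ take p us, \<beta>) \<in> trans Z"
      by (rule multiset_axiom_mset[OF ms t p(1)])
    have "1 \<le> length (drop p us)" "length (drop p us) < length (drop p us @ take p us)" using p
        by auto
    from main[OF t p(2,3)] main[OF t' this]
    show "(\<exists>!\<nu>1. \<nu>1 \<in> states Z \<and> (\<alpha>, take p us, \<nu>1) \<in> trans Z \<and> (\<nu>1, drop p us, \<beta>) \<in> trans Z) \<and>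
        (\<exists>!\<nu>2. \<nu>2 \<in> states Z \<and> (\<alpha>, drop p us, \<nu>2) \<in> trans Z \<and> (\<nu>2, take p us, \<beta>) \<in> trans Z)"
      by simp
  qed
qed

text \<open>The index set \<open>P\<close> may have any size, because only the sets \<open>V\<close> and \<open>M\<close> of names enter the
  size of the result.\<close>

lemma joint_image:
  fixes V :: "'t set" and M :: "'m set" and P :: "'p set" and tg :: "'p \<Rightarrow> ('u, 'a) tsystem"
  assumes V: "small TYPE('u) V" and M: "small TYPE('u) M"
    and lab: "\<And>m. m \<in> M \<Longrightarrow> lab m \<in> \<Sigma>"
    and ev: "\<And>p t. p \<in> P \<Longrightarrow> t \<in> V \<Longrightarrow> ev p t \<in> states (tg p)"
    and act: "\<And>p m. p \<in> P \<Longrightarrow> m \<in> M \<Longrightarrow> act p m \<in> actions (tg p)"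
    and lab_act: "\<And>p m. p \<in> P \<Longrightarrow> m \<in> M \<Longrightarrow> label (tg p) (act p m) = lab m"
  obtains Z :: "('u, 'a) tsystem" and qs qa \<pi> where
    "pre_tsystem \<Sigma> Z" "states Z = qs ` V" "actions Z = qa ` M"
    "\<And>m. m \<in> M \<Longrightarrow> label Z (qa m) = lab m"
    "\<And>p. p \<in> P \<Longrightarrow> \<pi> p \<in> tmor Z (tg p)"
    "\<And>p t. p \<in> P \<Longrightarrow> t \<in> V \<Longrightarrow> on_states (\<pi> p) (qs t) = ev p t"
    "\<And>p m. p \<in> P \<Longrightarrow> m \<in> M \<Longrightarrow> on_actions (\<pi> p) (qa m) = act p m"
    "initial_along UNIV Z (\<pi> ` P)" "jointly_monic Z (\<pi> ` P)"
proof -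
  obtain qs :: "'t \<Rightarrow> 'u" where qs: "\<And>s t. s \<in> V \<Longrightarrow> t \<in> V \<Longrightarrow> qs s = qs t \<longleftrightarrow> (\<forall>p\<in>P. ev p s = ev p t)"
    by (rule small_quotient_encode[OF V, of "\<lambda>s t. \<forall>p\<in>P. ev p s = ev p t"]) (simp, simp, simp,
        blast)
  obtain qa :: "'m \<Rightarrow> 'u" where
    qa: "\<And>s t. s \<in> M \<Longrightarrow> t \<in> M \<Longrightarrow> qa s = qa t \<longleftrightarrow> lab s = lab t \<and> (\<forall>p\<in>P. act p s = act p t)"
    by (rule small_quotient_encode[OF M, of "\<lambda>s t. lab s = lab t \<and> (\<forall>p\<in>P. act p s = act p t)"])
      (simp, simp, simp, blast)
  have "\<forall>p\<in>P. \<exists>h. \<forall>t\<in>V. h (qs t) = ev p t"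
  proof
    fix p assume "p \<in> P"
    then show "\<exists>h. \<forall>t\<in>V. h (qs t) = ev p t"
      using factor_through_image[of V qs "ev p"] qs by blast
  qed
  then obtain hs where hs: "\<And>p t. p \<in> P \<Longrightarrow> t \<in> V \<Longrightarrow> hs p (qs t) = ev p t" by metis
  have "\<forall>p\<in>P. \<exists>h. \<forall>m\<in>M. h (qa m) = act p m"
  proof
    fix p assume "p \<in> P"
    then show "\<exists>h. \<forall>m\<in>M. h (qa m) = act p m"
      using factor_through_image[of M qa "act p"] qa by blast
  qed
  then obtain ha where ha: "\<And>p m. p \<in> P \<Longrightarrow> m \<in> M \<Longrightarrow> ha p (qa m) = act p m" by metis
  have "lab s = lab t" if "s \<in> M" "t \<in> M" "qa s = qa t" for s t using qa[OF that(1,2)] that(3)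
      by blast
  from factor_through_image[of M qa lab, OF this]
  obtain l where l: "l \<in> extensional (qa ` M)" "\<And>m. m \<in> M \<Longrightarrow> l (qa m) = lab m" by blast
  define Z where "Z = \<lparr>states = qs ` V, actions = qa ` M, label = l,
    trans = {(\<alpha>, us, \<beta>). \<alpha> \<in> qs ` V \<and> \<beta> \<in> qs ` V \<and> us \<in> lists (qa ` M) \<and> us \<noteq> [] \<and>
      (\<forall>p\<in>P. (hs p \<alpha>, map (ha p) us, hs p \<beta>) \<in> trans (tg p))}\<rparr>"
  have Z: "states Z = qs ` V" "actions Z = qa ` M" "label Z = l"
    "\<And>\<alpha> us \<beta>. (\<alpha>, us, \<beta>) \<in> trans Z \<longleftrightarrow> \<alpha> \<in> qs ` V \<and> \<beta> \<in> qs ` V \<and> us \<in> lists (qa ` M) \<and> us \<noteq> [] \<and>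
      (\<forall>p\<in>P. (hs p \<alpha>, map (ha p) us, hs p \<beta>) \<in> trans (tg p))"
    by (auto simp: Z_def)
  have pZ: "pre_tsystem \<Sigma> Z"
    unfolding pre_tsystem_def
  proof (intro conjI)
    show "small TYPE('u) (states Z)" "small TYPE('u) (actions Z)"
      using small_image[OF V] small_image[OF M] by (simp_all add: Z)
    show "label Z \<in> actions Z \<rightarrow>\<^sub>E \<Sigma>" using l lab unfolding Z PiE_def by auto
    show "trans Z \<subseteq> {(\<alpha>, us, \<beta>). \<alpha> \<in> states Z \<and> us \<in> lists (actions Z) \<and> us \<noteq> [] \<and> \<beta> \<in> states Z}"
      using Z by auto
  qed
  define \<pi> where "\<pi> p = tmap Z (tg p) (hs p) (ha p)" for p
  have maps: "map (on_actions (\<pi> p)) us = map (ha p) us" if "us \<in> lists (actions Z)" for p us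
    using that by (auto simp: \<pi>_def)
  have pi: "\<pi> p \<in> tmor Z (tg p)" if p: "p \<in> P" for p
    unfolding \<pi>_def
    by (rule tmap_in_tmor[OF pZ]) (use p hs ha ev act lab_act l Z in auto)
  have st: "on_states (\<pi> p) x = hs p x" if "x \<in> states Z" for p x using that by (simp add: \<pi>_def)
  have ac: "on_actions (\<pi> p) x = ha p x" if "x \<in> actions Z" for p x using that by (simp add: \<pi>_def)
  have tgt: "target (\<pi> p) = tg p" for p by (simp add: \<pi>_def)
  have init: "initial_along UNIV Z (\<pi> ` P)"
    unfolding initial_along_def
  proof (intro allI)
    fix \<alpha> us \<beta>
    show "(\<alpha>, us, \<beta>) \<in> trans Z \<longleftrightarrow>
        \<alpha> \<in> states Z \<and> \<beta> \<in> states Z \<and> us \<in> lists (actions Z) \<and> us \<noteq> [] \<and> length us \<in> UNIV \<and>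
        (\<forall>\<pi>\<in>\<pi> ` P. (on_states \<pi> \<alpha>, map (on_actions \<pi>) us, on_states \<pi> \<beta>) \<in> trans (target \<pi>))"
    proof (cases "\<alpha> \<in> states Z \<and> \<beta> \<in> states Z \<and> us \<in> lists (actions Z)")
      case True
      then have in_Z: "\<alpha> \<in> states Z" "\<beta> \<in> states Z" "us \<in> lists (actions Z)" by auto
      have eq: "(on_states (\<pi> p) \<alpha>, map (on_actions (\<pi> p)) us, on_states (\<pi> p) \<beta>) =
          (hs p \<alpha>, map (ha p) us, hs p \<beta>)" for p
        by (simp only: st[OF in_Z(1)] st[OF in_Z(2)] maps[OF in_Z(3)])
      have "(\<forall>\<rho>\<in>\<pi> ` P. (on_states \<rho> \<alpha>, map (on_actions \<rho>) us, on_states \<rho> \<beta>) \<in> trans (target \<rho>)) \<longleftrightarrow>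
          (\<forall>p\<in>P. (on_states (\<pi> p) \<alpha>, map (on_actions (\<pi> p)) us, on_states (\<pi> p) \<beta>) \<in> trans (target
              (\<pi> p)))"
        by blast
      also have "\<dots> \<longleftrightarrow> (\<forall>p\<in>P. (hs p \<alpha>, map (ha p) us, hs p \<beta>) \<in> trans (tg p))"
        unfolding eq tgt ..
      finally show ?thesis using True unfolding Z(4) Z(1,2)[symmetric] by blast
    next
      case False
      then show ?thesis unfolding Z(4) Z(1,2)[symmetric] by blast
    qed
  qed
  have mono: "jointly_monic Z (\<pi> ` P)"
    unfolding jointly_monic_def
  proof (intro conjI ballI impI)
    fix x y assume xy: "x \<in> states Z" "y \<in> states Z" "\<forall>\<pi>\<in>\<pi> ` P. on_states \<pi> x = on_states \<pi> y"
    then obtain s t where st': "s \<in> V" "t \<in> V" "x = qs s" "y = qs t" unfolding Z by blast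
    have "ev p s = ev p t" if "p \<in> P" for p
      using xy(3) that st xy(1,2) hs[OF that] st' by fastforce
    then show "x = y" using qs[OF st'(1,2)] st' by simp
  next
    fix x y assume xy: "x \<in> actions Z" "y \<in> actions Z" "label Z x = label Z y"
      "\<forall>\<pi>\<in>\<pi> ` P. on_actions \<pi> x = on_actions \<pi> y"
    then obtain s t where st': "s \<in> M" "t \<in> M" "x = qa s" "y = qa t" unfolding Z by blast
    have "act p s = act p t" if "p \<in> P" for p
      using xy(4) that ac xy(1,2) ha[OF that] st' by fastforce
    moreover have "lab s = lab t" using xy(3) l(2) st' unfolding Z by simp
    ultimately show "x = y" using qa[OF st'(1,2)] st' by simp
  qed
  show ?thesis
  proof (rule that[OF pZ Z(1,2) _ pi _ _ init mono])
    show "label Z (qa m) = lab m" if "m \<in> M" for m using l(2)[OF that] Z(3) by simp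
    show "on_states (\<pi> p) (qs t) = ev p t" if "p \<in> P" "t \<in> V" for p t
      using st hs[OF that] that Z(1) by simp
    show "on_actions (\<pi> p) (qa m) = act p m" if "p \<in> P" "m \<in> M" for p m
      using ac ha[OF that] that Z(2) by simp
  qed
qed

section \<open>Colimits of weak systems\<close>

text \<open>The colimit of a diagram is the joint image of all cocones under it, the names being the
  states and actions of all the systems of the diagram.\<close>

lemma (in tsystems) cocomplete_if_initial_closed:
  assumes U: "universe TYPE('u)"
    and closed: "\<And>Z Q. pre_tsystem \<Sigma> Z \<Longrightarrow> initial_along UNIV Z Q \<Longrightarrow> (\<And>\<pi>. \<pi> \<in> Q \<Longrightarrow> target \<pi> \<in> \<O>) \<Longrightarrow>
        Z \<in> \<O>"
  shows "cocomplete TYPE('u) \<C>"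
  unfolding cocomplete_def
proof (intro allI impI)
  fix J :: "('u, 'u) cat" and D
  assume a: "small_category J \<and> is_functor J \<C> D"
  then have D: "is_functor J \<C> D" by simp
  interpret J: category J using is_functorD(1)[OF D] .
  have Dob: "omap D j \<in> \<O>" if "j \<in> Ob J" for j using is_functorD(3)[OF D that] by simp
  note Dpre = pre[OF Dob]
  have Dmor: "amap D a \<in> tmor (omap D (Dom J a)) (omap D (Cod J a))" if "a \<in> Ar J" for a
    using is_functorD(4)[OF D arrow_in_Hom[OF that]] by (simp add: Hom_iff)
  let ?P = "{(Y, d). cocone J \<C> D Y d}"
  let ?V = "SIGMA j:Ob J. states (omap D j)" and ?M = "SIGMA j:Ob J. actions (omap D j)"
  have J: "small TYPE('u) (Ob J)" using a by (simp add: small_category_def)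
  have sV: "small TYPE('u) ?V" "small TYPE('u) ?M"
    using Dpre by (auto intro!: small_Sigma[OF U J] simp: pre_tsystem_def)
  note coc = cocone_tsystem_iff[OF D]
  have d: "d j \<in> tmor (omap D j) Y" if "cocone J \<C> D Y d" "j \<in> Ob J" for Y d j
    using that coc by simp
  obtain Z :: "('u, 'a) tsystem" and qs qa \<pi> where Z: "pre_tsystem \<Sigma> Z" "states Z = qs ` ?V"
      "actions Z = qa ` ?M"
    and l: "\<And>m. m \<in> ?M \<Longrightarrow> label Z (qa m) = label (omap D (fst m)) (snd m)"
    and pi: "\<And>p. p \<in> ?P \<Longrightarrow> \<pi> p \<in> tmor Z (fst p)"
    and ev: "\<And>p t. p \<in> ?P \<Longrightarrow> t \<in> ?V \<Longrightarrow> on_states (\<pi> p) (qs t) = on_states (snd p (fst t)) (snd t)"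
    and act: "\<And>p m. p \<in> ?P \<Longrightarrow> m \<in> ?M \<Longrightarrow> on_actions (\<pi> p) (qa m) = on_actions (snd p (fst m)) (snd m)"
    and init: "initial_along UNIV Z (\<pi> ` ?P)" and mono: "jointly_monic Z (\<pi> ` ?P)"
  proof (rule joint_image[OF sV, where P = ?P and tg = fst and \<Sigma> = \<Sigma> and
        ev = "\<lambda>p t. on_states (snd p (fst t)) (snd t)" and act = "\<lambda>p m. on_actions (snd p (fst m))
            (snd m)" and
        lab = "\<lambda>m. label (omap D (fst m)) (snd m)"])
    show "label (omap D (fst m)) (snd m) \<in> \<Sigma>" if "m \<in> ?M" for m
      using that pre_tsystem_label[OF Dpre] by auto
    show "on_states (snd p (fst t)) (snd t) \<in> states (fst p)" if "p \<in> ?P" "t \<in> ?V" for p t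
      using that tmorD(1)[OF d] by (cases p; cases t) auto
    show "on_actions (snd p (fst t)) (snd t) \<in> actions (fst p)" if "p \<in> ?P" "t \<in> ?M" for p t
      using that tmorD(2)[OF d] by (cases p; cases t) auto
    show "label (fst p) (on_actions (snd p (fst t)) (snd t)) = label (omap D (fst t)) (snd t)"
      if "p \<in> ?P" "t \<in> ?M" for p t
      using that tmorD(3)[OF d] by (cases p; cases t) auto
  qed blast
  have tgt: "target (\<pi> p) = fst p" if "p \<in> ?P" for p using tmorD(6)[OF pi[OF that]] .
  have ZO: "Z \<in> \<O>"
    by (rule closed[OF Z(1) init]) (use tgt coc in auto)
  define c where "c j = tmap (omap D j) Z (\<lambda>s. qs (j, s)) (\<lambda>u. qa (j, u))" for j
  have c: "c j \<in> tmor (omap D j) Z" if j: "j \<in> Ob J" for j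
    unfolding c_def
  proof (rule tmap_in_tmor[OF Dpre[OF j]])
    fix \<alpha> us \<beta> assume t: "(\<alpha>, us, \<beta>) \<in> trans (omap D j)"
    note p = pre_tsystem_trans[OF Dpre[OF j] t]
    have M: "(j, u) \<in> ?M" if "u \<in> set us" for u using p(3) that j by auto
    show "(qs (j, \<alpha>), map (\<lambda>u. qa (j, u)) us, qs (j, \<beta>)) \<in> trans Z"
    proof (rule initial_alongI[OF init])
      show "qs (j, \<alpha>) \<in> states Z" "qs (j, \<beta>) \<in> states Z" using p j Z by auto
      show "set (map (\<lambda>u. qa (j, u)) us) \<subseteq> actions Z" using M unfolding Z by auto
      fix \<rho> assume "\<rho> \<in> \<pi> ` ?P"
      then obtain Y d where Yd: "cocone J \<C> D Y d" "\<rho> = \<pi> (Y, d)" by auto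
      then have P: "(Y, d) \<in> ?P" by simp
      have m: "map (on_actions \<rho>) (map (\<lambda>u. qa (j, u)) us) = map (on_actions (d j)) us"
        using act[OF P M] Yd(2) by simp
      show "(on_states \<rho> (qs (j, \<alpha>)), map (on_actions \<rho>) (map (\<lambda>u. qa (j, u)) us), on_states \<rho> (qs
          (j, \<beta>)))
          \<in> trans (target \<rho>)"
        unfolding m using tmorD(4)[OF d[OF Yd(1) j] t] ev[OF P] j p Yd(2) tgt[OF P] by simp
    qed (use p in auto)
  qed (use j Z l in auto)
  have cap: "on_states (c j) s = qs (j, s)" if "s \<in> states (omap D j)" for j s using that
      by (simp add: c_def)
  have capa: "on_actions (c j) u = qa (j, u)" if "u \<in> actions (omap D j)" for j u using that
      by (simp add: c_def)
  have "is_colimit J \<C> D Z c"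
    unfolding is_colimit_def
  proof (intro conjI allI impI)
    show "cocone J \<C> D Z c"
      unfolding coc
    proof (intro conjI ballI)
      fix a assume aJ: "a \<in> Ar J"
      have j: "Dom J a \<in> Ob J" "Cod J a \<in> Ob J" using J.dom_ob J.cod_ob aJ by auto
      { fix x assume x: "x \<in> states (omap D (Dom J a))"
        have y: "on_states (amap D a) x \<in> states (omap D (Cod J a))"
            using tmorD(1)[OF Dmor[OF aJ] x] .
        have "qs (Cod J a, on_states (amap D a) x) = qs (Dom J a, x)"
        proof (rule mono[unfolded jointly_monic_def, THEN conjunct1, rule_format])
          fix \<rho> assume "\<rho> \<in> \<pi> ` ?P"
          then obtain Y d where Yd: "cocone J \<C> D Y d" "\<rho> = \<pi> (Y, d)" by auto
          then have P: "(Y, d) \<in> ?P" by simp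
          show "on_states \<rho> (qs (Cod J a, on_states (amap D a) x)) = on_states \<rho> (qs (Dom J a, x))"
            using ev[OF P] j x y Yd(1) aJ unfolding Yd(2) coc by simp
        qed (use j x y Z in auto)
        then show "on_states (c (Cod J a)) (on_states (amap D a) x) = on_states (c (Dom J a)) x"
          using cap x y by simp }
      { fix x assume x: "x \<in> actions (omap D (Dom J a))"
        have y: "on_actions (amap D a) x \<in> actions (omap D (Cod J a))"
            using tmorD(2)[OF Dmor[OF aJ] x] .
        have "qa (Cod J a, on_actions (amap D a) x) = qa (Dom J a, x)"
        proof (rule mono[unfolded jointly_monic_def, THEN conjunct2, rule_format])
          show "label Z (qa (Cod J a, on_actions (amap D a) x)) = label Z (qa (Dom J a, x))"
            using l j x y tmorD(3)[OF Dmor[OF aJ] x] by simp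
          fix \<rho> assume "\<rho> \<in> \<pi> ` ?P"
          then obtain Y d where Yd: "cocone J \<C> D Y d" "\<rho> = \<pi> (Y, d)" by auto
          then have P: "(Y, d) \<in> ?P" by simp
          show "on_actions \<rho> (qa (Cod J a, on_actions (amap D a) x)) = on_actions \<rho> (qa (Dom J a,
              x))"
            using act[OF P] j x y Yd(1) aJ unfolding Yd(2) coc by simp
        qed (use j x y Z in auto)
        then show "on_actions (c (Cod J a)) (on_actions (amap D a) x) = on_actions (c (Dom J a)) x"
          using capa x y by simp }
    qed (use ZO c in auto)
    fix Y d assume Yd: "cocone J \<C> D Y d"
    then have P: "(Y, d) \<in> ?P" and Y: "Y \<in> \<O>" using coc by auto
    have h: "\<pi> (Y, d) \<in> tmor Z Y" using pi[OF P] by simp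
    have comp_iff: "Comp \<C> k (c j) = d j \<longleftrightarrow> (\<forall>x\<in>states (omap D j). on_states k (qs (j, x)) =
        on_states (d j) x) \<and>
      (\<forall>u\<in>actions (omap D j). on_actions k (qa (j, u)) = on_actions (d j) u)" if "j \<in> Ob J" "k \<in>
          tmor Z Y" for j k
      using Comp_eq_iff[OF Dpre[OF that(1)] c[OF that(1)] that(2) d[OF Yd that(1)]] cap capa by simp
    show "\<exists>!h. h \<in> Hom \<C> Z Y \<and> (\<forall>j\<in>Ob J. Comp \<C> h (c j) = d j)"
    proof (rule ex1I[of _ "\<pi> (Y, d)"])
      show "\<pi> (Y, d) \<in> Hom \<C> Z Y \<and> (\<forall>j\<in>Ob J. Comp \<C> (\<pi> (Y, d)) (c j) = d j)"
        using h ZO Y ev[OF P] act[OF P] by (simp add: Hom_iff comp_iff)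
      fix k assume k: "k \<in> Hom \<C> Z Y \<and> (\<forall>j\<in>Ob J. Comp \<C> k (c j) = d j)"
      then have kt: "k \<in> tmor Z Y" by (simp add: Hom_iff)
      show "k = \<pi> (Y, d)"
      proof (rule tmor_eqI[OF kt h])
        fix x assume "x \<in> states Z"
        then obtain j s where "j \<in> Ob J" "s \<in> states (omap D j)" "x = qs (j, s)" unfolding Z by auto
        then show "on_states k x = on_states (\<pi> (Y, d)) x"
          using k comp_iff[OF _ kt] ev[OF P] by simp
      next
        fix x assume "x \<in> actions Z"
        then obtain j s where "j \<in> Ob J" "s \<in> actions (omap D j)" "x = qa (j, s)" unfolding Z
            by auto
        then show "on_actions k x = on_actions (\<pi> (Y, d)) x"
          using k comp_iff[OF _ kt] act[OF P] by simp
      qed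
    qed
  qed
  then show "\<exists>X c. is_colimit J \<C> D X c" by blast
qed

section \<open>The free higher dimensional transition system\<close>

text \<open>Names for the states of the free higher dimensional transition system: the given states, and
  formal intermediate states \<open>Mid a us p b\<close>, which stand for the state after the first \<open>p\<close> actions
  of a transition \<open>(a, us, b)\<close>.\<close>

datatype 'u split_term = Gen 'u | Mid "'u split_term" "'u list" nat "'u split_term"

primrec split_value :: "('u, 'a) tmorphism \<Rightarrow> 'u split_term \<Rightarrow> 'u" where
  "split_value f (Gen s) = on_states f s"
| "split_value f (Mid a us p b) = (THE \<nu>. \<nu> \<in> states (target f) \<and>
     (split_value f a, map (on_actions f) (take p us), \<nu>) \<in> trans (target f) \<and>
     (\<nu>, map (on_actions f) (drop p us), split_value f b) \<in> trans (target f))"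

text \<open>An intermediate state is adjoined to \<open>(a, us, b)\<close> as soon as this is a transition under
  every morphism in \<open>P\<close>; it is then a transition of the joint image and has to be split there.\<close>

inductive_set split_terms :: "('u, 'a) tsystem \<Rightarrow> ('u, 'a) tmorphism set \<Rightarrow> 'u split_term set"
  for X P where
  Gen: "s \<in> states X \<Longrightarrow> Gen s \<in> split_terms X P"
| Mid: "a \<in> split_terms X P \<Longrightarrow> b \<in> split_terms X P \<Longrightarrow> set us \<subseteq> actions X \<Longrightarrow> 1 \<le> p \<Longrightarrow> p < length us \<Longrightarrow>
     (\<And>f. f \<in> P \<Longrightarrow> (split_value f a, map (on_actions f) us, split_value f b) \<in> trans (target f)) \<Longrightarrow>
     Mid a us p b \<in> split_terms X P"

text \<open>The definite description is justified by \<open>CSA2\<close> in the target.\<close>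

lemma split_value_Mid:
  assumes C: "CSA2 (target f)" and p: "1 \<le> p" "p < length us"
    and t: "(split_value f a, map (on_actions f) us, split_value f b) \<in> trans (target f)"
  shows "split_value f (Mid a us p b) \<in> states (target f)"
    "(split_value f a, map (on_actions f) (take p us), split_value f (Mid a us p b)) \<in> trans
        (target f)"
    "(split_value f (Mid a us p b), map (on_actions f) (drop p us), split_value f b) \<in> trans
        (target f)"
    "\<And>\<nu>. \<nu> \<in> states (target f) \<Longrightarrow> (split_value f a, map (on_actions f) (take p us), \<nu>) \<in> trans
        (target f) \<Longrightarrow>
      (\<nu>, map (on_actions f) (drop p us), split_value f b) \<in> trans (target f) \<Longrightarrow>
          split_value f (Mid a us p b) = \<nu>"
proof -
  have ex1: "\<exists>!\<nu>. \<nu> \<in> states (target f) \<and> (split_value f a, map (on_actions f) (take p us),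
      \<nu>) \<in> trans (target f) \<and>
      (\<nu>, map (on_actions f) (drop p us), split_value f b) \<in> trans (target f)"
    using C[unfolded CSA2_def, rule_format, of "map (on_actions f) us" p "split_value f a"
        "split_value f b"] p t
    by (simp add: take_map drop_map)
  from theI'[OF ex1] show "split_value f (Mid a us p b) \<in> states (target f)"
    "(split_value f a, map (on_actions f) (take p us), split_value f (Mid a us p b)) \<in> trans
        (target f)"
    "(split_value f (Mid a us p b), map (on_actions f) (drop p us), split_value f b) \<in> trans
        (target f)"
    by simp_all
  show "split_value f (Mid a us p b) = \<nu>" if "\<nu> \<in> states (target f)"
    "(split_value f a, map (on_actions f) (take p us), \<nu>) \<in> trans (target f)"
    "(\<nu>, map (on_actions f) (drop p us), split_value f b) \<in> trans (target f)" for \<nu>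
    using the1_equality[OF ex1, of \<nu>] that by simp
qed

lemma split_value_in_states:
  assumes "t \<in> split_terms X P" "f \<in> P" "f \<in> tmor X (target f)" "CSA2 (target f)"
  shows "split_value f t \<in> states (target f)"
  using assms(1)
proof cases
  case (Gen s)
  then show ?thesis using tmorD(1)[OF assms(3)] by simp
next
  case (Mid a b us p)
  then show ?thesis using split_value_Mid(1)[OF assms(4) Mid(5,6) Mid(7)[OF assms(2)]] by simp
qed

lemma small_split_terms:
  assumes U: "universe TYPE('u)" and X: "pre_tsystem \<Sigma> (X :: ('u, 'a) tsystem)"
  shows "small TYPE('u) (split_terms X P)"
proof -
  \<comment> \<open>\<open>T n\<close> consists of terms nested at most \<open>n\<close> deep, without the condition on \<open>Mid\<close>.\<close>
  define T where "T = rec_nat (Gen ` states X)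
    (\<lambda>_ T. T \<union> (\<lambda>((a, us), (p, b)). Mid a us p b) ` ((T \<times> lists (actions X)) \<times> ((UNIV :: nat set)
        \<times> T)))"
  have T: "T 0 = Gen ` states X" "\<And>n. T (Suc n) = T n \<union>
      (\<lambda>((a, us), (p, b)). Mid a us p b) ` ((T n \<times> lists (actions X)) \<times> ((UNIV :: nat set) \<times> T n))"
    by (simp_all add: T_def)
  have sX: "small TYPE('u) (states X)" "small TYPE('u) (actions X)" using X
      by (auto simp: pre_tsystem_def)
  have "small TYPE('u) (T n)" for n
  proof (induction n)
    case 0
    then show ?case unfolding T by (intro small_image sX)
  next
    case (Suc n)
    have "small TYPE('u) (\<Union>b\<in>(UNIV :: bool set). if b then T n else
        (\<lambda>((a, us), (p, b)). Mid a us p b) ` ((T n \<times> lists (actions X)) \<times> ((UNIV :: nat set) \<times> T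
            n)))"
    proof (rule small_UN[OF U small_finite[OF U]])
      show "small TYPE('u) (if b then T n else
        (\<lambda>((a, us), (p, b)). Mid a us p b) ` ((T n \<times> lists (actions X)) \<times> ((UNIV :: nat set) \<times> T
            n)))" for b
        using Suc by (cases b) (simp_all add: small_image small_Sigma U small_lists sX small_nat)
    qed simp
    then show ?case unfolding T by (simp add: UNIV_bool Un_commute)
  qed
  then have s: "small TYPE('u) (\<Union>n. T n)" by (intro small_UN[OF U small_nat[OF U]])
  have mono: "T m \<subseteq> T n" if "m \<le> n" for m n
    using lift_Suc_mono_le[of T m n] T(2) that by auto
  have "t \<in> (\<Union>n. T n)" if "t \<in> split_terms X P" for t
    using that
  proof induction
    case (Gen s)
    then have "Gen s \<in> T 0" unfolding T by blast
    then show ?case by blast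
  next
    case (Mid a b us p)
    then obtain m n where "a \<in> T m" "b \<in> T n" by blast
    then have ab: "a \<in> T (max m n)" "b \<in> T (max m n)"
        using mono[of m "max m n"] mono[of n "max m n"] by auto
    have "Mid a us p b \<in> (\<lambda>((a, us), (p, b)). Mid a us p b) `
        ((T (max m n) \<times> lists (actions X)) \<times> ((UNIV :: nat set) \<times> T (max m n)))"
      by (rule image_eqI[of _ _ "((a, us), (p, b))"]) (use ab Mid(3) in auto)
    then have "Mid a us p b \<in> T (Suc (max m n))" unfolding T by blast
    then show ?case by blast
  qed
  then show ?thesis using small_subset[OF s] by blast
qed

text \<open>The reflection is the joint image of the split terms under all morphisms from \<open>X\<close> to higher
  dimensional transition systems. The terms \<open>Mid a us p b\<close> provide the intermediate states. They
  are also the reason for uniqueness: a morphism out of the reflection has to preserve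
  intermediate states, hence is determined by its values on the states and actions of \<open>X\<close>.\<close>

lemma hdts_reflection:
  fixes X :: "('u, 'a) tsystem"
  assumes U: "universe TYPE('u)" and X: "weak_hdts \<Sigma> X"
  shows "\<exists>R \<eta>. is_reflection (HDTS \<Sigma>) (WHDTS \<Sigma>) X R \<eta>"
proof -
  have pX: "pre_tsystem \<Sigma> X" using X by (simp add: weak_hdts_def)
  let ?P = "{f. f \<in> tmor X (target f) \<and> hdts \<Sigma> (target f)}"
  let ?V = "split_terms X ?P"
  have C2: "CSA2 (target f)" if "f \<in> ?P" for f using that by (simp add: hdts_def)
  have sM: "small TYPE('u) (actions X)" using pX by (simp add: pre_tsystem_def)
  obtain Z :: "('u, 'a) tsystem" and qs qa \<pi> where Z: "pre_tsystem \<Sigma> Z" "states Z = qs ` ?V"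
      "actions Z = qa ` actions X"
    and l: "\<And>m. m \<in> actions X \<Longrightarrow> label Z (qa m) = label X m"
    and pi: "\<And>p. p \<in> ?P \<Longrightarrow> \<pi> p \<in> tmor Z (target p)"
    and ev: "\<And>p t. p \<in> ?P \<Longrightarrow> t \<in> ?V \<Longrightarrow> on_states (\<pi> p) (qs t) = split_value p t"
    and act: "\<And>p m. p \<in> ?P \<Longrightarrow> m \<in> actions X \<Longrightarrow> on_actions (\<pi> p) (qa m) = on_actions p m"
    and init: "initial_along UNIV Z (\<pi> ` ?P)" and mono: "jointly_monic Z (\<pi> ` ?P)"
  proof (rule joint_image[OF small_split_terms[OF U pX] sM, where P = ?P and tg = target and \<Sigma> =
      \<Sigma> and
        ev = split_value and act = on_actions and lab = "label X"])
    show "label X m \<in> \<Sigma>" if "m \<in> actions X" for m using pre_tsystem_label[OF pX that] .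
    show "split_value p t \<in> states (target p)" if "p \<in> ?P" "t \<in> ?V" for p t
      using split_value_in_states[OF that(2,1) _ C2[OF that(1)]] that(1) by simp
    show "on_actions p m \<in> actions (target p)" "label (target p) (on_actions p m) = label X m"
      if "p \<in> ?P" "m \<in> actions X" for p m
      using that tmorD(2,3)[of p X "target p" m] by auto
  qed blast
  have tgt: "target (\<pi> p) = target p" if "p \<in> ?P" for p using tmorD(6)[OF pi[OF that]] .
  have transI: "(qs a, map qa us, qs b) \<in> trans Z"
    if "a \<in> ?V" "b \<in> ?V" "set us \<subseteq> actions X" "us \<noteq> []"
      "\<And>f. f \<in> ?P \<Longrightarrow> (split_value f a, map (on_actions f) us, split_value f b) \<in> trans (target f)"
          for a us b
  proof (rule initial_alongI[OF init])
    fix \<rho> assume "\<rho> \<in> \<pi> ` ?P"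
    then obtain f where f: "f \<in> ?P" "\<rho> = \<pi> f" by blast
    have m: "map (on_actions \<rho>) (map qa us) = map (on_actions f) us"
      using act[OF f(1)] that(3) f(2) by auto
    show "(on_states \<rho> (qs a), map (on_actions \<rho>) (map qa us), on_states \<rho> (qs b)) \<in> trans (target
        \<rho>)"
      unfolding m using that(5)[OF f(1)] ev[OF f(1)] that(1,2) f(2) tgt[OF f(1)] by simp
  qed (use that Z in auto)
  have transD: "\<exists>a b ms. \<alpha> = qs a \<and> \<beta> = qs b \<and> us = map qa ms \<and> a \<in> ?V \<and> b \<in> ?V \<and>
      set ms \<subseteq> actions X \<and>
      (\<forall>f\<in>?P. (split_value f a, map (on_actions f) ms, split_value f b) \<in> trans (target f))"
    if t: "(\<alpha>, us, \<beta>) \<in> trans Z" for \<alpha> us \<beta>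
  proof -
    note d = initial_alongD[OF init t]
    obtain a b where ab: "a \<in> ?V" "b \<in> ?V" "\<alpha> = qs a" "\<beta> = qs b" using d(1,2) Z(2) by blast
    have "us \<in> lists (qa ` actions X)" using d(3) Z(3) by auto
    then obtain ms where ms: "us = map qa ms" "set ms \<subseteq> actions X" unfolding lists_image by auto
    have "(split_value f a, map (on_actions f) ms, split_value f b) \<in> trans (target f)"
        if f: "f \<in> ?P" for f
    proof -
      have "map (on_actions (\<pi> f)) us = map (on_actions f) ms" using act[OF f] ms by auto
      then show ?thesis using d(6)[of "\<pi> f"] f ev[OF f] ab tgt[OF f] by auto
    qed
    then show ?thesis using ab ms by blast
  qed
  have ms: "multiset_axiom Z"
    by (rule multiset_axiom_initial[OF init]) (use tgt in \<open>auto simp: hdts_def\<close>)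
  have "CSA1 Z"
    by (rule CSA1_initial[OF Z(1) init mono]) (use tgt pi in \<open>auto simp: hdts_def\<close>)
  moreover have "CSA3 Z"
    by (rule CSA3_initial[OF init mono]) (use tgt in \<open>auto simp: hdts_def\<close>)
  moreover have "CSA2 Z"
  proof (rule CSA2_initial[OF init mono _ ms])
    show "\<rho> \<in> tmor Z (target \<rho>) \<and> CSA2 (target \<rho>)" if "\<rho> \<in> \<pi> ` ?P" for \<rho>
      using that tgt pi by (auto simp: hdts_def)
    fix \<alpha> us \<beta> p assume t: "(\<alpha>, us, \<beta>) \<in> trans Z" and p: "1 \<le> p" "p < length us"
    obtain a b ms where ab: "\<alpha> = qs a" "\<beta> = qs b" "us = map qa ms" "a \<in> ?V" "b \<in> ?V"
        "set ms \<subseteq> actions X"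
      and f: "\<And>f. f \<in> ?P \<Longrightarrow> (split_value f a, map (on_actions f) ms, split_value f b) \<in> trans
          (target f)"
      using transD[OF t] by blast
    have p': "p < length ms" using p(2) ab(3) by simp
    have m: "Mid a ms p b \<in> ?V" by (rule split_terms.Mid[OF ab(4-6) p(1) p' f])
    have "(on_states \<rho> \<alpha>, map (on_actions \<rho>) (take p us), on_states \<rho> (qs (Mid a ms p b))) \<in> trans
        (target \<rho>) \<and>
        (on_states \<rho> (qs (Mid a ms p b)), map (on_actions \<rho>) (drop p us), on_states \<rho> \<beta>) \<in> trans
            (target \<rho>)"
      if "\<rho> \<in> \<pi> ` ?P" for \<rho>
    proof -
      obtain g where g: "g \<in> ?P" "\<rho> = \<pi> g" using \<open>\<rho> \<in> \<pi> ` ?P\<close> by blast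
      have e: "map (on_actions \<rho>) us = map (on_actions g) ms" using act[OF g(1)] ab(3,6) g(2)
          by auto
      note s = split_value_Mid[OF C2[OF g(1)] p(1) p' f[OF g(1)]]
      show ?thesis
        using s(2,3) ev[OF g(1)] ab m g(2) tgt[OF g(1)] e
        by (simp del: split_value.simps map_map add: take_map[symmetric] drop_map[symmetric])
    qed
    then show "\<exists>\<nu>\<in>states Z. \<forall>\<pi>\<in>\<pi> ` ?P. (on_states \<pi> \<alpha>, map (on_actions \<pi>) (take p us), on_states \<pi>
        \<nu>) \<in> trans (target \<pi>) \<and>
        (on_states \<pi> \<nu>, map (on_actions \<pi>) (drop p us), on_states \<pi> \<beta>) \<in> trans (target \<pi>)"
      using m Z(2) by blast
  qed
  ultimately have hZ: "hdts \<Sigma> Z" using Z(1) ms by (simp add: hdts_def)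
  let ?\<eta> = "tmap X Z (\<lambda>s. qs (Gen s)) qa"
  have eta: "?\<eta> \<in> tmor X Z"
  proof (rule tmap_in_tmor[OF pX])
    fix \<alpha> us \<beta> assume t: "(\<alpha>, us, \<beta>) \<in> trans X"
    show "(qs (Gen \<alpha>), map qa us, qs (Gen \<beta>)) \<in> trans Z"
      by (rule transI)
        (use pre_tsystem_trans[OF pX t] tmorD(4)[OF _ t] in \<open>auto intro: split_terms.Gen\<close>)
  qed (use Z l in \<open>auto intro: split_terms.Gen\<close>)
  have "is_reflection (HDTS \<Sigma>) (WHDTS \<Sigma>) X Z ?\<eta>"
    unfolding is_reflection_def
  proof (intro conjI ballI)
    have wZ: "weak_hdts \<Sigma> Z" using hdts_imp_weak_hdts[OF hZ] .
    show "Z \<in> Ob (HDTS \<Sigma>)" using hZ by (simp add: HDTS_def)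
    show "?\<eta> \<in> Hom (WHDTS \<Sigma>) X Z" using X wZ eta by (simp add: WHDTS_def Hom_tsystem_cat)
    fix Y f assume Y0: "Y \<in> Ob (HDTS \<Sigma>)" and f0: "f \<in> Hom (WHDTS \<Sigma>) X Y"
    have Y: "hdts \<Sigma> Y" using Y0 by (simp add: HDTS_def)
    have f: "f \<in> tmor X Y" using f0 by (simp add: WHDTS_def Hom_tsystem_cat split: if_splits)
    have tf: "target f = Y" using tmorD(6)[OF f] .
    have P: "f \<in> ?P" using f Y tf by simp
    have pif: "\<pi> f \<in> tmor Z Y" using pi[OF P] tf by simp
    have comp_iff: "Comp (WHDTS \<Sigma>) g ?\<eta> = f \<longleftrightarrow> (\<forall>x\<in>states X. on_states g (qs (Gen x)) = on_states f
        x) \<and>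
        (\<forall>u\<in>actions X. on_actions g (qa u) = on_actions f u)" if "g \<in> tmor Z Y" for g
      using Comp_eq_iff[OF pX eta that f] by (simp add: WHDTS_def)
    show "\<exists>!g. g \<in> Hom (HDTS \<Sigma>) Z Y \<and> Comp (WHDTS \<Sigma>) g ?\<eta> = f"
    proof (rule ex1I[of _ "\<pi> f"])
      show "\<pi> f \<in> Hom (HDTS \<Sigma>) Z Y \<and> Comp (WHDTS \<Sigma>) (\<pi> f) ?\<eta> = f"
        using pif hZ Y ev[OF P split_terms.Gen] act[OF P]
            by (simp add: comp_iff) (simp add: HDTS_def Hom_tsystem_cat)
      fix g assume g0: "g \<in> Hom (HDTS \<Sigma>) Z Y \<and> Comp (WHDTS \<Sigma>) g ?\<eta> = f"
      then have g: "g \<in> tmor Z Y" by (simp add: HDTS_def Hom_tsystem_cat split: if_splits)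
      have gG: "\<And>x. x \<in> states X \<Longrightarrow> on_states g (qs (Gen x)) = on_states f x"
        and ga: "\<And>u. u \<in> actions X \<Longrightarrow> on_actions g (qa u) = on_actions f u"
        using g0 comp_iff[OF g] by auto
      have gt: "on_states g (qs t) = split_value f t" if "t \<in> ?V" for t
        using that
      proof induction
        case (Gen s)
        then show ?case using gG by simp
      next
        case (Mid a b us p)
        have mV: "Mid a us p b \<in> ?V" by (rule split_terms.Mid[OF Mid.hyps])
        have tk: "set (take p us) \<subseteq> actions X" "set (drop p us) \<subseteq> actions X"
          using Mid.hyps(3) set_take_subset[of p us] set_drop_subset[of p us] by auto
        have gm: "map (on_actions g) (map qa vs) = map (on_actions f) vs" if "set vs \<subseteq> actions X"
            for vs
          using ga that by auto
        note s = split_value_Mid[OF C2 Mid.hyps(4,5) Mid.hyps(6)]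
        have "(qs a, map qa (take p us), qs (Mid a us p b)) \<in> trans Z"
          by (rule transI[OF Mid.hyps(1) mV tk(1)]) (use s(2) Mid.hyps(4,5) in auto)
        moreover have "(qs (Mid a us p b), map qa (drop p us), qs b) \<in> trans Z"
          by (rule transI[OF mV Mid.hyps(2) tk(2)]) (use s(3) Mid.hyps(4,5) in auto)
        ultimately have "(split_value f a, map (on_actions f) (take p us), on_states g (qs (Mid a
            us p b))) \<in> trans Y"
          "(on_states g (qs (Mid a us p b)), map (on_actions f) (drop p us), split_value f b) \<in>
              trans Y"
          using tmorD(4)[OF g] gm[OF tk(1)] gm[OF tk(2)] Mid.IH by metis+
        moreover have "on_states g (qs (Mid a us p b)) \<in> states Y"
          using tmorD(1)[OF g] mV Z(2) by blast
        ultimately have "split_value f (Mid a us p b) = on_states g (qs (Mid a us p b))"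
          using s(4)[OF P P] tf by metis
        then show ?case by metis
      qed
      show "g = \<pi> f"
      proof (rule tmor_eqI[OF g pif])
        show "on_states g x = on_states (\<pi> f) x" if "x \<in> states Z" for x
          using that gt ev[OF P] Z(2) by auto
        show "on_actions g u = on_actions (\<pi> f) u" if "u \<in> actions Z" for u
          using that ga act[OF P] Z(3) by auto
      qed
    qed
  qed
  then show ?thesis by blast
qed

section \<open>Weak systems are directed unions of finite ones\<close>

lemma small_inj_on:
  assumes "inj_on f A" "small TYPE('u) (f ` A)"
  shows "small TYPE('u) A"
  using small_image[OF assms(2), of "inv_into A f"] assms(1) by simp

text \<open>The connecting morphisms \<open>m i j\<close> are determined by the injective legs, which makes them
  functorial, and injectivity turns the cocone into an elementwise colimit as soon as it is
  surjective.\<close>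

lemma (in tsystems) directed_union:
  fixes I :: "'u set"
  assumes dir: "directed_poset natLeq I r" and X: "X \<in> \<O>"
    and F: "\<And>i. i \<in> I \<Longrightarrow> F i \<in> \<O>" and c: "\<And>i. i \<in> I \<Longrightarrow> c i \<in> tmor (F i) X"
    and inj: "\<And>i. i \<in> I \<Longrightarrow> inj_on (on_states (c i)) (states (F i))"
      "\<And>i. i \<in> I \<Longrightarrow> inj_on (on_actions (c i)) (actions (F i))"
    and m: "\<And>i j. (i, j) \<in> r \<Longrightarrow> m i j \<in> tmor (F i) (F j)"
    and cm: "\<And>i j x. (i, j) \<in> r \<Longrightarrow> x \<in> states (F i) \<Longrightarrow> on_states (c j) (on_states (m i j) x) =
        on_states (c i) x"
      "\<And>i j u. (i, j) \<in> r \<Longrightarrow> u \<in> actions (F i) \<Longrightarrow> on_actions (c j) (on_actions (m i j) u) =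
          on_actions (c i) u"
    and surj: "\<And>x. x \<in> states X \<Longrightarrow> \<exists>i\<in>I. \<exists>y\<in>states (F i). on_states (c i) y = x"
      "\<And>u. u \<in> actions X \<Longrightarrow> \<exists>i\<in>I. \<exists>v\<in>actions (F i). on_actions (c i) v = u"
      "\<And>\<alpha> us \<beta>. (\<alpha>, us, \<beta>) \<in> trans X \<Longrightarrow> \<exists>i\<in>I. \<exists>\<alpha>' us' \<beta>'. (\<alpha>', us', \<beta>') \<in> trans (F i) \<and>
        on_states (c i) \<alpha>' = \<alpha> \<and> map (on_actions (c i)) us' = us \<and> on_states (c i) \<beta>' = \<beta>"
  shows "\<exists>D. is_functor (poset_cat I r) \<C> D \<and> (\<forall>i\<in>I. omap D i = F i) \<and> is_colimit (poset_cat I r)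
      \<C> D X c"
proof -
  note r = directed_posetD[OF dir]
  let ?D = "\<lparr>omap = F, amap = \<lambda>a. m (fst a) (snd a)\<rparr>"
  have states_eq: "x = y" if "i \<in> I" "x \<in> states (F i)" "y \<in> states (F i)"
      "on_states (c i) x = on_states (c i) y" for i x y
    using inj(1)[OF that(1)] that(2-4) by (auto dest: inj_onD)
  have actions_eq: "x = y" if "i \<in> I" "x \<in> actions (F i)" "y \<in> actions (F i)"
      "on_actions (c i) x = on_actions (c i) y" for i x y
    using inj(2)[OF that(1)] that(2-4) by (auto dest: inj_onD)
  have D: "is_functor (poset_cat I r) \<C> ?D"
    unfolding is_functor_def
  proof (intro conjI ballI impI)
    show "category (poset_cat I r)" by (rule poset_cat_category[OF dir])
    show "category \<C>" by (rule tsystem_cat_category)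
    show "omap ?D i \<in> Ob \<C>" if "i \<in> Ob (poset_cat I r)" for i using F that by simp
    show "amap ?D a \<in> Hom \<C> (omap ?D (Dom (poset_cat I r) a)) (omap ?D (Cod (poset_cat I r) a))"
      if "a \<in> Ar (poset_cat I r)" for a
      using that m[of "fst a" "snd a"] F r(1)[of "fst a" "snd a"] by (simp add: Hom_iff)
    show "amap ?D (Id (poset_cat I r) i) = Id \<C> (omap ?D i)" if "i \<in> Ob (poset_cat I r)" for i
    proof -
      have i: "i \<in> I" "(i, i) \<in> r" using that r(2) by auto
      have "m i i = tmap (F i) (F i) id id"
      proof (rule tmor_eqI[OF m[OF i(2)] tmap_id_in_tmor[OF pre[OF F[OF i(1)]]]])
        fix x assume x: "x \<in> states (F i)"
        show "on_states (m i i) x = on_states (tmap (F i) (F i) id id) x"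
          using states_eq[OF i(1) tmorD(1)[OF m[OF i(2)] x] x] cm(1)[OF i(2) x] x by simp
      next
        fix x assume x: "x \<in> actions (F i)"
        show "on_actions (m i i) x = on_actions (tmap (F i) (F i) id id) x"
          using actions_eq[OF i(1) tmorD(2)[OF m[OF i(2)] x] x] cm(2)[OF i(2) x] x by simp
      qed
      then show ?thesis by simp
    qed
    fix a b assume ab: "a \<in> Ar (poset_cat I r)" "b \<in> Ar (poset_cat I r)"
      "Dom (poset_cat I r) b = Cod (poset_cat I r) a"
    obtain i j k where a: "a = (i, j)" "(i, j) \<in> r" and b: "b = (j, k)" "(j, k) \<in> r"
      using ab by (cases a; cases b) auto
    have ik: "(i, k) \<in> r" using r(3)[OF a(2) b(2)] .
    have I: "i \<in> I" "j \<in> I" "k \<in> I" using r(1) a(2) b(2) by auto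
    note mij = m[OF a(2)] and mjk = m[OF b(2)] and mik = m[OF ik]
    have "Comp \<C> (m j k) (m i j) = m i k"
      unfolding Comp_eq_iff[OF pre[OF F[OF I(1)]] mij mjk mik]
    proof (intro conjI ballI)
      fix x assume x: "x \<in> states (F i)"
      note y = tmorD(1)[OF mij x]
      show "on_states (m j k) (on_states (m i j) x) = on_states (m i k) x"
        using states_eq[OF I(3) tmorD(1)[OF mjk y] tmorD(1)[OF mik x]] cm(1)[OF b(2) y] cm(1)[OF
            a(2) x]
          cm(1)[OF ik x] by simp
    next
      fix x assume x: "x \<in> actions (F i)"
      note y = tmorD(2)[OF mij x]
      show "on_actions (m j k) (on_actions (m i j) x) = on_actions (m i k) x"
        using actions_eq[OF I(3) tmorD(2)[OF mjk y] tmorD(2)[OF mik x]] cm(2)[OF b(2) y] cm(2)[OF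
            a(2) x]
          cm(2)[OF ik x] by simp
    qed
    then show "amap ?D (Comp (poset_cat I r) b a) = Comp \<C> (amap ?D b) (amap ?D a)"
      by (simp add: a(1) b(1))
  qed
  interpret dd: directed_diagram \<Sigma> \<O> I r ?D by unfold_locales (use dir D in auto)
  have "elementwise_colimit I r ?D X c"
    unfolding elementwise_colimit_def
  proof (intro conjI ballI allI impI)
    show "\<exists>j. (i, j) \<in> r \<and> on_states (amap ?D (i, j)) x = on_states (amap ?D (i, j)) y"
      if "i \<in> I" "x \<in> states (omap ?D i)" "y \<in> states (omap ?D i)"
          "on_states (c i) x = on_states (c i) y" for i x y
      using states_eq[of i x y] that r(2)[OF that(1)] by auto
    show "\<exists>j. (i, j) \<in> r \<and> on_actions (amap ?D (i, j)) x = on_actions (amap ?D (i, j)) y"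
      if "i \<in> I" "x \<in> actions (omap ?D i)" "y \<in> actions (omap ?D i)"
          "on_actions (c i) x = on_actions (c i) y" for i x y
      using actions_eq[of i x y] that r(2)[OF that(1)] by auto
  qed (use c cm surj in simp_all)
  from dd.colimit_if_elementwise[OF X this] show ?thesis using D by (intro exI[of _ ?D]) simp
qed

text \<open>A finite system is encoded by finite sets, its labelling by its graph, which determines it
  because labellings are extensional.\<close>

lemma small_finite_systems:
  fixes \<Sigma> :: "'a set" and N :: "'u set"
  assumes U: "universe TYPE('u)" and Sig: "small TYPE('u) \<Sigma>" and R: "small TYPE('u) N"
  shows "small TYPE('u) {K :: ('u, 'a) tsystem. weak_hdts \<Sigma> K \<and> states K \<in> Fpow N \<and>
    actions K \<in> Fpow N \<and> finite (trans K)}" (is "small _ ?G")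
proof (rule small_inj_on)
  let ?f = "\<lambda>K :: ('u, 'a) tsystem. (states K, actions K, (\<lambda>u. (u, label K u)) ` actions K,
      trans K)"
  have pre_G: "pre_tsystem \<Sigma> K" "states K \<subseteq> N" "actions K \<subseteq> N" if "K \<in> ?G" for K
    using that by (auto simp: weak_hdts_def Fpow_def)
  have lab: "label K \<in> actions K \<rightarrow>\<^sub>E \<Sigma>" if "K \<in> ?G" for K
    using pre_G(1)[OF that] by (simp add: pre_tsystem_def)
  have tr: "trans K \<subseteq> N \<times> lists N \<times> N" if K: "K \<in> ?G" for K
  proof
    fix t assume t: "t \<in> trans K"
    obtain \<alpha> us \<beta> where t': "t = (\<alpha>, us, \<beta>)" by (cases t)
    note p = pre_tsystem_trans[OF pre_G(1)[OF K] t[unfolded t']]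
    have "\<alpha> \<in> N" "\<beta> \<in> N" "set us \<subseteq> N" using p pre_G(2,3)[OF K] by blast+
    then show "t \<in> N \<times> lists N \<times> N" unfolding t' lists_eq_set by simp
  qed
  show "inj_on ?f ?G"
  proof (rule inj_onI)
    fix K K' assume K: "K \<in> ?G" "K' \<in> ?G" "?f K = ?f K'"
    have k: "states K = states K'" "actions K = actions K'"
      "(\<lambda>u. (u, label K u)) ` actions K = (\<lambda>u. (u, label K' u)) ` actions K'" "trans K = trans K'"
      using K(3) unfolding prod.inject by blast+
    note g = k(3)[folded k(2)]
    have "label K = label K'"
    proof (rule PiE_ext[OF lab[OF K(1)]])
      show "label K' \<in> actions K \<rightarrow>\<^sub>E \<Sigma>" using lab[OF K(2)] k(2) by simp
      show "label K u = label K' u" if "u \<in> actions K" for u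
      proof -
        have "(u, label K u) \<in> (\<lambda>u. (u, label K' u)) ` actions K"
          unfolding g[symmetric] using that by (rule imageI)
        then show ?thesis by auto
      qed
    qed
    then show "K = K'" using k(1,2,4) by (cases K; cases K') simp
  qed
  have "?f ` ?G \<subseteq> Fpow N \<times> Fpow N \<times> Fpow (N \<times> \<Sigma>) \<times> Fpow (N \<times> lists N \<times> N)"
  proof
    fix z assume "z \<in> ?f ` ?G"
    then obtain K where K: "K \<in> ?G" "z = ?f K" by blast
    have "(\<lambda>u. (u, label K u)) ` actions K \<in> Fpow (N \<times> \<Sigma>)"
      using K(1) lab[OF K(1)] by (auto simp: Fpow_def)
    moreover have "trans K \<in> Fpow (N \<times> lists N \<times> N)" using K(1) tr[OF K(1)] by (simp add: Fpow_def)
    ultimately show "z \<in> Fpow N \<times> Fpow N \<times> Fpow (N \<times> \<Sigma>) \<times> Fpow (N \<times> lists N \<times> N)"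
      using K by simp
  qed
  then show "small TYPE('u) (?f ` ?G)"
    by (rule small_subset[rotated]) (intro small_Sigma small_Fpow small_lists U R Sig)
qed

text \<open>Diagrams are indexed by posets inside \<open>'u\<close>, whereas the natural index sets consist of
  tuples.\<close>

lemma small_directed_encode:
  fixes Q :: "'q set"
  assumes Q: "small TYPE('u) Q"
    and refl: "\<And>p. p \<in> Q \<Longrightarrow> le p p"
    and antisym: "\<And>p q. p \<in> Q \<Longrightarrow> q \<in> Q \<Longrightarrow> le p q \<Longrightarrow> le q p \<Longrightarrow> p = q"
    and trans: "\<And>p q s. le p q \<Longrightarrow> le q s \<Longrightarrow> le p s"
    and bound: "\<And>K. finite K \<Longrightarrow> K \<subseteq> Q \<Longrightarrow> \<exists>b\<in>Q. \<forall>k\<in>K. le k b"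
  obtains I :: "'u set" and r dec where "small TYPE('u) I" "directed_poset natLeq I r"
    "\<And>i. i \<in> I \<Longrightarrow> dec i \<in> Q" "\<And>i j. (i, j) \<in> r \<Longrightarrow> i \<in> I \<and> j \<in> I \<and> le (dec i) (dec j)"
    "\<And>p. p \<in> Q \<Longrightarrow> \<exists>i\<in>I. dec i = p"
proof -
  obtain e :: "'q \<Rightarrow> 'u" where e: "inj_on e Q" using small_encode[OF Q] .
  define dec where "dec = inv_into Q e"
  define r where "r = {(i, j). i \<in> e ` Q \<and> j \<in> e ` Q \<and> le (dec i) (dec j)}"
  have dec: "dec i \<in> Q" if "i \<in> e ` Q" for i using inv_into_into[OF that] by (simp add: dec_def)
  have inj: "inj_on dec (e ` Q)" unfolding dec_def by (rule inj_on_inv_into) simp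
  have dec_e: "dec (e p) = p" if "p \<in> Q" for p using e that by (simp add: dec_def)
  have "partial_order_on (e ` Q) r"
    unfolding partial_order_on_def preorder_on_def
  proof (intro conjI)
    show "refl_on (e ` Q) r" using refl dec by (auto intro!: refl_onI simp: r_def)
    show "antisym r"
    proof (rule antisymI)
      fix i j assume "(i, j) \<in> r" "(j, i) \<in> r"
      then have ij: "i \<in> e ` Q" "j \<in> e ` Q" and "le (dec i) (dec j)" "le (dec j) (dec i)"
        by (auto simp: r_def)
      then have "dec i = dec j" using antisym dec by blast
      then show "i = j" using inj_onD[OF inj] ij by blast
    qed
    show "Relation.trans r" by (rule transI) (use trans in \<open>auto simp: r_def\<close>)
  qed (auto simp: r_def)
  moreover have "\<exists>b\<in>e ` Q. \<forall>k\<in>K. (k, b) \<in> r" if K: "K \<subseteq> e ` Q" "|K| <o natLeq" for K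
  proof -
    have "finite (dec ` K)" using K(2) finite_iff_ordLess_natLeq by blast
    moreover have "dec ` K \<subseteq> Q" using K(1) dec by blast
    ultimately obtain b where b: "b \<in> Q" "\<forall>k\<in>dec ` K. le k b" using bound by metis
    then have "(k, e b) \<in> r" if "k \<in> K" for k using that K(1) dec_e[OF b(1)] by (auto simp: r_def)
    then show ?thesis using b(1) by blast
  qed
  ultimately have dir: "directed_poset natLeq (e ` Q) r" by (simp add: directed_poset_def)
  have rE: "i \<in> e ` Q \<and> j \<in> e ` Q \<and> le (dec i) (dec j)" if "(i, j) \<in> r" for i j
    using that by (simp add: r_def)
  have "\<exists>i\<in>e ` Q. dec i = p" if "p \<in> Q" for p using dec_e that by blast
  from that[OF small_image[OF Q] dir dec rE this] show ?thesis .
qed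

text \<open>A morphism into \<open>X\<close> factors through an initial \<open>g\<close> when its image lies in that of \<open>g\<close> and
  the lengths of its transitions belong to \<open>N\<close>.\<close>

lemma factor_through_initial:
  assumes F: "pre_tsystem \<Sigma> F" and f: "f \<in> tmor F X" and g: "g \<in> tmor G X" and init:
      "initial_along N G {g}"
    and im: "on_states f ` states F \<subseteq> on_states g ` states G"
        "on_actions f ` actions F \<subseteq> on_actions g ` actions G"
    and N: "\<And>\<alpha> us \<beta>. (\<alpha>, us, \<beta>) \<in> trans F \<Longrightarrow> length us \<in> N"
  shows "\<exists>m\<in>tmor F G. (\<forall>x\<in>states F. on_states g (on_states m x) = on_states f x) \<and>
    (\<forall>u\<in>actions F. on_actions g (on_actions m u) = on_actions f u)"
proof -
  define s where "s x = inv_into (states G) (on_states g) (on_states f x)" for x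
  define a where "a u = inv_into (actions G) (on_actions g) (on_actions f u)" for u
  have s: "s x \<in> states G" "on_states g (s x) = on_states f x" if "x \<in> states F" for x
  proof -
    have "on_states f x \<in> on_states g ` states G" using im(1) that by blast
    then show "s x \<in> states G" "on_states g (s x) = on_states f x"
      unfolding s_def by (rule inv_into_into, rule f_inv_into_f)
  qed
  have a: "a u \<in> actions G" "on_actions g (a u) = on_actions f u" if "u \<in> actions F" for u
  proof -
    have "on_actions f u \<in> on_actions g ` actions G" using im(2) that by blast
    then show "a u \<in> actions G" "on_actions g (a u) = on_actions f u"
      unfolding a_def by (rule inv_into_into, rule f_inv_into_f)
  qed
  have "tmap F G s a \<in> tmor F G"
  proof (rule tmap_in_tmor[OF F])
    show "label G (a u) = label F u" if "u \<in> actions F" for u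
      using tmorD(3)[OF g a(1)[OF that]] tmorD(3)[OF f that] a(2)[OF that] by simp
    fix \<alpha> us \<beta> assume t: "(\<alpha>, us, \<beta>) \<in> trans F"
    note p = pre_tsystem_trans[OF F t]
    have "on_actions g (a u) = on_actions f u" if "u \<in> set us" for u using a(2) p(3) that by blast
    then have m: "map (on_actions g) (map a us) = map (on_actions f) us" by simp
    show "(s \<alpha>, map a us, s \<beta>) \<in> trans G"
    proof (rule initial_alongI[OF init])
      show "set (map a us) \<subseteq> actions G" using a(1) p(3) by auto
      show "(on_states \<pi> (s \<alpha>), map (on_actions \<pi>) (map a us), on_states \<pi> (s \<beta>)) \<in> trans (target
          \<pi>)"
        if "\<pi> \<in> {g}" for \<pi>
        using that tmorD(4)[OF f t] tmorD(6)[OF g] m s(2)[OF p(1)] s(2)[OF p(2)]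
            by (simp del: map_map)
    qed (use s p N[OF t] in auto)
  qed (use s a in auto)
  then show ?thesis using s(2) a(2) by (intro bexI[of _ "tmap F G s a"]) simp_all
qed

text \<open>The piece of \<open>X\<close> with states \<open>S\<close>, actions \<open>A\<close> and all transitions of length at most \<open>n\<close>,
  copied to an initial segment of the range of \<open>\<nu>\<close>. The bound on the length makes it finite. It is
  initial along the inclusion into \<open>X\<close>, and the axioms of weak systems only infer transitions that
  are not longer than the given ones, so it is again a weak system.\<close>

lemma finite_piece:
  fixes X :: "('u, 'a) tsystem" and \<nu> :: "nat \<Rightarrow> 'u"
  assumes U: "universe TYPE('u)" and nu: "inj \<nu>" and X: "weak_hdts \<Sigma> X"
    and S: "S \<in> Fpow (states X)" and A: "A \<in> Fpow (actions X)"
  shows "\<exists>F f. weak_hdts \<Sigma> F \<and> states F \<in> Fpow (range \<nu>) \<and> actions F \<in> Fpow (range \<nu>) \<and>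
    finite (trans F) \<and> f \<in> tmor F X \<and> bij_betw (on_states f) (states F) S \<and>
    bij_betw (on_actions f) (actions F) A \<and> initial_along {..n} F {f}"
proof -
  have pX: "pre_tsystem \<Sigma> X" using X by (simp add: weak_hdts_def)
  have bij: "\<exists>g. bij_betw g (\<nu> ` {..<card B}) B" if "finite B" for B :: "'u set"
    by (rule finite_same_card_bij[OF _ that])
      (use nu in \<open>simp_all add: card_image inj_on_subset\<close>)
  have "finite S" "finite A" using S A by (auto simp: Fpow_def)
  from bij[OF this(1)] bij[OF this(2)]
  obtain g h where g: "bij_betw g (\<nu> ` {..<card S}) S" and h: "bij_betw h (\<nu> ` {..<card A}) A"
      by auto
  define F where "F = \<lparr>states = \<nu> ` {..<card S}, actions = \<nu> ` {..<card A},
     label = (\<lambda>u\<in>\<nu> ` {..<card A}. label X (h u)),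
     trans = {(\<alpha>, us, \<beta>). \<alpha> \<in> \<nu> ` {..<card S} \<and> \<beta> \<in> \<nu> ` {..<card S} \<and>
       us \<in> lists (\<nu> ` {..<card A}) \<and> us \<noteq> [] \<and> length us \<in> {..n} \<and> (g \<alpha>, map h us, g \<beta>) \<in> trans
           X}\<rparr>"
  have F: "states F = \<nu> ` {..<card S}" "actions F = \<nu> ` {..<card A}"
    "\<And>u. u \<in> actions F \<Longrightarrow> label F u = label X (h u)"
    "\<And>\<alpha> us \<beta>. (\<alpha>, us, \<beta>) \<in> trans F \<longleftrightarrow> \<alpha> \<in> states F \<and> \<beta> \<in> states F \<and> us \<in> lists (actions F) \<and>
       us \<noteq> [] \<and> length us \<in> {..n} \<and> (g \<alpha>, map h us, g \<beta>) \<in> trans X"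
    by (simp_all add: F_def)
  have gX: "g x \<in> states X" if "x \<in> states F" for x
    using bij_betw_apply[OF g that[unfolded F]] S by (auto simp: Fpow_def)
  have hX: "h u \<in> actions X" if "u \<in> actions F" for u
    using bij_betw_apply[OF h that[unfolded F]] A by (auto simp: Fpow_def)
  have fin: "finite (states F)" "finite (actions F)" by (simp_all add: F)
  have pF: "pre_tsystem \<Sigma> F"
    unfolding pre_tsystem_def
  proof (intro conjI)
    show "small TYPE('u) (states F)" "small TYPE('u) (actions F)"
      using fin small_finite[OF U] by auto
    have "label X (h u) \<in> \<Sigma>" if "u \<in> actions F" for u
      using pre_tsystem_label[OF pX hX[OF that]] .
    then show "label F \<in> actions F \<rightarrow>\<^sub>E \<Sigma>" by (auto simp: F_def)
  qed (auto simp: F_def)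
  define f where "f = tmap F X g h"
  have f: "f \<in> tmor F X"
    unfolding f_def by (rule tmap_in_tmor[OF pF]) (use gX hX F(3,4) in auto)
  have ap: "\<And>x. x \<in> states F \<Longrightarrow> on_states f x = g x" "\<And>u. u \<in> actions F \<Longrightarrow> on_actions f u = h u"
    by (simp_all add: f_def)
  have init: "initial_along {..n} F {f}"
    unfolding initial_along_def
  proof (intro allI)
    fix \<alpha> us \<beta>
    have "(on_states f \<alpha>, map (on_actions f) us, on_states f \<beta>) = (g \<alpha>, map h us, g \<beta>)"
      if "\<alpha> \<in> states F" "\<beta> \<in> states F" "us \<in> lists (actions F)"
      using that ap by auto
    then show "(\<alpha>, us, \<beta>) \<in> trans F \<longleftrightarrow> \<alpha> \<in> states F \<and> \<beta> \<in> states F \<and> us \<in> lists (actions F) \<and>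
        us \<noteq> [] \<and> length us \<in> {..n} \<and>
        (\<forall>\<pi>\<in>{f}. (on_states \<pi> \<alpha>, map (on_actions \<pi>) us, on_states \<pi> \<beta>) \<in> trans (target \<pi>))"
      unfolding F(4) using tmorD(6)[OF f] by (metis singleton_iff)
  qed
  have "weak_hdts \<Sigma> F"
    by (rule weak_hdts_initial[OF pF init]) (use X tmorD(6)[OF f] in auto)
  moreover have "finite (trans F)"
  proof (rule finite_subset)
    show "trans F \<subseteq> states F \<times> {us. set us \<subseteq> actions F \<and> length us \<le> n} \<times> states F"
      by (auto simp: F_def)
  qed (intro finite_cartesian_product fin finite_lists_length_le)
  moreover have "bij_betw (on_states f) (states F) S"
    using g ap(1) unfolding F(1)[symmetric] by (simp cong: bij_betw_cong)
  moreover have "bij_betw (on_actions f) (actions F) A"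
    using h ap(2) unfolding F(2)[symmetric] by (simp cong: bij_betw_cong)
  moreover have "states F \<in> Fpow (range \<nu>)" "actions F \<in> Fpow (range \<nu>)" by (auto simp: F Fpow_def)
  ultimately show ?thesis using f init by blast
qed

text \<open>The pieces are indexed by a finite set of states, a finite set of actions and a bound for
  the lengths, ordered by inclusion and by \<open>\<le>\<close>. The order is partial, and finitely many pieces lie
  in a common one.\<close>

lemma weak_hdts_directed_union:
  fixes \<Sigma> :: "'a set" and X :: "('u, 'a) tsystem" and \<nu> :: "nat \<Rightarrow> 'u"
  assumes U: "universe TYPE('u)" and nu: "inj \<nu>" and X: "weak_hdts \<Sigma> X"
  shows "\<exists>(I :: 'u set) r D c. small TYPE('u) I \<and> directed_poset natLeq I r \<and>
    is_functor (poset_cat I r) (WHDTS \<Sigma>) D \<and>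
    (\<forall>i\<in>I. omap D i \<in> {K. weak_hdts \<Sigma> K \<and> states K \<in> Fpow (range \<nu>) \<and>
      actions K \<in> Fpow (range \<nu>) \<and> finite (trans K)}) \<and>
    is_colimit (poset_cat I r) (WHDTS \<Sigma>) D X c"
proof -
  interpret W: tsystems \<Sigma> "{X :: ('u, 'a) tsystem. weak_hdts \<Sigma> X}"
    by unfold_locales (simp add: weak_hdts_def)
  have pX: "pre_tsystem \<Sigma> X" using X by (simp add: weak_hdts_def)
  let ?Q = "Fpow (states X) \<times> Fpow (actions X) \<times> (UNIV :: nat set)"
  let ?le = "\<lambda>p q. fst p \<subseteq> fst q \<and> fst (snd p) \<subseteq> fst (snd q) \<and> snd (snd p) \<le> snd (snd q)"
  have Q: "small TYPE('u) ?Q"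
    using pX by (intro small_Sigma small_Fpow small_nat U) (auto simp: pre_tsystem_def)
  have bound: "\<exists>b\<in>?Q. \<forall>k\<in>K. ?le k b" if K: "finite K" "K \<subseteq> ?Q" for K
  proof -
    \<comment> \<open>The sum serves as a common bound for the lengths because it also exists for empty \<open>K\<close>.\<close>
    let ?b = "(\<Union>p\<in>K. fst p, \<Union>p\<in>K. fst (snd p), \<Sum>p\<in>K. snd (snd p))"
    have fpow: "fst p \<in> Fpow (states X)" "fst (snd p) \<in> Fpow (actions X)" if "p \<in> K" for p
      using K(2) that by auto
    have "(\<Union>p\<in>K. fst p) \<subseteq> states X" "(\<Union>p\<in>K. fst (snd p)) \<subseteq> actions X"
      using fpow unfolding Fpow_def by blast+
    moreover have "finite (\<Union>p\<in>K. fst p)" "finite (\<Union>p\<in>K. fst (snd p))"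
      by (intro finite_UN_I[OF K(1)]; use fpow in \<open>simp add: Fpow_def\<close>)+
    ultimately have "?b \<in> ?Q" by (simp add: Fpow_def)
    moreover have "?le p ?b" if "p \<in> K" for p
      using that member_le_sum[OF that _ K(1), of "\<lambda>p. snd (snd p)"] by auto
    ultimately show ?thesis by blast
  qed
  obtain I :: "'u set" and r dec where I: "small TYPE('u) I" and dir: "directed_poset natLeq I r"
    and dec: "\<And>i. i \<in> I \<Longrightarrow> dec i \<in> ?Q" and r: "\<And>i j. (i, j) \<in> r \<Longrightarrow> i \<in> I \<and> j \<in> I \<and>
        ?le (dec i) (dec j)"
    and cover: "\<And>p. p \<in> ?Q \<Longrightarrow> \<exists>i\<in>I. dec i = p"
  proof (rule small_directed_encode[OF Q, of ?le])
    show "\<exists>b\<in>?Q. \<forall>k\<in>K. ?le k b" if "finite K" "K \<subseteq> ?Q" for K using bound[OF that] .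
    show "?le p p" for p :: "'u set \<times> 'u set \<times> nat" by simp
    show "p = q" if "?le p q" "?le q p" for p q :: "'u set \<times> 'u set \<times> nat"
      using that by (auto simp: prod_eq_iff)
    show "?le p s" if "?le p q" "?le q s" for p q s :: "'u set \<times> 'u set \<times> nat" using that by auto
  qed blast
  let ?P = "\<lambda>i F f. weak_hdts \<Sigma> F \<and> states F \<in> Fpow (range \<nu>) \<and> actions F \<in> Fpow (range \<nu>) \<and>
    finite (trans F) \<and> f \<in> tmor F X \<and> bij_betw (on_states f) (states F) (fst (dec i)) \<and>
    bij_betw (on_actions f) (actions F) (fst (snd (dec i))) \<and> initial_along {..snd (snd (dec i))}
        F {f}"
  have "\<exists>F f. ?P i F f" if "i \<in> I" for i
    by (rule finite_piece[OF U nu X]) (use dec[OF that] in auto)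
  then obtain F f where "\<And>i. i \<in> I \<Longrightarrow> ?P i (F i) (f i)" by metis
  then have F: "\<And>i. i \<in> I \<Longrightarrow> weak_hdts \<Sigma> (F i)"
      "\<And>i. i \<in> I \<Longrightarrow> states (F i) \<in> Fpow (range \<nu>) \<and> actions (F i) \<in> Fpow (range \<nu>) \<and>
          finite (trans (F i))"
    and f: "\<And>i. i \<in> I \<Longrightarrow> f i \<in> tmor (F i) X"
    and fs: "\<And>i. i \<in> I \<Longrightarrow> bij_betw (on_states (f i)) (states (F i)) (fst (dec i))"
    and fa: "\<And>i. i \<in> I \<Longrightarrow> bij_betw (on_actions (f i)) (actions (F i)) (fst (snd (dec i)))"
    and init: "\<And>i. i \<in> I \<Longrightarrow> initial_along {..snd (snd (dec i))} (F i) {f i}"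
    by blast+
  have "\<exists>m\<in>tmor (F i) (F j). (\<forall>x\<in>states (F i). on_states (f j) (on_states m x) = on_states (f i)
      x) \<and>
      (\<forall>u\<in>actions (F i). on_actions (f j) (on_actions m u) = on_actions (f i) u)" if ij: "(i,
          j) \<in> r" for i j
  proof -
    have i: "i \<in> I" and j: "j \<in> I" and le: "?le (dec i) (dec j)" using r[OF ij] by auto
    show ?thesis
    proof (rule factor_through_initial[OF W.pre f[OF i] f[OF j] init[OF j]])
      show "on_states (f i) ` states (F i) \<subseteq> on_states (f j) ` states (F j)"
        "on_actions (f i) ` actions (F i) \<subseteq> on_actions (f j) ` actions (F j)"
        using le unfolding bij_betw_imp_surj_on[OF fs[OF i]] bij_betw_imp_surj_on[OF fs[OF j]]
          bij_betw_imp_surj_on[OF fa[OF i]] bij_betw_imp_surj_on[OF fa[OF j]] by auto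
      show "length us \<in> {..snd (snd (dec j))}" if "(\<alpha>, us, \<beta>) \<in> trans (F i)" for \<alpha> us \<beta>
        using initial_alongD(5)[OF init[OF i] that] le by simp
    qed (use F(1)[OF i] in simp)
  qed
  then have "\<forall>i j. \<exists>m. (i, j) \<in> r \<longrightarrow> m \<in> tmor (F i) (F j) \<and>
      (\<forall>x\<in>states (F i). on_states (f j) (on_states m x) = on_states (f i) x) \<and>
      (\<forall>u\<in>actions (F i). on_actions (f j) (on_actions m u) = on_actions (f i) u)" by blast
  then obtain m where m: "\<And>i j. (i, j) \<in> r \<Longrightarrow> m i j \<in> tmor (F i) (F j) \<and>
      (\<forall>x\<in>states (F i). on_states (f j) (on_states (m i j) x) = on_states (f i) x) \<and>
      (\<forall>u\<in>actions (F i). on_actions (f j) (on_actions (m i j) u) = on_actions (f i) u)"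
    unfolding choice_iff by blast
  have "\<exists>D. is_functor (poset_cat I r) W.\<C> D \<and> (\<forall>i\<in>I. omap D i = F i) \<and> is_colimit (poset_cat I r)
      W.\<C> D X f"
  proof (rule W.directed_union[OF dir, where m = m])
    show "X \<in> {X. weak_hdts \<Sigma> X}" using X by simp
    show "F i \<in> {X. weak_hdts \<Sigma> X}" if "i \<in> I" for i using F(1)[OF that] by simp
    show "inj_on (on_states (f i)) (states (F i))" "inj_on (on_actions (f i)) (actions (F i))"
        if "i \<in> I" for i
      using bij_betw_imp_inj_on[OF fs[OF that]] bij_betw_imp_inj_on[OF fa[OF that]] by auto
    \<comment> \<open>One state or one action makes a piece by itself. A transition is found in the piece given
      by its ends, its actions and its length.\<close>
    show "\<exists>i\<in>I. \<exists>y\<in>states (F i). on_states (f i) y = x" if x: "x \<in> states X" for x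
    proof -
      obtain i where i: "i \<in> I" "dec i = ({x}, {}, 0)" using cover[of "({x}, {}, 0)"] x
          by (auto simp: Fpow_def)
      have "x \<in> on_states (f i) ` states (F i)"
          unfolding bij_betw_imp_surj_on[OF fs[OF i(1)]] i(2) by simp
      then show ?thesis using i(1) by auto
    qed
    show "\<exists>i\<in>I. \<exists>v\<in>actions (F i). on_actions (f i) v = u" if u: "u \<in> actions X" for u
    proof -
      obtain i where i: "i \<in> I" "dec i = ({}, {u}, 0)" using cover[of "({}, {u}, 0)"] u
          by (auto simp: Fpow_def)
      have "u \<in> on_actions (f i) ` actions (F i)"
          unfolding bij_betw_imp_surj_on[OF fa[OF i(1)]] i(2) by simp
      then show ?thesis using i(1) by auto
    qed
    show "\<exists>i\<in>I. \<exists>\<alpha>' us' \<beta>'. (\<alpha>', us', \<beta>') \<in> trans (F i) \<and> on_states (f i) \<alpha>' = \<alpha> \<and>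
        map (on_actions (f i)) us' = us \<and> on_states (f i) \<beta>' = \<beta>"
      if t: "(\<alpha>, us, \<beta>) \<in> trans X" for \<alpha> us \<beta>
    proof -
      note tX = pre_tsystem_trans[OF pX t]
      obtain i where i: "i \<in> I" "dec i = ({\<alpha>, \<beta>}, set us, length us)"
        using cover[of "({\<alpha>, \<beta>}, set us, length us)"] tX by (auto simp: Fpow_def)
      have im: "\<alpha> \<in> on_states (f i) ` states (F i)" "\<beta> \<in> on_states (f i) ` states (F i)"
        unfolding bij_betw_imp_surj_on[OF fs[OF i(1)]] i(2) by simp_all
      have "us \<in> lists (on_actions (f i) ` actions (F i))"
        unfolding bij_betw_imp_surj_on[OF fa[OF i(1)]] i(2) by (simp add: lists_eq_set)
      then have "us \<in> map (on_actions (f i)) ` lists (actions (F i))" unfolding lists_image .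
      then obtain \<alpha>' us' \<beta>' where w: "\<alpha>' \<in> states (F i)" "\<alpha> = on_states (f i) \<alpha>'"
          "\<beta>' \<in> states (F i)"
        "\<beta> = on_states (f i) \<beta>'" "us' \<in> lists (actions (F i))" "us = map (on_actions (f i)) us'"
        using im by blast
      have "(\<alpha>', us', \<beta>') \<in> trans (F i)"
        by (rule initial_alongI[OF init[OF i(1)]]) (use w t tX i(2) tmorD(6)[OF f[OF i(1)]] in auto)
      then show ?thesis using w i(1) by blast
    qed
  qed (use f m in auto)
  then obtain D where "is_functor (poset_cat I r) W.\<C> D" "\<And>i. i \<in> I \<Longrightarrow> omap D i = F i"
    "is_colimit (poset_cat I r) W.\<C> D X f" by blast
  then show ?thesis
    using I dir F unfolding WHDTS_def
        by (intro exI[of _ I] exI[of _ r] exI[of _ D] exI[of _ f]) simp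
qed

lemma whdts_directed_generation:
  fixes \<Sigma> :: "'a set"
  assumes U: "universe TYPE('u)" and Sig: "small TYPE('u) \<Sigma>"
    and lifting: "\<And>K. weak_hdts \<Sigma> K \<Longrightarrow> finite (states K) \<Longrightarrow> finite (actions K) \<Longrightarrow>
      finite (trans K) \<Longrightarrow>
      directed_lifting TYPE('u) (WHDTS \<Sigma> :: (('u, 'a) tsystem, ('u, 'a) tmorphism) cat) K"
  shows "directed_generation TYPE('u) (WHDTS \<Sigma> :: (('u, 'a) tsystem, ('u, 'a) tmorphism) cat)"
proof -
  obtain \<nu> :: "nat \<Rightarrow> 'u" where nu: "inj \<nu>" using universe_nat_embedding[OF U] .
  let ?G = "{K :: ('u, 'a) tsystem. weak_hdts \<Sigma> K \<and> states K \<in> Fpow (range \<nu>) \<and>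
    actions K \<in> Fpow (range \<nu>) \<and> finite (trans K)}"
  show ?thesis
    unfolding directed_generation_def
  proof (intro exI[of _ ?G] conjI ballI)
    show "small TYPE('u) ?G"
      by (intro small_finite_systems U Sig small_image small_nat)
    show "directed_lifting TYPE('u) (WHDTS \<Sigma>) K" if "K \<in> ?G" for K
      using that lifting by (simp add: Fpow_def)
    show "\<exists>(I :: 'u set) r D c. small TYPE('u) I \<and> directed_poset natLeq I r \<and>
        is_functor (poset_cat I r) (WHDTS \<Sigma>) D \<and> (\<forall>i\<in>I. omap D i \<in> ?G) \<and>
        is_colimit (poset_cat I r) (WHDTS \<Sigma>) D X c" if "X \<in> Ob (WHDTS \<Sigma>)" for X
    proof -
      have "weak_hdts \<Sigma> X" using that by (simp add: WHDTS_def)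
      then show ?thesis by (rule weak_hdts_directed_union[OF U nu])
    qed
  qed
qed

section \<open>Local presentability of both categories\<close>

text \<open>Accessibility asks for a cardinal carried by \<open>'u\<close>, and a countable subset of \<open>'u\<close> provides a
  copy of \<open>natLeq\<close> there.\<close>

lemma regular_countable_cardinal:
  assumes U: "universe TYPE('u)"
  obtains \<kappa> :: "'u rel" where "regular_cardinal \<kappa>" "\<kappa> <o |UNIV :: 'u set|" "natLeq =o \<kappa>"
proof -
  obtain \<nu> :: "nat \<Rightarrow> 'u" where nu: "inj \<nu>" using universe_nat_embedding[OF U] .
  have iso: "natLeq =o |range \<nu>|"
  proof -
    have "|UNIV :: nat set| =o |range \<nu>|"
      using nu by (auto intro!: card_of_ordIsoI[of \<nu>] simp: bij_betw_def)
    then show ?thesis using card_of_nat ordIso_symmetric ordIso_transitive by metis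
  qed
  have "Cinfinite natLeq" "regularCard natLeq"
    using natLeq_Cinfinite regularCard_natLeq by auto
  then have "regular_cardinal |range \<nu>|"
    unfolding regular_cardinal_def using iso Cinfinite_cong regularCard_ordIso by blast
  moreover have "|range \<nu>| <o |UNIV :: 'u set|"
    using small_image[OF small_nat[OF U], of \<nu> UNIV] by (simp add: small_def)
  ultimately show ?thesis using that iso by blast
qed

theorem corollary5p8:
  fixes \<Sigma> :: "'a set"
  assumes "universe TYPE('u)"
    and "\<Sigma> \<noteq> {}" and "small TYPE('u) \<Sigma>"
  shows "full_reflective_subcategory (HDTS \<Sigma> :: (('u, 'a) tsystem, ('u, 'a) tmorphism) cat) (WHDTS \<Sigma>)
    \<and> locally_finitely_presentable TYPE('u) (HDTS \<Sigma> :: (('u, 'a) tsystem, ('u, 'a) tmorphism) cat)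
    \<and> limit_preserving TYPE('u)
         (HDTS \<Sigma> :: (('u, 'a) tsystem, ('u, 'a) tmorphism) cat) (WHDTS \<Sigma>) inclusion
    \<and> accessible TYPE('u)
         (HDTS \<Sigma> :: (('u, 'a) tsystem, ('u, 'a) tmorphism) cat) (WHDTS \<Sigma>) inclusion"
proof -
  let ?H = "HDTS \<Sigma> :: (('u, 'a) tsystem, ('u, 'a) tmorphism) cat"
  let ?W = "WHDTS \<Sigma> :: (('u, 'a) tsystem, ('u, 'a) tmorphism) cat"
  note U = assms(1)
  interpret W: tsystems \<Sigma> "{X :: ('u, 'a) tsystem. weak_hdts \<Sigma> X}"
    by unfold_locales (simp add: weak_hdts_def)
  interpret H: tsystems \<Sigma> "{X :: ('u, 'a) tsystem. hdts \<Sigma> X}"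
    by unfold_locales (simp add: hdts_def)
  have W_closed: "Z \<in> {X. weak_hdts \<Sigma> X}"
    if dd: "directed_diagram \<Sigma> {X. weak_hdts \<Sigma> X} I r D" and Z: "pre_tsystem \<Sigma> Z"
        "elementwise_colimit I r D Z e"
    for I :: "'u set" and r D e and Z :: "('u, 'a) tsystem"
    using directed_diagram.weak_hdts_elementwise[OF dd Z] directed_diagram.D_ob[OF dd] by simp
  have H_closed: "Z \<in> {X. hdts \<Sigma> X}"
    if dd: "directed_diagram \<Sigma> {X. hdts \<Sigma> X} I r D" and Z: "pre_tsystem \<Sigma> Z"
        "elementwise_colimit I r D Z e"
    for I :: "'u set" and r D e and Z :: "('u, 'a) tsystem"
    using directed_diagram.hdts_elementwise[OF dd Z] directed_diagram.D_ob[OF dd] by simp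
  have "full_subcategory ?H ?W"
    unfolding full_subcategory_def HDTS_def WHDTS_def
    using H.tsystem_cat_category W.tsystem_cat_category hdts_imp_weak_hdts
    by (auto simp: Hom_tsystem_cat) (simp_all add: tsystem_cat_def)
  moreover have "\<exists>R \<eta>. is_reflection ?H ?W X R \<eta>" if "X \<in> Ob ?W" for X
  proof -
    have "weak_hdts \<Sigma> X" using that by (simp add: WHDTS_def)
    then show ?thesis by (rule hdts_reflection[OF U])
  qed
  ultimately have refl: "full_reflective_subcategory ?H ?W"
      by (simp add: full_reflective_subcategory_def)
  then interpret R: full_reflective ?H ?W by unfold_locales
  have incl: "preserves_directed_colimits TYPE('u) natLeq ?H ?W inclusion"
    unfolding preserves_directed_colimits_def R.comp_inclusion R.inclusion_simps
  proof (intro allI impI, elim conjE)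
    fix I :: "'u set" and r D X c
    assume I: "small TYPE('u) I" and dir: "directed_poset natLeq I r" and D: "is_functor
        (poset_cat I r) ?H D"
      and X: "is_colimit (poset_cat I r) ?H D X c"
    interpret DH: directed_diagram \<Sigma> "{X. hdts \<Sigma> X}" I r D
      by unfold_locales (use dir D in \<open>simp_all add: HDTS_def\<close>)
    interpret DW: directed_diagram \<Sigma> "{X. weak_hdts \<Sigma> X}" I r D
      by unfold_locales (use dir R.functor_into_B[OF D] in \<open>simp_all add: WHDTS_def\<close>)
    have el: "elementwise_colimit I r D X c"
      by (rule DH.elementwise_if_colimit[OF U I]) (use H_closed[OF DH.directed_diagram_axioms] X
          in \<open>auto simp: HDTS_def\<close>)
    have "X \<in> {X. weak_hdts \<Sigma> X}"
      using X hdts_imp_weak_hdts by (auto simp: is_colimit_def cocone_def HDTS_def)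
    from DW.colimit_if_elementwise[OF this el] show "is_colimit (poset_cat I r) ?W D X c"
        by (simp add: WHDTS_def)
  qed
  have "directed_lifting TYPE('u) ?W K"
    if "weak_hdts \<Sigma> K" "finite (states K)" "finite (actions K)" "finite (trans K)" for K
    using W.finite_directed_lifting[OF U W_closed, where K = K] that by (simp add: WHDTS_def)
  then have genW: "directed_generation TYPE('u) ?W"
      by (rule whdts_directed_generation[OF U assms(3)])
  have cocW: "cocomplete TYPE('u) ?W"
    unfolding WHDTS_def
  proof (rule W.cocomplete_if_initial_closed[OF U])
    fix Z :: "('u, 'a) tsystem" and Q
    assume Z: "pre_tsystem \<Sigma> Z" "initial_along UNIV Z Q" "\<And>\<pi>. \<pi> \<in> Q \<Longrightarrow> target \<pi> \<in> {X. weak_hdts \<Sigma> X}"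
    have "weak_hdts \<Sigma> Z" by (rule weak_hdts_initial[OF Z(1,2)]) (use Z(3) in auto)
    then show "Z \<in> {X. weak_hdts \<Sigma> X}" by simp
  qed
  have lpW: "locally_presentable_at TYPE('u) natLeq ?W"
    by (rule locally_presentable_if_directed_generation[OF R.B.category_axioms cocW genW])
  have lpH: "locally_presentable_at TYPE('u) natLeq ?H"
    by (rule locally_presentable_if_directed_generation[OF R.A.category_axioms
          R.cocomplete_subcategory[OF cocW] R.directed_generation_subcategory[OF genW incl]])
  obtain \<kappa> :: "'u rel" where k: "regular_cardinal \<kappa>" "\<kappa> <o |UNIV :: 'u set|" "natLeq =o \<kappa>"
    using regular_countable_cardinal[OF U] .
  have "locally_presentable TYPE('u) ?W" "locally_presentable TYPE('u) ?H"
    unfolding locally_presentable_def using k locally_presentable_at_cong[OF k(3)] lpW lpH by blast+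
  moreover have "preserves_directed_colimits TYPE('u) \<kappa> ?H ?W inclusion"
    using incl preserves_directed_colimits_cong[OF k(3)] by blast
  ultimately have "accessible TYPE('u) ?H ?W inclusion"
    unfolding accessible_def using R.inclusion_functor k by blast
  then show ?thesis
    using refl lpH R.inclusion_preserves_limits by (simp add: locally_finitely_presentable_def)
qed

end
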